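(* Let $d\ge 3$ be an integer, let $A$ be the $d\times 2d$ matrix with columns $a_1,\dots,a_{2d}$ given by $$a_1=e_1,\quad a_2=e_1+e_d,\quad a_3=e_1+3e_d,\quad a_4=e_1+4e_d,$$ $$a_{2k-1}=e_1+e_{k-1},\qquad a_{2k}=e_1+e_{k-1}+e_d\qquad (3\le k\le d),$$ where $e_1,\dots,e_d$ are the standard basis vectors, and let $\beta=(1,0,\dots,0,2)=e_1+2e_d\in\mathbb{C}^d$. Then $$\operatorname{rank}(H_A(\beta))-\operatorname{vol}(A)\ \ge\ d-1 .$$
   Context: For an integer $d\times n$ matrix $A=(a_{i,j})$ of full rank $d$ and $\beta\in\mathbb{C}^d$: write $\partial_j=\partial/\partial x_j$ and use multi-index notation. For $u\in\mathbb{Z}^n$ write $u=u_+-u_-$ with $(u_+)_i=\max\{u_i,0\}$, $(u_-)_i=\max\{-u_i,0\}$. Let $\ker_{\mathbb{Z}}(A)=\{u\in\mathbb{Z}^n: Au=0\}$. The $A$-hypergeometric system $H_A(\beta)$ is the system of linear partial differential equations for a function $\varphi=\varphi(x_1,\dots,x_n)$ consisting of the homogeneity equations $\sum_{j=1}^n a_{i,j}x_j\partial_j\varphi=\beta_i\varphi$ for $i=1,\dots,d$, and the toric equations $\partial^{u_+}\varphi=\partial^{u_-}\varphi$ for all $u\in\ker_{\mathbb{Z}}(A)$. The rank $\operatorname{rank}(H_A(\beta))$ is the dimension of the complex vector space of holomorphic solutions of $H_A(\beta)$ on a nonempty simply connected open subset of $\mathbb{C}^n$ avoiding the singular locus of the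 system. (There is a nonzero polynomial $h$ in $x_1,\dots,x_n$ such that this dimension is finite and the same for all nonempty simply connected open subsets of $\{h\ne 0\}$; the rank is this common value.) The simplicial (normalized) volume $\operatorname{vol}(A)$ is $d!$ times the Euclidean volume of the convex hull in $\mathbb{R}^d$ of the origin and the columns of $A$. *)

theory Defs
  imports "HOL-Analysis.Analysis" "HOL-Library.Function_Algebras"
begin

definition holomorphic_on_Cn :: "(complex^'n \<Rightarrow> complex) \<Rightarrow> (complex^'n) set \<Rightarrow> bool" where
  "holomorphic_on_Cn f U \<longleftrightarrow>
     (\<forall>x\<in>U. \<exists>D. (f has_derivative D) (at x) \<and> (\<forall>c v. D (c *s v) = c * D v))"

definition pd :: "'n \<Rightarrow> (complex^'n \<Rightarrow> complex) \<Rightarrow> complex^'n \<Rightarrow> complex" where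
  "pd j f x = deriv (\<lambda>z. f (\<chi> i. if i = j then z else x $ i)) (x $ j)"

text \<open>The index type carries no order, so the iterated derivative runs through its elements in
  an arbitrary fixed order. On an open set where \<open>f\<close> is holomorphic, the partial derivatives
  commute and the result does not depend on this order.\<close>

definition multi_pd :: "('n::finite \<Rightarrow> nat) \<Rightarrow> (complex^'n \<Rightarrow> complex) \<Rightarrow> complex^'n \<Rightarrow> complex" where
  "multi_pd \<alpha> f =
     foldr (\<lambda>j. pd j ^^ \<alpha> j) (SOME js. distinct js \<and> set js = (UNIV :: 'n set)) f"

text \<open>Functions on \<open>U\<close> are represented by total functions that are \<open>0\<close> outside \<open>U\<close>, so that
  two solutions are equal iff they agree on \<open>U\<close>.\<close>

definition hypergeometric_solutions ::
  "int^'n^'d \<Rightarrow> complex^'d \<Rightarrow> (complex^'n) set \<Rightarrow> (complex^'n \<Rightarrow> complex) set" where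
  "hypergeometric_solutions A \<beta> U = {\<phi>.
     holomorphic_on_Cn \<phi> U \<and> (\<forall>x. x \<notin> U \<longrightarrow> \<phi> x = 0) \<and>
     (\<forall>i. \<forall>x\<in>U. (\<Sum>j\<in>UNIV. of_int (A $ i $ j) * x $ j * pd j \<phi> x) = \<beta> $ i * \<phi> x) \<and>
     (\<forall>u. A *v u = 0 \<longrightarrow>
        (\<forall>x\<in>U. multi_pd (\<lambda>i. nat (u $ i)) \<phi> x = multi_pd (\<lambda>i. nat (- (u $ i))) \<phi> x))}"

interpretation cfun: vector_space "\<lambda>(c::complex) (f :: 'a \<Rightarrow> complex) x. c * f x"
  by unfold_locales (auto simp: fun_eq_iff algebra_simps)

definition has_finite_dim :: "('a \<Rightarrow> complex) set \<Rightarrow> nat \<Rightarrow> bool" where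
  "has_finite_dim V r \<longleftrightarrow>
     (\<exists>B. finite B \<and> card B = r \<and> cfun.independent B \<and> cfun.span B = V)"

definition polynomial_on_Cn :: "(complex^'n \<Rightarrow> complex) \<Rightarrow> bool" where
  "polynomial_on_Cn h \<longleftrightarrow>
     (\<exists>(S :: ('n \<Rightarrow> nat) set) c. finite S \<and>
        h = (\<lambda>x. \<Sum>\<alpha>\<in>S. c \<alpha> * (\<Prod>i\<in>UNIV. (x $ i) ^ \<alpha> i)))"

definition hypergeometric_rank :: "int^'n^'d \<Rightarrow> complex^'d \<Rightarrow> nat" where
  "hypergeometric_rank A \<beta> = (THE r. \<exists>h. polynomial_on_Cn h \<and> h \<noteq> (\<lambda>_. 0) \<and>
     (\<forall>U. open U \<and> U \<noteq> {} \<and> simply_connected U \<and> U \<subseteq> {x. h x \<noteq> 0} \<longrightarrow>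
        has_finite_dim (hypergeometric_solutions A \<beta> U) r))"

definition simplicial_volume :: "int^'n^'d \<Rightarrow> real" where
  "simplicial_volume A = fact CARD('d) *
     measure lebesgue (convex hull (insert 0 (range (\<lambda>j. \<chi> i. real_of_int (A $ i $ j)))) :: (real^'d) set)"

end

theory Submission
  imports Defs "HOL-Complex_Analysis.Cauchy_Integral_Formula"
begin

text \<open>
  Write \<open>f(t) = x1 + x2 t + x3 t^3 + x4 t^4\<close> for the first four variables and \<open>a_k + b_k t\<close>, with
  \<open>3 \<le> k \<le> d\<close>, for the remaining pairs. Off the zeros of one explicit polynomial the solution space on every
  simply connected open set has dimension \<open>2d + 1\<close>, whereas the volume is at most \<open>d + 2\<close>.

  Solutions come from the function \<open>\<Phi>(t) = - x1/(2 t^2) - x2/t + x3 t + x4 t^2/2\<close>, an antiderivative of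
  \<open>f(t)/t^3\<close>; it has no logarithmic term because \<open>t^2\<close> does not occur in \<open>f\<close>. Its values at the four roots of
  \<open>f\<close> and at the zeros \<open>- a_k/b_k\<close> are solutions, as expected from Euler integrals. The same gap in the exponents
  has two further effects: \<open>x2^2/x1\<close> is a solution by itself, and the value at \<open>- a_k/b_k\<close> splits into its
  parts with negative and with positive powers of \<open>t\<close>, both of which are solutions. This gives
  \<open>4 + 1 + 2 (d - 2) = 2d + 1\<close> solutions, \<open>d - 1\<close> more than the volume.

  The rank is by definition the common dimension, so completeness of this list has to be shown as well. Let
  \<open>\<phi>\<close> be any solution. The quadratic and cubic toric equations and the homogeneity relations force
  \<open>\<partial>\<phi>/\<partial>b_k\<close> to be linear in \<open>x1, \<dots>, x4\<close> (\<open>mixed_blocks\<close>, \<open>block_second\<close>) and then to depend on two constants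
  only (\<open>block_constants\<close>). Subtracting the corresponding rational solutions leaves a function of
  \<open>x1, \<dots>, x4\<close>. It has nine second derivatives \<open>G_0, \<dots>, G_8\<close>, one for each total exponent, and the Euler
  relations of the first derivatives are four of the five instances of the linear recurrence with characteristic
  polynomial \<open>f\<close>. The fifth one, which would belong to the missing exponent 2, holds up to a constant
  (\<open>R_constant\<close>), and a multiple of \<open>x2^2/x1\<close> removes this constant. Then the \<open>G_m\<close> are combinations of powers of the roots,
  and the remaining equations make the coefficients constant (\<open>block_free_span\<close>). Since no exponent equals the
  degree 2, second derivatives determine a solution (\<open>zero_if_second_derivatives_zero\<close>).

  Global branches of the roots on a simply connected set come from the classical formulas in radicals,
  because nonvanishing functions on such sets have holomorphic logarithms (\<open>quartic_root_functions\<close>). The convex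
  hull is a Cayley polytope over segments of lengths 4, 1, \<dots>, 1; after a shear it lies below the graph of a
  linear form over a simplex and is cut into slices that are images of standard simplices (\<open>hull_volume\<close>).
\<close>

section \<open>Holomorphic functions of several variables\<close>

abbreviation slice :: "complex^'n \<Rightarrow> 'n \<Rightarrow> complex \<Rightarrow> complex^'n" where
  "slice x j z \<equiv> (\<chi> i. if i = j then z else x $ i)"

lemma slice_eq: "slice x j z = x + axis j (z - x $ j)"
  by (auto simp: vec_eq_iff axis_def)

lemma slice_self [simp]: "slice x j (x $ j) = x"
  by (auto simp: vec_eq_iff)

lemma norm_axis [simp]: "norm (axis j (c::complex) :: complex^'n) = norm c"
proof -
  have "norm (axis j c :: complex^'n) = L2_set (\<lambda>i. if i = j then norm c else 0) UNIV"
    by (simp add: norm_vec_def axis_def if_distrib cong: if_cong)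
  moreover have "\<dots> = norm c"
    by (simp add: L2_set_def if_distrib[of "\<lambda>z. z\<^sup>2"] cong: if_cong)
  ultimately show ?thesis by simp
qed

lemma has_derivative_slice:
  fixes x :: "complex^'n"
  shows "((\<lambda>z. slice x j z) has_derivative (\<lambda>h. axis j h)) (at z)"
proof -
  have "linear (\<lambda>h. axis j h :: complex^'n)"
    by (rule linearI) (auto simp: vec_eq_iff axis_def)
  then have "bounded_linear (\<lambda>h. axis j h :: complex^'n)"
    by (simp add: linear_linear)
  moreover have "(\<lambda>z. slice x j z) = (\<lambda>z. (x - axis j (x$j)) + axis j z)"
    by (auto simp: vec_eq_iff axis_def)
  ultimately show ?thesis
    by (auto intro!: derivative_eq_intros bounded_linear_imp_has_derivative)
qed

lemma vec_eq_sum_axis: "(v :: complex^'n) = (\<Sum>k\<in>UNIV. v $ k *s axis k (1::complex))"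
  by (auto simp: vec_eq_iff axis_def if_distrib cong: if_cong)

text \<open>A complex linear differential is determined by its values on the unit vectors, and these are the
  derivatives along the coordinate lines.\<close>

lemma holo_has_derivative:
  fixes f :: "complex^'n \<Rightarrow> complex"
  assumes "holomorphic_on_Cn f U" "x \<in> U"
  shows "(f has_derivative (\<lambda>v. \<Sum>k\<in>UNIV. v $ k * pd k f x)) (at x)"
    and "((\<lambda>z. f (slice x j z)) has_field_derivative pd j f x) (at (x $ j))"
proof -
  obtain D where D: "(f has_derivative D) (at x)" and lin: "\<And>c v. D (c *s v) = c * D v"
    using assms unfolding holomorphic_on_Cn_def by blast
  have sl: "((\<lambda>z. f (slice x j z)) has_field_derivative D (axis j 1)) (at (x $ j))" for j
  proof -
    have "((\<lambda>z. f (slice x j z)) has_derivative (\<lambda>h. D (axis j h))) (at (x $ j))"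
      using has_derivative_compose[OF has_derivative_slice[where x = x and j = j and z = "x$j"], of f D] D by simp
    moreover have "D (axis j h) = D (axis j 1) * h" for h
    proof -
      have "axis j h = h *s (axis j 1 :: complex^'n)" by (auto simp: vec_eq_iff axis_def)
      then show ?thesis using lin by (metis mult.commute)
    qed
    then have "(\<lambda>h. D (axis j h)) = (*) (D (axis j 1))" by (rule ext)
    ultimately show ?thesis unfolding has_field_derivative_def by (simp only:)
  qed
  have pd: "pd j f x = D (axis j 1)" for j
    unfolding pd_def using DERIV_imp_deriv[OF sl] by simp
  show "((\<lambda>z. f (slice x j z)) has_field_derivative pd j f x) (at (x $ j))"
    using sl pd by simp
  have "linear D" using D has_derivative_linear by blast
  have "D v = (\<Sum>k\<in>UNIV. v $ k * pd k f x)" for v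
  proof -
    have "D v = D (\<Sum>k\<in>UNIV. v $ k *s axis k (1::complex))" using vec_eq_sum_axis[of v] by simp
    also have "\<dots> = (\<Sum>k\<in>UNIV. D (v $ k *s axis k (1::complex)))"
      using \<open>linear D\<close> by (simp add: linear_sum)
    finally show ?thesis using lin pd by simp
  qed
  then have "D = (\<lambda>v. \<Sum>k\<in>UNIV. v $ k * pd k f x)" by (rule ext)
  then show "(f has_derivative (\<lambda>v. \<Sum>k\<in>UNIV. v $ k * pd k f x)) (at x)"
    using D by simp
qed

lemma pd_eqI:
  assumes "((\<lambda>z. f (slice x j z)) has_field_derivative D) (at (x $ j))"
  shows "pd j f x = D"
  unfolding pd_def using DERIV_imp_deriv[OF assms] .

lemma holo_continuous_on:
  assumes "holomorphic_on_Cn f U" shows "continuous_on U f"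
  using assms has_derivative_continuous
  by (fastforce simp: holomorphic_on_Cn_def intro: continuous_at_imp_continuous_on)

lemma holo_subset: "holomorphic_on_Cn f U \<Longrightarrow> V \<subseteq> U \<Longrightarrow> holomorphic_on_Cn f V"
  by (auto simp: holomorphic_on_Cn_def)

lemma holo_cong:
  assumes "holomorphic_on_Cn f U" "open U" "\<And>x. x \<in> U \<Longrightarrow> f x = g x"
  shows "holomorphic_on_Cn g U"
  unfolding holomorphic_on_Cn_def
proof
  fix x assume "x \<in> U"
  then obtain D where "(f has_derivative D) (at x)" "\<And>c v. D (c *s v) = c * D v"
    using assms unfolding holomorphic_on_Cn_def by blast
  then show "\<exists>D. (g has_derivative D) (at x) \<and> (\<forall>c v. D (c *s v) = c * D v)"
    using has_derivative_transform_within_open[of f D x UNIV U g] assms(2,3) \<open>x \<in> U\<close> by auto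
qed

lemma pd_cong:
  assumes "open U" "x \<in> U" "\<And>x. x \<in> U \<Longrightarrow> f x = g x"
  shows "pd j f x = pd j g x"
  unfolding pd_def
proof (rule deriv_cong_ev)
  have "isCont (slice x j) (x $ j)"
    using has_derivative_continuous[OF has_derivative_slice] by blast
  then have "((slice x j) \<longlongrightarrow> x) (nhds (x$j))"
    unfolding continuous_at tendsto_at_iff_tendsto_nhds[of "slice x j"] by simp
  then have "eventually (\<lambda>z. slice x j z \<in> U) (nhds (x $ j))"
    using assms(1,2) by (simp add: topological_tendstoD)
  then show "\<forall>\<^sub>F z in nhds (x $ j). f (slice x j z) = g (slice x j z)"
    by (rule eventually_mono) (use assms in auto)
qed simp

lemma holo_const [intro!]: "holomorphic_on_Cn (\<lambda>x. c) U"
  unfolding holomorphic_on_Cn_def by (auto intro!: exI[of _ "\<lambda>_. 0"])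

lemma holo_coord [intro!]: "holomorphic_on_Cn (\<lambda>x. x $ j) U"
  unfolding holomorphic_on_Cn_def
  by (auto intro!: exI[of _ "\<lambda>v. v $ j"] bounded_linear_imp_has_derivative bounded_linear_vec_nth)

lemma holo_add [intro]:
  assumes "holomorphic_on_Cn f U" "holomorphic_on_Cn g U"
  shows "holomorphic_on_Cn (\<lambda>x. f x + g x) U"
  unfolding holomorphic_on_Cn_def
proof
  fix x assume "x \<in> U"
  then obtain D E where "(f has_derivative D) (at x)" "\<And>c v. D (c *s v) = c * D v"
    "(g has_derivative E) (at x)" "\<And>c v. E (c *s v) = c * E v"
    using assms unfolding holomorphic_on_Cn_def by metis
  then show "\<exists>D. ((\<lambda>x. f x + g x) has_derivative D) (at x) \<and> (\<forall>c v. D (c *s v) = c * D v)"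
    by (intro exI[of _ "\<lambda>v. D v + E v"]) (auto intro!: has_derivative_add simp: algebra_simps)
qed

lemma holo_mult [intro]:
  assumes "holomorphic_on_Cn f U" "holomorphic_on_Cn g U"
  shows "holomorphic_on_Cn (\<lambda>x. f x * g x) U"
  unfolding holomorphic_on_Cn_def
proof
  fix x assume "x \<in> U"
  then obtain D E where "(f has_derivative D) (at x)" "\<And>c v. D (c *s v) = c * D v"
    "(g has_derivative E) (at x)" "\<And>c v. E (c *s v) = c * E v"
    using assms unfolding holomorphic_on_Cn_def by metis
  then show "\<exists>D. ((\<lambda>x. f x * g x) has_derivative D) (at x) \<and> (\<forall>c v. D (c *s v) = c * D v)"
    by (intro exI[of _ "\<lambda>v. f x * E v + D v * g x"] conjI has_derivative_mult) (auto simp: algebra_simps)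
qed

lemma holo_compose:
  assumes "holomorphic_on_Cn f U" "\<And>x. x \<in> U \<Longrightarrow> \<exists>d. (g has_field_derivative d) (at (f x))"
  shows "holomorphic_on_Cn (\<lambda>x. g (f x)) U"
  unfolding holomorphic_on_Cn_def
proof
  fix x assume x: "x \<in> U"
  then obtain D where D: "(f has_derivative D) (at x)" "\<And>c v. D (c *s v) = c * D v"
    using assms unfolding holomorphic_on_Cn_def by metis
  obtain d where "(g has_field_derivative d) (at (f x))" using assms(2) x by blast
  then have "((\<lambda>x. g (f x)) has_derivative (\<lambda>v. d * D v)) (at x)"
    using has_derivative_compose[OF D(1)] by (simp add: has_field_derivative_def)
  then show "\<exists>D. ((\<lambda>x. g (f x)) has_derivative D) (at x) \<and> (\<forall>c v. D (c *s v) = c * D v)"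
    using D(2) by (intro exI[of _ "\<lambda>v. d * D v"]) auto
qed

lemma holo_uminus [intro]: "holomorphic_on_Cn f U \<Longrightarrow> holomorphic_on_Cn (\<lambda>x. - f x) U"
  using holo_mult[OF holo_const[of "-1" U]] by simp

lemma holo_diff [intro]:
  assumes "holomorphic_on_Cn f U" "holomorphic_on_Cn g U"
  shows "holomorphic_on_Cn (\<lambda>x. f x - g x) U"
  using holo_add[OF assms(1) holo_uminus[OF assms(2)]] by simp

lemma holo_power [intro]:
  "holomorphic_on_Cn f U \<Longrightarrow> holomorphic_on_Cn (\<lambda>x. f x ^ n) U"
  by (induction n) auto

lemma holo_divide [intro]:
  assumes "holomorphic_on_Cn f U" "holomorphic_on_Cn g U" "\<And>x. x \<in> U \<Longrightarrow> g x \<noteq> 0"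
  shows "holomorphic_on_Cn (\<lambda>x. f x / g x) U"
proof -
  have "holomorphic_on_Cn (\<lambda>x. inverse (g x)) U"
  proof (rule holo_compose[OF assms(2)])
    fix x assume "x \<in> U"
    then show "\<exists>d. (inverse has_field_derivative d) (at (g x))"
      using DERIV_inverse assms(3) by blast
  qed
  from holo_mult[OF assms(1) this] show ?thesis by (simp add: divide_inverse)
qed

lemma pd_const [simp]: "pd j (\<lambda>x. c) x = 0"
  by (rule pd_eqI) simp

lemma pd_coord: "pd j (\<lambda>x. x $ i) x = (if i = j then 1 else 0)"
  by (rule pd_eqI) auto

context
  fixes f g :: "complex^'n \<Rightarrow> complex" and U x
  assumes f: "holomorphic_on_Cn f U" and g: "holomorphic_on_Cn g U" and x: "x \<in> U"
begin

lemma pd_add: "pd j (\<lambda>x. f x + g x) x = pd j f x + pd j g x"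
  by (rule pd_eqI) (intro DERIV_add holo_has_derivative(2)[OF f x] holo_has_derivative(2)[OF g x])

lemma pd_mult: "pd j (\<lambda>x. f x * g x) x = pd j f x * g x + f x * pd j g x"
  using DERIV_mult[OF holo_has_derivative(2)[OF f x, of j] holo_has_derivative(2)[OF g x, of j]]
  by (intro pd_eqI) (simp add: algebra_simps)

lemma pd_cmult: "pd j (\<lambda>x. c * f x) x = c * pd j f x"
  by (rule pd_eqI) (intro DERIV_cmult holo_has_derivative(2)[OF f x])

end

lemma pd_sum:
  assumes "\<And>i. i \<in> I \<Longrightarrow> holomorphic_on_Cn (f i) U" "x \<in> U"
  shows "pd j (\<lambda>x. \<Sum>i\<in>I. f i x) x = (\<Sum>i\<in>I. pd j (f i) x)"
  by (rule pd_eqI) (intro DERIV_sum holo_has_derivative(2)[OF assms(1) assms(2)])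

text \<open>The circle of radius \<open>r\<close> about the origin, parametrised over the unit interval, so that contour
  integrals become integrals over a fixed compact interval.\<close>

definition circ :: "real \<Rightarrow> real \<Rightarrow> complex" where
  "circ r t = of_real r * exp (\<i> * of_real (2 * pi * t))"

text \<open>Cauchy's formula for the derivative, applied on one coordinate line. The factor \<open>2 \<pi> \<i>\<close> and one
  power of the denominator cancel against the velocity of the circle.\<close>

lemma pd_Cauchy:
  fixes f :: "complex^'n \<Rightarrow> complex"
  assumes f: "holomorphic_on_Cn f U" and r: "r > 0"
    and sub: "cball x r \<subseteq> U"
  shows "((\<lambda>t. f (x + axis j (circ r t)) / circ r t) has_integral pd j f x) (cbox 0 1)"
proof -
  have xU: "x \<in> U" using sub r by auto
  have inU: "slice x j z \<in> U" if "z \<in> cball (x $ j) r" for z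
  proof -
    have "dist x (slice x j z) = norm (z - x $ j)"
      by (simp add: slice_eq dist_norm norm_axis)
    then show ?thesis using that sub by (auto simp: dist_norm norm_minus_commute)
  qed
  define h where "h = (\<lambda>z. f (slice x j z))"
  have hd: "h field_differentiable (at z)" if "z \<in> cball (x $ j) r" for z
  proof -
    have "((\<lambda>w. f (slice (slice x j z) j w)) has_field_derivative pd j f (slice x j z)) (at (slice x j z $ j))"
      using holo_has_derivative(2)[OF f inU[OF that]] .
    moreover have "slice (slice x j z) j w = slice x j w" for w by (auto simp: vec_eq_iff)
    ultimately show ?thesis by (auto simp: h_def field_differentiable_def)
  qed
  have c: "continuous_on (cball (x $ j) r) h"
    using field_differentiable_imp_continuous_at[OF hd] by (rule continuous_at_imp_continuous_on[OF ballI])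
  have hol: "h holomorphic_on ball (x $ j) r"
    unfolding holomorphic_on_def
  proof
    fix z assume "z \<in> ball (x $ j) r"
    then have "z \<in> cball (x $ j) r" by auto
    from hd[OF this] show "h field_differentiable at z within ball (x $ j) r"
      by (rule field_differentiable_at_within)
  qed
  note C = Cauchy_derivative_integral_circlepath[OF c hol, of "x $ j"]
  have "pd j f x = 1 / (2 * of_real pi * \<i>) * contour_integral (circlepath (x $ j) r) (\<lambda>u. h u / (u - x $ j)\<^sup>2)"
    using C(2) r by (intro pd_eqI) (auto simp: h_def)
  moreover have "((\<lambda>u. h u / (u - x $ j)\<^sup>2) has_contour_integral
     contour_integral (circlepath (x $ j) r) (\<lambda>u. h u / (u - x $ j)\<^sup>2)) (circlepath (x $ j) r)"
    using C(1) r by (auto intro: has_contour_integral_integral)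
  ultimately have "((\<lambda>u. 1 / (2 * of_real pi * \<i>) * (h u / (u - x $ j)\<^sup>2)) has_contour_integral pd j f x) (circlepath (x $ j) r)"
    using has_contour_integral_lmul[of _ _ _ "1 / (2 * of_real pi * \<i>)"] by (simp only:)
  then have I: "((\<lambda>t. 1 / (2 * of_real pi * \<i>) * (h (circlepath (x $ j) r t) / (circlepath (x $ j) r t - x $ j)\<^sup>2) *
       vector_derivative (circlepath (x $ j) r) (at t within {0..1})) has_integral pd j f x) {0..1}"
    by (simp add: has_contour_integral_def)
  show ?thesis unfolding cbox_interval
  proof (rule has_integral_eq[OF _ I])
    fix t :: real assume t: "t \<in> {0..1}"
    have cp: "circlepath (x $ j) r t = x $ j + circ r t"
      by (simp add: circlepath circ_def algebra_simps)
    have "vector_derivative (circlepath (x $ j) r) (at t within {0..1}) = 2 * of_real pi * \<i> * circ r t"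
      using t by (simp add: vector_derivative_circlepath01 circ_def algebra_simps)
    moreover have "circ r t \<noteq> 0" using r by (simp add: circ_def)
    moreover have "h (x $ j + circ r t) = f (x + axis j (circ r t))" by (simp add: h_def slice_eq)
    ultimately show "1 / (2 * of_real pi * \<i>) * (h (circlepath (x $ j) r t) / (circlepath (x $ j) r t - x $ j)\<^sup>2) *
       vector_derivative (circlepath (x $ j) r) (at t within {0..1}) = f (x + axis j (circ r t)) / circ r t"
      unfolding cp by (simp add: field_simps power2_eq_square)
  qed
qed

lemma axis_circ_continuous:
  "continuous_on S (\<lambda>p::(complex^'n) \<times> real. fst p + axis j (circ r (snd p)))"
proof -
  have "(\<lambda>p::(complex^'n) \<times> real. fst p + axis j (circ r (snd p))) =
     (\<lambda>p. fst p + circ r (snd p) *s axis j 1)"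
    by (auto simp: vec_eq_iff axis_def fun_eq_iff)
  moreover have "continuous_on S (\<lambda>p::(complex^'n) \<times> real. \<chi> i. (fst p)$i + circ r (snd p) * axis j 1 $ i)"
    unfolding circ_def by (intro continuous_intros continuous_on_vec_lambda)
  moreover have "(\<lambda>p::(complex^'n) \<times> real. fst p + circ r (snd p) *s axis j 1) =
      (\<lambda>p. \<chi> i. (fst p)$i + circ r (snd p) * axis j 1 $ i)"
    by (simp add: vec_eq_iff fun_eq_iff)
  ultimately show ?thesis by (simp only:)
qed

text \<open>The radius is the same for all points near \<open>x0\<close>; this uniformity is what permits passing limits and
  derivatives through the Cauchy integral.\<close>

lemma Cauchy_kernel_continuous:
  fixes f :: "complex^'n \<Rightarrow> complex"
  assumes f: "continuous_on U f" and r: "r > 0"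
    and sub: "cball x0 (2 * r) \<subseteq> U"
  shows "continuous_on (ball x0 r \<times> cbox 0 1) (\<lambda>(x,t). f (x + axis j (circ r t)) / circ r t)"
proof -
  have "x + axis j (circ r t) \<in> U" if "x \<in> ball x0 r" for x t
  proof -
    have "norm (circ r t) = r" using r by (simp add: circ_def norm_mult)
    then have "dist x (x + axis j (circ r t)) = r" by (simp add: dist_norm norm_axis)
    then have "dist x0 (x + axis j (circ r t)) < 2 * r"
      using that dist_triangle[of x0 "x + axis j (circ r t)" x] by simp
    then show ?thesis using sub by auto
  qed
  then have "continuous_on (ball x0 r \<times> cbox 0 1) (\<lambda>p. f (fst p + axis j (circ r (snd p))))"
    by (intro continuous_on_compose2[OF f axis_circ_continuous]) auto
  moreover have "continuous_on (ball x0 r \<times> cbox 0 1) (\<lambda>p::(complex^'n) \<times> real. circ r (snd p))"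
    unfolding circ_def by (intro continuous_intros)
  ultimately show ?thesis unfolding case_prod_beta
    using r by (intro continuous_on_divide) (auto simp: circ_def)
qed

lemma pd_continuous_on:
  assumes f: "holomorphic_on_Cn f U" and U: "open U"
  shows "continuous_on U (pd j f)"
proof (rule continuous_at_imp_continuous_on, rule)
  fix x0 assume "x0 \<in> U"
  then obtain R where "R > 0" "cball x0 R \<subseteq> U" using U open_contains_cball by blast
  define r where "r = R/2"
  have r: "r > 0" "cball x0 (2 * r) \<subseteq> U" using \<open>R > 0\<close> \<open>cball x0 R \<subseteq> U\<close> by (auto simp: r_def)
  have "continuous_on (ball x0 r) (\<lambda>x. integral (cbox 0 1) (\<lambda>t. f (x + axis j (circ r t)) / circ r t))"
    by (rule integral_continuous_on_param Cauchy_kernel_continuous[OF holo_continuous_on[OF f] r])+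
  moreover have "integral (cbox 0 1) (\<lambda>t. f (x + axis j (circ r t)) / circ r t) = pd j f x" if "x \<in> ball x0 r" for x
  proof -
    have "cball x r \<subseteq> U" using that r(2) cball_subset_cball_iff[of x r x0 "2*r"] by (auto simp: dist_commute)
    then show ?thesis using pd_Cauchy[OF f r(1), of x j] by (auto intro: integral_unique)
  qed
  ultimately have "continuous_on (ball x0 r) (pd j f)" by (subst continuous_on_cong[OF refl, symmetric])
  then show "isCont (pd j f) x0" using r(1) by (simp add: continuous_on_eq_continuous_at)
qed

text \<open>Differentiating the Cauchy integral under the integral sign replaces \<open>f\<close> by its gradient, which is
  continuous by the preceding lemma. The differential obtained is complex linear, and its coefficients are the
  Cauchy integrals of the partial derivatives; smoothness and the symmetry of second derivatives
  both follow from this one formula.\<close>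

lemma pd_has_derivative_Cauchy:
  fixes f :: "complex^'n \<Rightarrow> complex"
  assumes f: "holomorphic_on_Cn f U" and U: "open U" and x0: "x0 \<in> U"
  obtains r where "r > 0" "cball x0 r \<subseteq> U"
    "(pd j f has_derivative (\<lambda>v. \<Sum>k\<in>UNIV. v $ k *
        integral (cbox 0 1) (\<lambda>t. pd k f (x0 + axis j (circ r t)) / circ r t))) (at x0)"
proof -
  obtain R where "R > 0" "cball x0 R \<subseteq> U" using U x0 open_contains_cball by blast
  define r where "r = R/2"
  have r: "r > 0" "cball x0 (2 * r) \<subseteq> U" using \<open>R > 0\<close> \<open>cball x0 R \<subseteq> U\<close> by (auto simp: r_def)
  define B where "B = ball x0 r"
  have sub: "cball x r \<subseteq> U" if "x \<in> B" for x
    using that r(2) cball_subset_cball_iff[of x r x0 "2*r"] by (auto simp: dist_commute B_def)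
  define K where "K = (\<lambda>x t. f (x + axis j (circ r t)) / circ r t)"
  define L where "L = (\<lambda>k x t. pd k f (x + axis j (circ r t)) / circ r t)"
  define E where "E = (\<lambda>x t (v::complex^'n). \<Sum>k\<in>UNIV. v $ k * L k x t)"
  have bl: "bounded_linear (E x t)" for x t
  proof -
    have "linear (E x t)" unfolding E_def
      by (rule linearI) (auto simp: algebra_simps sum.distrib scaleR_sum_right sum_distrib_left)
    then show ?thesis by (simp add: linear_linear)
  qed
  have Eapp: "blinfun_apply (Blinfun (E x t)) = E x t" for x t
    using bl by (simp add: bounded_linear_Blinfun_apply)
  have inU: "x + axis j (circ r t) \<in> U" if "x \<in> B" for x t
  proof -
    have "norm (circ r t) = r" using r by (simp add: circ_def norm_mult)
    then have "dist x (x + axis j (circ r t)) = r" by (simp add: dist_norm norm_axis)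
    then show ?thesis using sub[OF that] by auto
  qed
  have LC: "continuous_on (B \<times> cbox 0 1) (\<lambda>(x,t). L k x t)" for k
    unfolding L_def B_def by (rule Cauchy_kernel_continuous[OF pd_continuous_on[OF f U] r])
  have EC: "continuous_on (B \<times> cbox 0 1) (\<lambda>(x,t). Blinfun (E x t))"
  proof (rule continuous_on_blinfun_componentwise)
    fix i :: "complex^'n"
    show "continuous_on (B \<times> cbox 0 1) (\<lambda>p. blinfun_apply (case p of (x,t) \<Rightarrow> Blinfun (E x t)) i)"
      unfolding case_prod_beta Eapp unfolding E_def
      using LC by (intro continuous_intros) (simp add: case_prod_beta)
  qed
  have KD: "((\<lambda>x. K x t) has_derivative blinfun_apply (Blinfun (E x t))) (at x within B)"
    if "x \<in> B" for x t
  proof -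
    have "((\<lambda>y. y + axis j (circ r t)) has_derivative (\<lambda>v. v)) (at x)"
      by (auto intro!: derivative_eq_intros)
    from has_derivative_compose[OF this holo_has_derivative(1)[OF f inU[OF that, of t]]]
    have "((\<lambda>y. f (y + axis j (circ r t)) * (1 / circ r t)) has_derivative
        (\<lambda>v. (\<Sum>k\<in>UNIV. v $ k * pd k f (x + axis j (circ r t))) * (1 / circ r t))) (at x)"
      by (intro has_derivative_mult_left) simp
    moreover have "(\<lambda>v. (\<Sum>k\<in>UNIV. v $ k * pd k f (x + axis j (circ r t))) * (1 / circ r t)) = E x t"
      by (auto simp: E_def L_def sum_distrib_right sum_divide_distrib)
    ultimately have "((\<lambda>y. f (y + axis j (circ r t)) * (1 / circ r t)) has_derivative (E x t)) (at x within B)"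
      using has_derivative_at_withinI by metis
    then show ?thesis unfolding Eapp by (simp add: K_def)
  qed
  have KI: "(K x has_integral pd j f x) (cbox 0 1)" if "x \<in> B" for x
    unfolding K_def by (rule pd_Cauchy[OF f r(1) sub[OF that]])
  have x0B: "x0 \<in> B" using r by (simp add: B_def)
  have "((\<lambda>x. integral (cbox 0 1) (K x)) has_derivative
      integral (cbox 0 1) (\<lambda>t. Blinfun (E x0 t))) (at x0 within B)"
    by (rule leibniz_rule[OF KD _ EC x0B]) (use KI in \<open>auto simp: B_def has_integral_integrable_integral\<close>)
  moreover have "blinfun_apply (integral (cbox 0 1) (\<lambda>t. Blinfun (E x0 t))) v =
      (\<Sum>k\<in>UNIV. v $ k * integral (cbox 0 1) (L k x0))" for v
  proof -
    have c1: "continuous_on (cbox 0 1) (\<lambda>t. Blinfun (E x0 t))"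
    proof -
      have "continuous_on (cbox 0 1) (\<lambda>t. (x0, t :: real))" by (intro continuous_intros)
      from continuous_on_compose2[OF EC this] show ?thesis using x0B by auto
    qed
    have c2: "L k x0 integrable_on cbox 0 1" for k
    proof -
      have "continuous_on (cbox 0 1) (\<lambda>t. (x0, t :: real))" by (intro continuous_intros)
      from continuous_on_compose2[OF LC this, of k] show ?thesis
        using x0B by (intro integrable_continuous) (auto)
    qed
    have "blinfun_apply (integral (cbox 0 1) (\<lambda>t. Blinfun (E x0 t))) v = integral (cbox 0 1) (\<lambda>t. E x0 t v)"
      using blinfun_apply_integral[OF integrable_continuous[OF c1]] by (simp add: Eapp)
    also have "\<dots> = (\<Sum>k\<in>UNIV. integral (cbox 0 1) (\<lambda>t. v $ k * L k x0 t))"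
      unfolding E_def by (rule integral_sum) (use c2 in \<open>auto intro: integrable_on_mult_right\<close>)
    also have "\<dots> = (\<Sum>k\<in>UNIV. v $ k * integral (cbox 0 1) (L k x0))"
      by (intro sum.cong refl integral_mult_right)
    finally show ?thesis .
  qed
  then have eq: "blinfun_apply (integral (cbox 0 1) (\<lambda>t. Blinfun (E x0 t))) =
      (\<lambda>v. \<Sum>k\<in>UNIV. v $ k * integral (cbox 0 1) (L k x0))" by (rule ext)
  ultimately have "((\<lambda>x. integral (cbox 0 1) (K x)) has_derivative
      (\<lambda>v. \<Sum>k\<in>UNIV. v $ k * integral (cbox 0 1) (L k x0))) (at x0 within B)"
    unfolding eq by blast
  then have "((\<lambda>x. integral (cbox 0 1) (K x)) has_derivative
      (\<lambda>v. \<Sum>k\<in>UNIV. v $ k * integral (cbox 0 1) (L k x0))) (at x0)"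
    using x0B at_within_open[of x0 B] by (simp add: B_def)
  then have "(pd j f has_derivative
      (\<lambda>v. \<Sum>k\<in>UNIV. v $ k * integral (cbox 0 1) (L k x0))) (at x0)"
    by (rule has_derivative_transform_within_open[of _ _ _ _ B])
       (use x0B KI in \<open>auto simp: B_def integral_unique\<close>)
  then show ?thesis using that[OF r(1) sub[OF x0B]] by (simp add: L_def)
qed

lemma pd_holo [intro]:
  assumes "holomorphic_on_Cn f U" "open U"
  shows "holomorphic_on_Cn (pd j f) U"
  unfolding holomorphic_on_Cn_def
proof
  fix x assume "x \<in> U"
  obtain r where
    D: "(pd j f has_derivative (\<lambda>v. \<Sum>k\<in>UNIV. v $ k *
        integral (cbox 0 1) (\<lambda>t. pd k f (x + axis j (circ r t)) / circ r t))) (at x)"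
    by (rule pd_has_derivative_Cauchy[OF assms \<open>x \<in> U\<close>, of j])
  show "\<exists>D. (pd j f has_derivative D) (at x) \<and> (\<forall>c v. D (c *s v) = c * D v)"
    by (rule exI, rule conjI[OF D]) (simp add: sum_distrib_left mult.assoc)
qed

lemma pd_commute:
  assumes "holomorphic_on_Cn f U" "open U" "x \<in> U"
  shows "pd k (pd j f) x = pd j (pd k f) x"
proof -
  obtain r where r: "r > 0" "cball x r \<subseteq> U" and
    D: "(pd j f has_derivative (\<lambda>v. \<Sum>k\<in>UNIV. v $ k *
        integral (cbox 0 1) (\<lambda>t. pd k f (x + axis j (circ r t)) / circ r t))) (at x)"
    by (rule pd_has_derivative_Cauchy[OF assms, of j])
  have I: "integral (cbox 0 1) (\<lambda>t. pd k f (x + axis j (circ r t)) / circ r t) = pd j (pd k f) x" for k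
    by (rule integral_unique pd_Cauchy pd_holo assms r)+
  have "(pd j f has_derivative (\<lambda>v. \<Sum>k\<in>UNIV. v $ k * pd k (pd j f) x)) (at x)"
    by (rule holo_has_derivative(1)[OF pd_holo[OF assms(1,2)] assms(3)])
  from has_derivative_unique[OF this D]
  have "(\<Sum>l\<in>UNIV. axis k 1 $ l * pd l (pd j f) x) = (\<Sum>l\<in>UNIV. axis k 1 $ l * pd j (pd l f) x)"
    unfolding I by (rule fun_cong)
  then show ?thesis by (simp add: axis_def if_distrib[of "\<lambda>z. z * _"] cong: if_cong)
qed

lemma holo_constant:
  assumes "holomorphic_on_Cn f U" "open U" "connected U"
    and "\<And>j x. x \<in> U \<Longrightarrow> pd j f x = 0" and "x \<in> U" "y \<in> U"
  shows "f x = f y"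
proof (rule has_derivative_zero_unique_connected[OF assms(2,3) _ assms(5,6)])
  fix x assume "x \<in> U"
  then show "(f has_derivative (\<lambda>x. 0)) (at x)"
    using holo_has_derivative(1)[OF assms(1), of x] assms(4) by simp
qed

section \<open>Iterated partial derivatives\<close>

abbreviation pds :: "'n::finite list \<Rightarrow> (complex^'n \<Rightarrow> complex) \<Rightarrow> complex^'n \<Rightarrow> complex" where
  "pds js f \<equiv> foldr pd js f"

lemma pds_holo [intro]:
  assumes "holomorphic_on_Cn f U" "open U"
  shows "holomorphic_on_Cn (pds js f) U"
  by (induction js) (use assms in auto)

lemma pds_cong:
  assumes "open U" "x \<in> U" "\<And>x. x \<in> U \<Longrightarrow> f x = g x"
  shows "pds js f x = pds js g x"
  using assms(2)
proof (induction js arbitrary: x)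
  case (Cons j js)
  show ?case
    using pd_cong[OF assms(1) Cons.prems, of "pds js f" "pds js g"] Cons.IH by simp
qed (use assms in simp)

lemma pds_pd_commute:
  assumes "holomorphic_on_Cn f U" "open U" "x \<in> U"
  shows "pds js (pd j f) x = pd j (pds js f) x"
  using assms(3)
proof (induction js arbitrary: x)
  case (Cons k js)
  have "pds (k # js) (pd j f) x = pd k (pd j (pds js f)) x"
    using pd_cong[OF assms(2) Cons.prems Cons.IH] by simp
  also have "\<dots> = pd j (pd k (pds js f)) x"
    using assms Cons.prems by (intro pd_commute) auto
  finally show ?case by simp
qed simp

text \<open>Since partial derivatives commute, an iterated derivative along a list of indices depends only on
  the multiset of its entries. This is the tool that frees all later arguments from the order of differentiation.\<close>

lemma pds_mset_eq:
  assumes f: "holomorphic_on_Cn f U" and U: "open U" and x: "x \<in> U" and eq: "mset js = mset ks"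
  shows "pds js f x = pds ks f x"
  using eq x
proof (induction js arbitrary: ks x)
  case (Cons j js)
  then have "j \<in> set ks" by (metis list.set_intros(1) set_mset_mset)
  then obtain k1 k2 where ks: "ks = k1 @ j # k2" by (meson split_list)
  then have m: "mset js = mset (k1 @ k2)" using Cons.prems by simp
  have "pds ks f x = pds k1 (pd j (pds k2 f)) x" by (simp add: ks)
  also have "\<dots> = pd j (pds k1 (pds k2 f)) x"
    using f U Cons.prems by (intro pds_pd_commute) auto
  also have "\<dots> = pd j (pds js f) x"
    using Cons.IH[OF m] by (intro pd_cong[OF U \<open>x \<in> U\<close>]) simp
  finally show ?case by simp
qed simp

lemma multi_pd_eq_pds:
  fixes f :: "complex^'n \<Rightarrow> complex"
  assumes f: "holomorphic_on_Cn f U" and U: "open U" and x: "x \<in> U"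
    and c: "\<And>j. count_list js j = \<alpha> j"
  shows "multi_pd \<alpha> f x = pds js f x"
proof -
  define ns where "ns = (SOME js. distinct js \<and> set js = (UNIV :: 'n set))"
  have "\<exists>js. distinct js \<and> set js = (UNIV :: 'n set)"
    using finite_distinct_list[of "UNIV :: 'n set"] by auto
  then have ns: "distinct ns \<and> set ns = UNIV"
    unfolding ns_def by (rule someI_ex)
  have "foldr (\<lambda>j. pd j ^^ \<alpha> j) ms f = pds (concat (map (\<lambda>j. replicate (\<alpha> j) j) ms)) f" for ms
    by (induction ms) auto
  then have "multi_pd \<alpha> f x = pds (concat (map (\<lambda>j. replicate (\<alpha> j) j) ns)) f x"
    by (simp add: multi_pd_def ns_def)
  also have "\<dots> = pds js f x"
  proof (rule pds_mset_eq[OF f U x])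
    have rep: "count_list (replicate n j) i = (if i = j then n else 0)" for n and i j :: 'n
      by (induction n) auto
    have "count_list (concat (map (\<lambda>j. replicate (\<alpha> j) j) ms)) i = (if i \<in> set ms then \<alpha> i else 0)"
      if "distinct ms" for ms i
      using that by (induction ms) (auto simp: rep)
    then have "count_list (concat (map (\<lambda>j. replicate (\<alpha> j) j) ns)) i = count_list js i" for i
      using ns c by simp
    then show "mset (concat (map (\<lambda>j. replicate (\<alpha> j) j) ns)) = mset js"
      by (intro multiset_eqI) (simp only: count_mset)
  qed
  finally show ?thesis .
qed

lemma pds_lincomb:
  assumes "holomorphic_on_Cn f U" "holomorphic_on_Cn g U" "open U" "x \<in> U"
  shows "pds js (\<lambda>x. f x + c * g x) x = pds js f x + c * pds js g x"
  using assms(4)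
proof (induction js arbitrary: x)
  case (Cons j js)
  have "pds (j # js) (\<lambda>x. f x + c * g x) x = pd j (\<lambda>x. pds js f x + c * pds js g x) x"
    using pd_cong[OF assms(3) Cons.prems Cons.IH] by simp
  also have "\<dots> = pd j (pds js f) x + pd j (\<lambda>x. c * pds js g x) x"
    using assms by (intro pd_add[where U = U] Cons.prems) auto
  also have "pd j (\<lambda>x. c * pds js g x) x = c * pd j (pds js g) x"
    using assms by (intro pd_cmult[where U = U] Cons.prems) auto
  finally show ?case by simp
qed simp

text \<open>Differentiating an Euler homogeneity relation lowers its degree by the weight of the variable.\<close>

lemma Euler_pd:
  fixes f :: "complex^'n \<Rightarrow> complex"
  assumes f: "holomorphic_on_Cn f U" and U: "open U"
    and E: "\<And>x. x \<in> U \<Longrightarrow> (\<Sum>j\<in>UNIV. w j * x $ j * pd j f x) = c * f x" and x: "x \<in> U"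
  shows "(\<Sum>j\<in>UNIV. w j * x $ j * pd j (pd k f) x) = (c - w k) * pd k f x"
proof -
  have "pd k (\<lambda>x. \<Sum>j\<in>UNIV. w j * x $ j * pd j f x) x = (\<Sum>j\<in>UNIV. pd k (\<lambda>x. w j * x $ j * pd j f x) x)"
    using f U x by (intro pd_sum) auto
  also have "\<dots> = (\<Sum>j\<in>UNIV. (if j = k then w j * pd j f x else 0) + w j * x $ j * pd j (pd k f) x)"
  proof (rule sum.cong[OF refl])
    fix j
    have "pd k (\<lambda>x. w j * x $ j * pd j f x) x = pd k (\<lambda>x. w j * x $ j) x * pd j f x + w j * x $ j * pd k (pd j f) x"
      using f U x by (intro pd_mult[where U = U]) auto
    moreover have "pd k (\<lambda>x. w j * x $ j) x = w j * pd k (\<lambda>x. x $ j) x"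
      using x by (intro pd_cmult[where U = U]) auto
    ultimately show "pd k (\<lambda>x. w j * x $ j * pd j f x) x = (if j = k then w j * pd j f x else 0) + w j * x $ j * pd j (pd k f) x"
      using pd_commute[OF f U x, of k j] by (simp add: pd_coord)
  qed
  also have "\<dots> = w k * pd k f x + (\<Sum>j\<in>UNIV. w j * x $ j * pd j (pd k f) x)"
    by (simp add: sum.distrib)
  finally have "pd k (\<lambda>x. \<Sum>j\<in>UNIV. w j * x $ j * pd j f x) x = w k * pd k f x + (\<Sum>j\<in>UNIV. w j * x $ j * pd j (pd k f) x)" .
  moreover have "pd k (\<lambda>x. \<Sum>j\<in>UNIV. w j * x $ j * pd j f x) x = pd k (\<lambda>x. c * f x) x"
    by (rule pd_cong[OF U x E])
  moreover have "\<dots> = c * pd k f x" by (rule pd_cmult[OF f f x])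
  ultimately show ?thesis by (simp add: algebra_simps)
qed

section \<open>Polynomials\<close>

lemma polynomial_monomial: "polynomial_on_Cn (\<lambda>x::complex^'n. c * (\<Prod>i\<in>UNIV. (x $ i) ^ \<alpha> i))"
  unfolding polynomial_on_Cn_def
  by (intro exI[of _ "{\<alpha>}"] exI[of _ "\<lambda>_. c"]) auto

lemma polynomial_add:
  assumes "polynomial_on_Cn f" "polynomial_on_Cn g"
  shows "polynomial_on_Cn (\<lambda>x. f x + g x)"
proof -
  obtain S c where S: "finite S" "f = (\<lambda>x. \<Sum>\<alpha>\<in>S. c \<alpha> * (\<Prod>i\<in>UNIV. (x $ i) ^ \<alpha> i))"
    using assms(1) unfolding polynomial_on_Cn_def by blast
  obtain T d where T: "finite T" "g = (\<lambda>x. \<Sum>\<alpha>\<in>T. d \<alpha> * (\<Prod>i\<in>UNIV. (x $ i) ^ \<alpha> i))"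
    using assms(2) unfolding polynomial_on_Cn_def by blast
  have "f x + g x = (\<Sum>\<alpha>\<in>S \<union> T. ((if \<alpha> \<in> S then c \<alpha> else 0) + (if \<alpha> \<in> T then d \<alpha> else 0)) * (\<Prod>i\<in>UNIV. (x $ i) ^ \<alpha> i))" for x
  proof -
    have "f x = (\<Sum>\<alpha>\<in>S \<union> T. (if \<alpha> \<in> S then c \<alpha> else 0) * (\<Prod>i\<in>UNIV. (x $ i) ^ \<alpha> i))"
      unfolding S(2) using S T by (intro sum.mono_neutral_cong_left) auto
    moreover have "g x = (\<Sum>\<alpha>\<in>S \<union> T. (if \<alpha> \<in> T then d \<alpha> else 0) * (\<Prod>i\<in>UNIV. (x $ i) ^ \<alpha> i))"
      unfolding T(2) using S T by (intro sum.mono_neutral_cong_left) auto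
    ultimately show ?thesis by (simp add: sum.distrib distrib_right)
  qed
  then show ?thesis unfolding polynomial_on_Cn_def using S(1) T(1)
    by (intro exI[of _ "S \<union> T"] exI conjI) (auto intro!: ext)
qed

lemma polynomial_const: "polynomial_on_Cn (\<lambda>x. c)"
  using polynomial_monomial[of c "\<lambda>_. 0"] by simp

lemma polynomial_coord: "polynomial_on_Cn (\<lambda>x. x $ i)"
  using polynomial_monomial[of 1 "\<lambda>j. if j = i then 1 else 0"]
  by (simp add: if_distrib[of "\<lambda>n. _ ^ n"] cong: if_cong)

lemma polynomial_sum:
  "(\<And>i. i \<in> I \<Longrightarrow> polynomial_on_Cn (f i)) \<Longrightarrow> polynomial_on_Cn (\<lambda>x. \<Sum>i\<in>I. f i x)"
  by (induction I rule: infinite_finite_induct) (auto intro: polynomial_add polynomial_const)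

lemma polynomial_mult:
  assumes "polynomial_on_Cn f" "polynomial_on_Cn g"
  shows "polynomial_on_Cn (\<lambda>x. f x * g x)"
proof -
  obtain S c where S: "finite S" "f = (\<lambda>x. \<Sum>\<alpha>\<in>S. c \<alpha> * (\<Prod>i\<in>UNIV. (x $ i) ^ \<alpha> i))"
    using assms(1) unfolding polynomial_on_Cn_def by blast
  obtain T d where T: "finite T" "g = (\<lambda>x. \<Sum>\<alpha>\<in>T. d \<alpha> * (\<Prod>i\<in>UNIV. (x $ i) ^ \<alpha> i))"
    using assms(2) unfolding polynomial_on_Cn_def by blast
  have "(\<lambda>x. f x * g x) = (\<lambda>x. \<Sum>\<alpha>\<in>S. \<Sum>\<beta>\<in>T. (c \<alpha> * d \<beta>) * (\<Prod>i\<in>UNIV. (x $ i) ^ (\<alpha> i + \<beta> i)))"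
    unfolding S(2) T(2) sum_product by (simp add: power_add prod.distrib algebra_simps)
  moreover have "polynomial_on_Cn \<dots>"
    by (intro polynomial_sum polynomial_monomial)
  ultimately show ?thesis by simp
qed

lemma polynomial_diff:
  "polynomial_on_Cn f \<Longrightarrow> polynomial_on_Cn g \<Longrightarrow> polynomial_on_Cn (\<lambda>x. f x - g x)"
  using polynomial_add[OF _ polynomial_mult[OF polynomial_const[of "-1"]], of f g] by simp

lemma polynomial_power: "polynomial_on_Cn f \<Longrightarrow> polynomial_on_Cn (\<lambda>x. f x ^ n)"
  by (induction n) (auto intro: polynomial_const polynomial_mult)

lemma polynomial_prod:
  "(\<And>i. i \<in> I \<Longrightarrow> polynomial_on_Cn (f i)) \<Longrightarrow> polynomial_on_Cn (\<lambda>x. \<Prod>i\<in>I. f i x)"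
  by (induction I rule: infinite_finite_induct) (auto intro: polynomial_mult polynomial_const)

lemmas polynomial_intros = polynomial_const polynomial_coord polynomial_add polynomial_mult
  polynomial_diff polynomial_power polynomial_sum polynomial_prod

lemma polynomial_continuous:
  assumes "polynomial_on_Cn f" shows "continuous_on S f"
proof -
  obtain S c where S: "f = (\<lambda>x. \<Sum>\<alpha>\<in>S. c \<alpha> * (\<Prod>i\<in>UNIV. (x $ i) ^ \<alpha> i))"
    using assms unfolding polynomial_on_Cn_def by blast
  show ?thesis unfolding S by (intro continuous_intros)
qed

text \<open>Restricting to the line through two points reduces this to polynomials in one variable,
  which have only finitely many zeros.\<close>

lemma polynomials_common_nonzero:
  fixes f g :: "complex^'n \<Rightarrow> complex"
  assumes "polynomial_on_Cn f" "polynomial_on_Cn g" "f \<noteq> (\<lambda>_. 0)" "g \<noteq> (\<lambda>_. 0)"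
  shows "\<exists>x. f x \<noteq> 0 \<and> g x \<noteq> 0"
proof -
  obtain u v where u: "f u \<noteq> 0" and v: "g v \<noteq> 0" using assms(3,4) by (auto simp: fun_eq_iff)
  have line: "\<exists>p. \<forall>z. h (\<chi> i. u $ i + z * (v $ i - u $ i)) = poly p z"
    if h: "polynomial_on_Cn h" for h :: "complex^'n \<Rightarrow> complex"
  proof -
    obtain S c where S: "h = (\<lambda>x. \<Sum>\<alpha>\<in>S. c \<alpha> * (\<Prod>i\<in>UNIV. (x $ i) ^ \<alpha> i))"
      using h unfolding polynomial_on_Cn_def by blast
    show ?thesis
      by (intro exI[of _ "\<Sum>\<alpha>\<in>S. [:c \<alpha>:] * (\<Prod>i\<in>UNIV. [:u $ i, v $ i - u $ i:] ^ \<alpha> i)"])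
         (simp add: S poly_sum poly_prod)
  qed
  obtain p where p: "\<And>z. f (\<chi> i. u $ i + z * (v $ i - u $ i)) = poly p z"
    using line[OF assms(1)] by blast
  obtain q where q: "\<And>z. g (\<chi> i. u $ i + z * (v $ i - u $ i)) = poly q z"
    using line[OF assms(2)] by blast
  have "p \<noteq> 0" using p[of 0] u by auto
  moreover have "q \<noteq> 0" using q[of 1] v by auto
  ultimately have "p * q \<noteq> 0" by simp
  then obtain z where "poly (p * q) z \<noteq> 0" using poly_all_0_iff_0 by blast
  then show ?thesis using p q by (metis mult_eq_0_iff poly_mult)
qed

section \<open>Dimension and rank\<close>

lemma has_finite_dim_unique:
  "has_finite_dim V r \<Longrightarrow> has_finite_dim V s \<Longrightarrow> r = s"
  unfolding has_finite_dim_def by (metis cfun.dim_eq_card cfun.span_span)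

lemma sum_fun_eq: "(\<Sum>v\<in>S. F v) = (\<lambda>x. \<Sum>v\<in>S. F v x)"
  for F :: "'i \<Rightarrow> 'a \<Rightarrow> complex"
  by (induction S rule: infinite_finite_induct) (auto simp: fun_eq_iff)

text \<open>A family that spans and has no nontrivial relation is injective, so its index set counts a basis.\<close>

lemma has_finite_dimI:
  fixes b :: "'i \<Rightarrow> 'a \<Rightarrow> complex"
  assumes I: "finite I"
    and sub: "\<And>c. (\<lambda>x. \<Sum>i\<in>I. c i * b i x) \<in> V"
    and span: "\<And>v. v \<in> V \<Longrightarrow> \<exists>c. v = (\<lambda>x. \<Sum>i\<in>I. c i * b i x)"
    and indep: "\<And>c i. (\<lambda>x. \<Sum>i\<in>I. c i * b i x) = (\<lambda>x. 0) \<Longrightarrow> i \<in> I \<Longrightarrow> c i = 0"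
  shows "has_finite_dim V (card I)"
proof -
  have inj: "inj_on b I"
  proof (rule inj_onI, rule ccontr)
    fix i j assume ij: "i \<in> I" "j \<in> I" "b i = b j" "i \<noteq> j"
    \<comment> \<open>equal members at different indices would give the relation \<open>b i - b j = 0\<close>\<close>
    define c where "c = (\<lambda>k. if k = i then 1 else if k = j then -1 else (0::complex))"
    have "(\<Sum>k\<in>I. c k * b k x) = 0" for x
    proof -
      have "(\<Sum>k\<in>I. c k * b k x) = (\<Sum>k\<in>{i,j}. c k * b k x)"
        using I ij by (intro sum.mono_neutral_right) (auto simp: c_def)
      also have "\<dots> = 0" using ij by (simp add: c_def)
      finally show ?thesis .
    qed
    then have "c i = 0" using indep[of c i] ij by auto
    then show False by (simp add: c_def)
  qed
  have sum_b: "(\<Sum>v\<in>b ` I. (\<lambda>x. u v * v x)) = (\<lambda>x. \<Sum>i\<in>I. u (b i) * b i x)" for u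
    unfolding sum_fun_eq using inj by (simp add: sum.reindex)
  have "cfun.independent (b ` I)"
    unfolding cfun.dependent_finite[OF finite_imageI[OF I]] sum_b
    using indep[of "\<lambda>i. u (b i)" for u] by (auto simp: zero_fun_def)
  moreover have "cfun.span (b ` I) = V"
  proof
    show "cfun.span (b ` I) \<subseteq> V"
      unfolding cfun.span_finite[OF finite_imageI[OF I]] sum_b using sub by auto
    show "V \<subseteq> cfun.span (b ` I)"
    proof
      fix v assume "v \<in> V"
      then obtain c where v: "v = (\<lambda>x. \<Sum>i\<in>I. c i * b i x)" using span by blast
      have "v = (\<lambda>x. \<Sum>i\<in>I. c (inv_into I b (b i)) * b i x)"
        unfolding v by (intro ext sum.cong) (auto simp: inv_into_f_f[OF inj])
      then show "v \<in> cfun.span (b ` I)"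
        unfolding cfun.span_finite[OF finite_imageI[OF I]] sum_b
        by (intro image_eqI[of _ _ "\<lambda>w. c (inv_into I b w)"]) auto
    qed
  qed
  ultimately show ?thesis
    unfolding has_finite_dim_def using I inj by (auto simp: card_image intro!: exI[of _ "b ` I"])
qed

text \<open>The rank is a definite description, so it has to be shown that no other value qualifies: the two
  polynomials that witness two values have a common point of nonvanishing, and a small ball about it carries both dimensions.\<close>

lemma hypergeometric_rank_eqI:
  fixes A :: "int^'n^'d"
  assumes h: "polynomial_on_Cn h" "h \<noteq> (\<lambda>_. 0)"
    and dim: "\<And>U. open U \<Longrightarrow> U \<noteq> {} \<Longrightarrow> simply_connected U \<Longrightarrow> U \<subseteq> {x. h x \<noteq> 0} \<Longrightarrow>
      has_finite_dim (hypergeometric_solutions A \<beta> U) r"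
  shows "hypergeometric_rank A \<beta> = r"
  unfolding hypergeometric_rank_def
proof (rule the_equality)
  show "\<exists>h. polynomial_on_Cn h \<and> h \<noteq> (\<lambda>_. 0) \<and> (\<forall>U. open U \<and> U \<noteq> {} \<and> simply_connected U \<and> U \<subseteq> {x. h x \<noteq> 0} \<longrightarrow>
      has_finite_dim (hypergeometric_solutions A \<beta> U) r)"
    using assms by blast
next
  fix r' assume "\<exists>h. polynomial_on_Cn h \<and> h \<noteq> (\<lambda>_. 0) \<and> (\<forall>U. open U \<and> U \<noteq> {} \<and> simply_connected U \<and> U \<subseteq> {x. h x \<noteq> 0} \<longrightarrow>
      has_finite_dim (hypergeometric_solutions A \<beta> U) r')"
  then obtain h' where h': "polynomial_on_Cn h'" "h' \<noteq> (\<lambda>_. 0)"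
    and dim': "\<And>U. open U \<Longrightarrow> U \<noteq> {} \<Longrightarrow> simply_connected U \<Longrightarrow> U \<subseteq> {x. h' x \<noteq> 0} \<Longrightarrow>
      has_finite_dim (hypergeometric_solutions A \<beta> U) r'"
    by blast
  obtain x where x: "h x \<noteq> 0" "h' x \<noteq> 0" using polynomials_common_nonzero[OF h(1) h'(1) h(2) h'(2)] by blast
  have "open {x. h x * h' x \<noteq> 0}"
    by (intro open_Collect_neq polynomial_continuous polynomial_mult h h' continuous_on_const)
  then obtain e where e: "e > 0" "ball x e \<subseteq> {x. h x * h' x \<noteq> 0}"
    using x open_contains_ball[of "{x. h x * h' x \<noteq> 0}"] by auto
  have sc: "simply_connected (ball x e)" by (simp add: convex_imp_simply_connected)
  have "has_finite_dim (hypergeometric_solutions A \<beta> (ball x e)) r"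
    using e sc by (intro dim) auto
  moreover have "has_finite_dim (hypergeometric_solutions A \<beta> (ball x e)) r'"
    using e sc by (intro dim') auto
  ultimately show "r' = r" using has_finite_dim_unique by blast
qed

section \<open>Root functions of a quartic\<close>

text \<open>On a simply connected set a nonvanishing continuous function has a continuous logarithm, because the
  exponential map is a covering. Near each point this logarithm is a translate of the principal branch, hence
  holomorphic.\<close>

lemma holo_log:
  fixes F :: "complex^'n \<Rightarrow> complex"
  assumes U: "open U" "simply_connected U" and F: "holomorphic_on_Cn F U"
    and nz: "\<And>x. x \<in> U \<Longrightarrow> F x \<noteq> 0"
  obtains l where "holomorphic_on_Cn l U" "\<And>x. x \<in> U \<Longrightarrow> exp (l x) = F x"
proof -
  obtain l where lc: "continuous_on U l" and l: "\<And>x. x \<in> U \<Longrightarrow> F x = exp (l x)"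
    using continuous_logarithm_on_simply_connected[OF holo_continuous_on[OF F] U(2)
        open_imp_locally_path_connected[OF U(1)] nz] by blast
  have "holomorphic_on_Cn l U"
    unfolding holomorphic_on_Cn_def
  proof
    fix a assume a: "a \<in> U"
    have "isCont l a" using lc U(1) a by (simp add: continuous_on_eq_continuous_at)
    then obtain d where d: "d > 0" "\<And>x. dist x a < d \<Longrightarrow> dist (l x) (l a) < 1"
      unfolding continuous_at_eps_delta by (meson zero_less_one)
    \<comment> \<open>on \<open>V\<close> the increment of \<open>l\<close> has imaginary part below \<open>\<pi>\<close>, so the principal branch recovers it\<close>
    define V where "V = U \<inter> ball a d"
    have V: "open V" "a \<in> V" using U(1) a d(1) by (auto simp: V_def)
    have eq: "l a + Ln (F x / F a) = l x" if "x \<in> V" for x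
    proof -
      have "norm (l x - l a) < 1" using that d(2)[of x] by (simp add: V_def dist_norm norm_minus_commute)
      then have "\<bar>Im (l x - l a)\<bar> < 1" using abs_Im_le_cmod[of "l x - l a"] by linarith
      then have "Ln (exp (l x - l a)) = l x - l a" using pi_gt3 by (intro Ln_exp) auto
      moreover have "F x / F a = exp (l x - l a)" using that a l by (simp add: V_def exp_diff)
      ultimately show ?thesis by simp
    qed
    have "holomorphic_on_Cn (\<lambda>x. l a + Ln (F x / F a)) {a}"
    proof (intro holo_add holo_const holo_compose[of _ _ Ln])
      show "holomorphic_on_Cn (\<lambda>x. F x / F a) {a}"
        using a nz by (intro holo_divide holo_subset[OF F] holo_const) auto
      show "\<exists>d. (Ln has_field_derivative d) (at (F x / F a))" if "x \<in> {a}" for x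
        using that nz[OF a] has_field_derivative_Ln[of 1] by auto
    qed
    then obtain D where D: "((\<lambda>x. l a + Ln (F x / F a)) has_derivative D) (at a)"
      "\<And>c v. D (c *s v) = c * D v" unfolding holomorphic_on_Cn_def by blast
    have "(l has_derivative D) (at a)"
      by (rule has_derivative_transform_within_open[OF D(1) V eq])
    then show "\<exists>D. (l has_derivative D) (at a) \<and> (\<forall>c v. D (c *s v) = c * D v)" using D(2) by blast
  qed
  then show ?thesis using that l by metis
qed

lemma holo_root:
  fixes F :: "complex^'n \<Rightarrow> complex"
  assumes U: "open U" "simply_connected U" and F: "holomorphic_on_Cn F U"
    and nz: "\<And>x. x \<in> U \<Longrightarrow> F x \<noteq> 0" and n: "n > 0"
  obtains g where "holomorphic_on_Cn g U" "\<And>x. x \<in> U \<Longrightarrow> g x ^ n = F x"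
proof -
  obtain l where l: "holomorphic_on_Cn l U" "\<And>x. x \<in> U \<Longrightarrow> exp (l x) = F x"
    using holo_log[OF U F nz] by blast
  show ?thesis
  proof
    show "holomorphic_on_Cn (\<lambda>x. exp (l x / of_nat n)) U"
      using n by (intro holo_compose[of _ _ exp] holo_divide l holo_const) (auto intro: DERIV_exp)
    show "exp (l x / of_nat n) ^ n = F x" if "x \<in> U" for x
      using l(2)[OF that] n by (simp flip: exp_of_nat_mult)
  qed
qed

text \<open>Cardano: the elementary symmetric functions of the three values given by Lagrange's resolvents.\<close>

lemma Cardano_symmetric:
  fixes e1 A B S u v w :: complex
  assumes w: "w\<^sup>2 + w + 1 = 0" and uv: "u * v = A" and u3: "u ^ 3 + v ^ 3 = B"
  defines "z1 \<equiv> (e1 + u + v) / 3" and "z2 \<equiv> (e1 + w * u + w\<^sup>2 * v) / 3"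
    and "z3 \<equiv> (e1 + w\<^sup>2 * u + w * v) / 3"
  shows "z1 + z2 + z3 = e1" and "z1 * z2 + z1 * z3 + z2 * z3 = (e1\<^sup>2 - A) / 3"
    and "z1 * z2 * z3 = (e1 ^ 3 + B - 3 * e1 * A) / 27"
proof -
  have z: "3 * z1 = e1 + u + v" "3 * z2 = e1 + w * u + w\<^sup>2 * v" "3 * z3 = e1 + w\<^sup>2 * u + w * v"
    by (simp_all add: z1_def z2_def z3_def)
  have "3 * (z1 + z2 + z3) = 3 * e1" using z w by algebra
  then show "z1 + z2 + z3 = e1" by (simp only: mult_cancel_left) simp
  have "9 * (z1 * z2 + z1 * z3 + z2 * z3) = 3 * e1\<^sup>2 - 3 * A" using z w uv by algebra
  then have "9 * (z1 * z2 + z1 * z3 + z2 * z3) = 9 * ((e1\<^sup>2 - A) / 3)" by (simp add: diff_divide_distrib)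
  then show "z1 * z2 + z1 * z3 + z2 * z3 = (e1\<^sup>2 - A) / 3" by (simp only: mult_cancel_left) simp
  have "27 * (z1 * z2 * z3) = e1 ^ 3 + B - 3 * e1 * A" using z w uv u3 by algebra
  then have "27 * (z1 * z2 * z3) = 27 * ((e1 ^ 3 + B - 3 * e1 * A) / 27)" by simp
  then show "z1 * z2 * z3 = (e1 ^ 3 + B - 3 * e1 * A) / 27" by (simp only: mult_cancel_left) simp
qed

text \<open>Each difference of two of the three values is, up to a nonzero factor, \<open>u\<close> minus \<open>v\<close> times a cube root
  of unity.\<close>

lemma Cardano_distinct:
  fixes e1 u v w :: complex
  assumes w: "w\<^sup>2 + w + 1 = 0" and d: "u ^ 3 \<noteq> v ^ 3"
  shows "e1 + u + v \<noteq> e1 + w * u + w\<^sup>2 * v" "e1 + u + v \<noteq> e1 + w\<^sup>2 * u + w * v"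
    "e1 + w * u + w\<^sup>2 * v \<noteq> e1 + w\<^sup>2 * u + w * v"
proof -
  have w1: "1 - w \<noteq> 0"
  proof
    assume "1 - w = 0" then have "w = 1" by simp
    then show False using w by simp
  qed
  have w0: "w \<noteq> 0" using w by auto
  show "e1 + u + v \<noteq> e1 + w * u + w\<^sup>2 * v"
  proof
    assume "e1 + u + v = e1 + w * u + w\<^sup>2 * v"
    then have "(1 - w) * (u - w\<^sup>2 * v) = 0" using w by algebra
    then have "u = w\<^sup>2 * v" using w1 by simp
    then have "u ^ 3 = v ^ 3" using w by algebra
    then show False using d by simp
  qed
  show "e1 + u + v \<noteq> e1 + w\<^sup>2 * u + w * v"
  proof
    assume "e1 + u + v = e1 + w\<^sup>2 * u + w * v"
    then have "(1 - w) * (v - w\<^sup>2 * u) = 0" using w by algebra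
    then have "v = w\<^sup>2 * u" using w1 by simp
    then have "u ^ 3 = v ^ 3" using w by algebra
    then show False using d by simp
  qed
  show "e1 + w * u + w\<^sup>2 * v \<noteq> e1 + w\<^sup>2 * u + w * v"
  proof
    assume "e1 + w * u + w\<^sup>2 * v = e1 + w\<^sup>2 * u + w * v"
    then have "w * (1 - w) * (u - v) = 0" by algebra
    then have "u = v" using w1 w0 by simp
    then show False using d by simp
  qed
qed

text \<open>Euler's solution of the quartic: the roots are \<open>\<alpha> + \<beta> + \<gamma>\<close> up to an even number of sign changes.\<close>

lemma Euler_quartic:
  fixes al be ga s t :: complex
  assumes "al\<^sup>2 + be\<^sup>2 + ga\<^sup>2 = e1" "al\<^sup>2 * be\<^sup>2 + al\<^sup>2 * ga\<^sup>2 + be\<^sup>2 * ga\<^sup>2 = e2" "8 * (al * be * ga) = - q"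
    and "s\<^sup>2 = 1" "t\<^sup>2 = 1" and y: "y = s * al + t * be + s * t * ga"
  shows "y ^ 4 - 2 * e1 * y\<^sup>2 + q * y + (e1\<^sup>2 - 4 * e2) = 0"
proof -
  have "y\<^sup>2 - e1 = 2 * (s * t * al * be + t * al * ga + s * be * ga)"
  proof -
    have "y\<^sup>2 = s\<^sup>2 * al\<^sup>2 + t\<^sup>2 * be\<^sup>2 + s\<^sup>2 * t\<^sup>2 * ga\<^sup>2
        + 2 * (s * t * al * be + s\<^sup>2 * t * al * ga + s * t\<^sup>2 * be * ga)"
      by (simp add: y power2_eq_square algebra_simps)
    then show ?thesis using assms(1,4,5) by (simp add: algebra_simps)
  qed
  moreover have "(s * t * al * be + t * al * ga + s * be * ga)\<^sup>2 = e2 + 2 * (al * be * ga) * y"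
  proof -
    have "(s * t * al * be + t * al * ga + s * be * ga)\<^sup>2 =
        s\<^sup>2 * t\<^sup>2 * (al\<^sup>2 * be\<^sup>2) + t\<^sup>2 * (al\<^sup>2 * ga\<^sup>2) + s\<^sup>2 * (be\<^sup>2 * ga\<^sup>2)
        + 2 * (al * be * ga) * (t\<^sup>2 * s * al + s\<^sup>2 * t * be + s * t * ga)"
      by (simp add: power2_eq_square algebra_simps)
    then show ?thesis using assms(2,4,5) by (simp add: y)
  qed
  ultimately have "(y\<^sup>2 - e1)\<^sup>2 = 4 * (e2 + 2 * (al * be * ga) * y)"
    by (simp only: power_mult_distrib) simp
  then show ?thesis using assms(3) by algebra
qed

text \<open>Euler's and Cardano's formulas express the roots through one square root, one cube root and two
  further square roots. On a simply connected set all of them have holomorphic branches as soon as their radicands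
  vanish nowhere, which is what the four hypotheses say: the leading coefficient, the product \<open>u v\<close> of the two
  cube roots, the linear coefficient of the depressed quartic (hence the product of the three resolvent
  roots), and the discriminant are nonzero.\<close>

lemma quartic_root_functions:
  fixes U :: "(complex^'n) set"
  assumes U: "open U" "simply_connected U"
    and hol: "holomorphic_on_Cn p1 U" "holomorphic_on_Cn p2 U" "holomorphic_on_Cn p3 U" "holomorphic_on_Cn p4 U"
    and p4: "\<And>x. x \<in> U \<Longrightarrow> p4 x \<noteq> 0"
    and nA: "\<And>x. x \<in> U \<Longrightarrow> 4 * p1 x * p4 x - p2 x * p3 x \<noteq> 0"
    and nq: "\<And>x. x \<in> U \<Longrightarrow> p3 x ^ 3 + 8 * p2 x * (p4 x)\<^sup>2 \<noteq> 0"
    and nD: "\<And>x. x \<in> U \<Longrightarrow> 27 * (p1 x * (p3 x)\<^sup>2 + (p2 x)\<^sup>2 * p4 x)\<^sup>2 - 4 * (4 * p1 x * p4 x - p2 x * p3 x) ^ 3 \<noteq> 0"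
  obtains \<rho> :: "nat \<Rightarrow> complex^'n \<Rightarrow> complex" where
    "\<And>j. holomorphic_on_Cn (\<rho> j) U"
    "\<And>x. x \<in> U \<Longrightarrow> inj_on (\<lambda>j. \<rho> j x) {..<4}"
    "\<And>j x. x \<in> U \<Longrightarrow> p1 x + p2 x * \<rho> j x + p3 x * \<rho> j x ^ 3 + p4 x * \<rho> j x ^ 4 = 0"
proof -
  define w where "w = Complex (- 1 / 2) (sqrt 3 / 2)"
  have w: "w\<^sup>2 + w + 1 = 0"
    by (simp add: w_def complex_eq_iff power2_eq_square)
  \<comment> \<open>\<open>t = y - e\<close> removes the cubic term; \<open>q\<close> is the new linear coefficient, and \<open>A\<close>, \<open>B\<close> are the invariants of the resolvent cubic\<close>
  define e where "e = (\<lambda>x. p3 x / (4 * p4 x))"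
  define c1 where "c1 = (\<lambda>x. p2 x / p4 x)"
  define c0 where "c0 = (\<lambda>x. p1 x / p4 x)"
  define q where "q = (\<lambda>x. 8 * e x ^ 3 + c1 x)"
  define A where "A = (\<lambda>x. 3 / 4 * (c0 x - c1 x * e x))"
  define B where "B = (\<lambda>x. 27 / 64 * (16 * c0 x * (e x)\<^sup>2 + (c1 x)\<^sup>2))"
  have hol_e: "holomorphic_on_Cn e U" "holomorphic_on_Cn c1 U" "holomorphic_on_Cn c0 U"
    unfolding e_def c1_def c0_def using hol p4 by (auto intro!: holo_divide holo_mult)
  have hol_q: "holomorphic_on_Cn q U" "holomorphic_on_Cn A U" "holomorphic_on_Cn B U"
    unfolding q_def A_def B_def by (intro holo_add holo_mult holo_power holo_diff holo_const hol_e)+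
  have q0: "q x \<noteq> 0" if "x \<in> U" for x
  proof -
    have "q x * (8 * p4 x ^ 3) = p3 x ^ 3 + 8 * p2 x * (p4 x)\<^sup>2"
      using p4[OF that] by (simp add: q_def e_def c1_def field_simps power2_eq_square power3_eq_cube)
    then show ?thesis using nq[OF that] by auto
  qed
  have Aeq: "16 * (A x * p4 x ^ 2) = 3 * (4 * p1 x * p4 x - p2 x * p3 x)" if "x \<in> U" for x
    using p4[OF that] by (simp add: A_def e_def c1_def c0_def field_simps power2_eq_square)
  have Beq: "64 * (B x * p4 x ^ 3) = 27 * (p1 x * (p3 x)\<^sup>2 + (p2 x)\<^sup>2 * p4 x)" if "x \<in> U" for x
    using p4[OF that] by (simp add: B_def e_def c1_def c0_def field_simps power2_eq_square power3_eq_cube)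
  have A0: "A x \<noteq> 0" if "x \<in> U" for x
    using Aeq[OF that] nA[OF that] by (metis mult_eq_0_iff zero_neq_numeral)
  have D0: "(B x)\<^sup>2 - 4 * A x ^ 3 \<noteq> 0" if "x \<in> U" for x
  proof
    assume "(B x)\<^sup>2 - 4 * A x ^ 3 = 0"
    then have "27 * (27 * (p1 x * (p3 x)\<^sup>2 + (p2 x)\<^sup>2 * p4 x)\<^sup>2 - 4 * (4 * p1 x * p4 x - p2 x * p3 x) ^ 3) = 0"
      using Aeq[OF that] Beq[OF that] by algebra
    then show False using nD[OF that] by simp
  qed
  have "holomorphic_on_Cn (\<lambda>x. (B x)\<^sup>2 - 4 * A x ^ 3) U"
    by (intro holo_diff holo_mult holo_power holo_const hol_q)
  from holo_root[OF U this D0, of 2] obtain S where S: "holomorphic_on_Cn S U"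
    "\<And>x. x \<in> U \<Longrightarrow> (S x)\<^sup>2 = (B x)\<^sup>2 - 4 * A x ^ 3" by auto
  have S0: "S x \<noteq> 0" if "x \<in> U" for x using D0[OF that] S(2)[OF that] by auto
  have BS: "(B x + S x) / 2 \<noteq> 0" if "x \<in> U" for x
  proof
    assume "(B x + S x) / 2 = 0"
    then have "B x + S x = 0" by simp
    then have "4 * A x ^ 3 = 0" using S(2)[OF that] by algebra
    then show False using A0[OF that] by simp
  qed
  have "holomorphic_on_Cn (\<lambda>x. (B x + S x) / 2) U"
    by (intro holo_divide holo_add hol_q S holo_const) simp
  from holo_root[OF U this BS, of 3] obtain u where u: "holomorphic_on_Cn u U"
    "\<And>x. x \<in> U \<Longrightarrow> u x ^ 3 = (B x + S x) / 2" by auto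
  have u0: "u x \<noteq> 0" if "x \<in> U" for x using u(2)[OF that] BS[OF that] by auto
  \<comment> \<open>the second cube root is not chosen freely: its product with the first one is prescribed\<close>
  define v where "v = (\<lambda>x. A x / u x)"
  have vh: "holomorphic_on_Cn v U" unfolding v_def by (intro holo_divide hol_q u u0)
  have uv: "u x * v x = A x" if "x \<in> U" for x using u0[OF that] by (simp add: v_def)
  have v3: "v x ^ 3 = (B x - S x) / 2" if "x \<in> U" for x
  proof -
    have "u x ^ 3 * v x ^ 3 = A x ^ 3" using uv[OF that] by (simp flip: power_mult_distrib)
    moreover have "(B x + S x) / 2 * ((B x - S x) / 2) = A x ^ 3"
      using S(2)[OF that] by (simp add: field_simps power2_eq_square)
    ultimately have "u x ^ 3 * v x ^ 3 = u x ^ 3 * ((B x - S x) / 2)"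
      by (simp only: u(2)[OF that])
    then show ?thesis using u0[OF that] by (simp only: mult_cancel_left) simp
  qed
  define e1 where "e1 = (\<lambda>x. 3 * (e x)\<^sup>2)"
  define z1 where "z1 = (\<lambda>x. (e1 x + u x + v x) / 3)"
  define z2 where "z2 = (\<lambda>x. (e1 x + w * u x + w\<^sup>2 * v x) / 3)"
  define z3 where "z3 = (\<lambda>x. (e1 x + w\<^sup>2 * u x + w * v x) / 3)"
  have zh: "holomorphic_on_Cn z1 U" "holomorphic_on_Cn z2 U"
    unfolding z1_def z2_def e1_def
    by (intro holo_divide holo_add holo_mult holo_power holo_const hol_e u vh; simp)+
  have sym: "z1 x + z2 x + z3 x = e1 x" "z1 x * z2 x + z1 x * z3 x + z2 x * z3 x = ((e1 x)\<^sup>2 - A x) / 3"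
    "64 * (z1 x * z2 x * z3 x) = (q x)\<^sup>2" if "x \<in> U" for x
  proof -
    have "u x ^ 3 + v x ^ 3 = B x"
      unfolding u(2)[OF that] v3[OF that] by (simp add: field_simps)
    note C = Cardano_symmetric[OF w uv[OF that] this, of "e1 x", folded z1_def z2_def z3_def]
    show "z1 x + z2 x + z3 x = e1 x" "z1 x * z2 x + z1 x * z3 x + z2 x * z3 x = ((e1 x)\<^sup>2 - A x) / 3"
      using C by (simp_all add: z1_def z2_def z3_def)
    have "z1 x * z2 x * z3 x = (e1 x ^ 3 + B x - 3 * e1 x * A x) / 27"
      using C(3) by (simp add: z1_def z2_def z3_def)
    then have "27 * (64 * (z1 x * z2 x * z3 x)) = 64 * (e1 x ^ 3 + B x - 3 * e1 x * A x)"
      by (simp only:) simp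
    also have "\<dots> = 27 * (q x)\<^sup>2"
      by (simp add: e1_def B_def A_def q_def field_simps power2_eq_square power3_eq_cube)
    finally show "64 * (z1 x * z2 x * z3 x) = (q x)\<^sup>2" by (simp only: mult_cancel_left) simp
  qed
  have z0: "z1 x \<noteq> 0" "z2 x \<noteq> 0" if "x \<in> U" for x using sym(3)[OF that] q0[OF that] by auto
  have dist: "z1 x \<noteq> z2 x" "z1 x \<noteq> z3 x" "z2 x \<noteq> z3 x" if "x \<in> U" for x
  proof -
    have "u x ^ 3 \<noteq> v x ^ 3"
    proof
      assume "u x ^ 3 = v x ^ 3"
      then have "S x = 0" using u(2)[OF that] v3[OF that] by (simp add: field_simps)
      then show False using S0[OF that] by simp
    qed
    from Cardano_distinct[OF w this, of "e1 x"]
    show "z1 x \<noteq> z2 x" "z1 x \<noteq> z3 x" "z2 x \<noteq> z3 x"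
      unfolding z1_def z2_def z3_def divide_cancel_right by simp_all
  qed
  from holo_root[OF U zh(1) z0(1), of 2] obtain al where al: "holomorphic_on_Cn al U"
    "\<And>x. x \<in> U \<Longrightarrow> (al x)\<^sup>2 = z1 x" by auto
  from holo_root[OF U zh(2) z0(2), of 2] obtain be where be: "holomorphic_on_Cn be U"
    "\<And>x. x \<in> U \<Longrightarrow> (be x)\<^sup>2 = z2 x" by auto
  have ab0: "al x \<noteq> 0" "be x \<noteq> 0" if "x \<in> U" for x using al(2)[OF that] be(2)[OF that] z0[OF that] by auto
  \<comment> \<open>the sign of the third square root is tied to those of the first two\<close>
  define ga where "ga = (\<lambda>x. - q x / (8 * al x * be x))"
  have gah: "holomorphic_on_Cn ga U" unfolding ga_def
    by (intro holo_divide holo_mult holo_uminus holo_const al be hol_q) (use ab0 in auto)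
  have abg: "8 * (al x * be x * ga x) = - q x" if "x \<in> U" for x
    using ab0[OF that] by (simp add: ga_def)
  have ga: "(ga x)\<^sup>2 = z3 x" if "x \<in> U" for x
  proof -
    have "64 * (z1 x * z2 x) * (ga x)\<^sup>2 = (8 * (al x * be x * ga x))\<^sup>2"
      by (simp add: power_mult_distrib al(2)[OF that] be(2)[OF that])
    also have "\<dots> = 64 * (z1 x * z2 x) * z3 x"
      unfolding abg[OF that] using sym(3)[OF that] by (simp add: mult.assoc)
    finally show ?thesis using z0[OF that] by simp
  qed
  \<comment> \<open>the four choices of an even number of minus signs\<close>
  define sg where "sg = (\<lambda>j::nat. if j = 0 \<or> j = 1 then 1 else (-1 :: complex))"
  define tg where "tg = (\<lambda>j::nat. if j = 0 \<or> j = 2 then 1 else (-1 :: complex))"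
  define y where "y = (\<lambda>j x. sg j * al x + tg j * be x + sg j * tg j * ga x)"
  define \<rho> where "\<rho> = (\<lambda>j x. y j x - e x)"
  show ?thesis
  proof
    show "holomorphic_on_Cn (\<rho> j) U" for j
      unfolding \<rho>_def y_def by (intro holo_diff holo_add holo_mult holo_const al be gah hol_e)
    fix x assume x: "x \<in> U"
    have pm: "a + b \<noteq> 0 \<and> a - b \<noteq> 0 \<and> a \<noteq> b" if "a\<^sup>2 \<noteq> b\<^sup>2" for a b :: complex
      using that by (metis add_eq_0_iff2 eq_iff_diff_eq_0 power2_minus)
    have "al x + be x \<noteq> 0 \<and> al x - be x \<noteq> 0 \<and> al x \<noteq> be x"
         "al x + ga x \<noteq> 0 \<and> al x - ga x \<noteq> 0 \<and> al x \<noteq> ga x"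
         "be x + ga x \<noteq> 0 \<and> be x - ga x \<noteq> 0 \<and> be x \<noteq> ga x"
      using pm dist[OF x] al(2)[OF x] be(2)[OF x] ga[OF x] by metis+
    note d = this
    have ys: "y 0 x - y 1 x = 2 * (be x + ga x)" "y 0 x - y 2 x = 2 * (al x + ga x)"
      "y 0 x - y 3 x = 2 * (al x + be x)" "y 1 x - y 2 x = 2 * (al x - be x)"
      "y 1 x - y 3 x = 2 * (al x - ga x)" "y 2 x - y 3 x = 2 * (be x - ga x)"
      by (simp_all add: y_def sg_def tg_def)
    have "y 0 x \<noteq> y 1 x" "y 0 x \<noteq> y 2 x" "y 0 x \<noteq> y 3 x" "y 1 x \<noteq> y 2 x" "y 1 x \<noteq> y 3 x" "y 2 x \<noteq> y 3 x"
      using ys d by (metis mult_eq_0_iff right_minus_eq zero_neq_numeral)+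
    moreover have "{..<4} = {0,1,2,3::nat}" by auto
    ultimately show "inj_on (\<lambda>j. \<rho> j x) {..<4}"
      by (auto simp: \<rho>_def)
    fix j
    have Eu: "(y j x) ^ 4 - 2 * e1 x * (y j x)\<^sup>2 + q x * y j x + ((e1 x)\<^sup>2 - 4 * (((e1 x)\<^sup>2 - A x) / 3)) = 0"
    proof (rule Euler_quartic[where s = "sg j" and t = "tg j", OF _ _ abg[OF x]])
      show "(al x)\<^sup>2 + (be x)\<^sup>2 + (ga x)\<^sup>2 = e1 x"
        "(al x)\<^sup>2 * (be x)\<^sup>2 + (al x)\<^sup>2 * (ga x)\<^sup>2 + (be x)\<^sup>2 * (ga x)\<^sup>2 = ((e1 x)\<^sup>2 - A x) / 3"
        using sym[OF x] al(2)[OF x] be(2)[OF x] ga[OF x] by simp_all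
    qed (auto simp: sg_def tg_def y_def)
    have R: "(e1 x)\<^sup>2 - 4 * (((e1 x)\<^sup>2 - A x) / 3) = c0 x - c1 x * e x - 3 * e x ^ 4"
      by (simp add: e1_def A_def field_simps power2_eq_square power4_eq_xxxx)
    have "(\<rho> j x + e x) ^ 4 - 6 * (e x)\<^sup>2 * (\<rho> j x + e x)\<^sup>2 + (8 * e x ^ 3 + c1 x) * (\<rho> j x + e x)
        + (c0 x - c1 x * e x - 3 * e x ^ 4) = 0"
      using Eu unfolding R by (simp add: \<rho>_def e1_def q_def)
    then have "c0 x + c1 x * \<rho> j x + 4 * e x * \<rho> j x ^ 3 + \<rho> j x ^ 4 = 0" by algebra
    then have "p4 x * (c0 x + c1 x * \<rho> j x + 4 * e x * \<rho> j x ^ 3 + \<rho> j x ^ 4) = 0" by simp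
    moreover have "p4 x * c0 x = p1 x" "p4 x * c1 x = p2 x" "p4 x * (4 * e x) = p3 x"
      using p4[OF x] by (simp_all add: c0_def c1_def e_def)
    ultimately show "p1 x + p2 x * \<rho> j x + p3 x * \<rho> j x ^ 3 + p4 x * \<rho> j x ^ 4 = 0"
      by algebra
  qed
qed

section \<open>The hypergeometric system of a quartic and linear polynomials\<close>

lemma pds_zero:
  fixes f :: "complex^'n \<Rightarrow> complex"
  assumes U: "open U" and z: "\<And>x. x \<in> U \<Longrightarrow> pds ks f x = 0" and x: "x \<in> U"
  shows "pds (js @ ks) f x = 0"
proof -
  have "pds js (\<lambda>x. 0) x = 0" for x :: "complex^'n"
    by (induction js arbitrary: x) (auto simp: pd_def)
  moreover have "pds (js @ ks) f x = pds js (\<lambda>x. 0) x"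
    using pds_cong[OF U x, of "pds ks f" "\<lambda>x. 0" js] z by simp
  ultimately show ?thesis by simp
qed

lemma pds_zero_mset:
  assumes f: "holomorphic_on_Cn f U" and U: "open U" and z: "\<And>x. x \<in> U \<Longrightarrow> pds ks f x = 0"
    and x: "x \<in> U" and sub: "mset ks \<subseteq># mset js"
  shows "pds js f x = 0"
proof -
  obtain ms where "mset ms = mset js - mset ks" using ex_mset by blast
  then have "mset js = mset (ms @ ks)" using sub by simp
  then show ?thesis using pds_mset_eq[OF f U x] pds_zero[OF U z x] by metis
qed

lemma pds_sum:
  assumes "\<And>i. i \<in> I \<Longrightarrow> holomorphic_on_Cn (f i) U" "open U" "x \<in> U"
  shows "pds js (\<lambda>x. \<Sum>i\<in>I. c i * f i x) x = (\<Sum>i\<in>I. c i * pds js (f i) x)"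
  using assms(3)
proof (induction js arbitrary: x)
  case (Cons j js)
  have "pds (j # js) (\<lambda>x. \<Sum>i\<in>I. c i * f i x) x = pd j (\<lambda>x. \<Sum>i\<in>I. c i * pds js (f i) x) x"
    using pd_cong[OF assms(2) Cons.prems Cons.IH] by simp
  also have "\<dots> = (\<Sum>i\<in>I. pd j (\<lambda>x. c i * pds js (f i) x) x)"
    using assms by (intro pd_sum[where U = U] Cons.prems holo_mult holo_const pds_holo) auto
  also have "\<dots> = (\<Sum>i\<in>I. c i * pd j (pds js (f i)) x)"
    using assms by (intro sum.cong refl pd_cmult[where U = U] Cons.prems pds_holo) auto
  finally show ?case by simp
qed simp

text \<open>If all derivatives of a family of functions are shifts of its derivative in one base direction, then an
  iterated derivative depends only on the length and the total weight of the list of directions. This is how the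
  infinitely many toric equations of a solution are checked.\<close>

lemma pds_family:
  fixes w :: "'n::finite \<Rightarrow> nat" and L :: "nat \<Rightarrow> complex^'n \<Rightarrow> complex"
  assumes U: "open U" and hol: "\<And>m. holomorphic_on_Cn (L m) U"
    and step: "\<And>c m x. c \<in> C \<Longrightarrow> x \<in> U \<Longrightarrow> pd c (L m) x = pd i0 (L (m + w c)) x"
    and "set bs \<subseteq> C" "x \<in> U"
  shows "pds bs (L m) x = pds (replicate (length bs) i0) (L (m + sum_list (map w bs))) x"
  using assms(4,5)
proof (induction bs arbitrary: x)
  case (Cons c bs)
  let ?n = "length bs" and ?m = "m + sum_list (map w bs)"
  have "pds (c # bs) (L m) x = pd c (pds (replicate ?n i0) (L ?m)) x"
    using pd_cong[OF U Cons.prems(2), of "pds bs (L m)"] Cons by simp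
  also have "\<dots> = pds (replicate ?n i0) (pd c (L ?m)) x"
    by (rule pds_pd_commute[symmetric, OF hol U Cons.prems(2)])
  also have "\<dots> = pds (replicate ?n i0) (pd i0 (L (?m + w c))) x"
    using step Cons.prems by (intro pds_cong[OF U]) auto
  also have "\<dots> = pd i0 (pds (replicate ?n i0) (L (?m + w c))) x"
    by (rule pds_pd_commute[OF hol U Cons.prems(2)])
  finally show ?case by (simp add: add.assoc add.commute[of "w c"])
qed simp

text \<open>The columns of the matrix fall into four that carry the quartic \<open>x1 + x2 t + x3 t^3 + x4 t^4\<close> and,
  for each \<open>k\<close> in \<open>K\<close>, a pair that carries the linear polynomial \<open>a_k + b_k t\<close>. The locale
  names these columns and nothing else; the matrix enters only through three kinds of weights.\<close>

locale quartic_config =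
  fixes i1 i2 i3 i4 :: "'n::finite" and ia ib :: "nat \<Rightarrow> 'n" and K :: "nat set"
  assumes finK: "finite K"
    and dist: "distinct [i1, i2, i3, i4]"
    and ia_new: "\<And>k. k \<in> K \<Longrightarrow> ia k \<notin> {i1, i2, i3, i4}"
    and ib_new: "\<And>k. k \<in> K \<Longrightarrow> ib k \<notin> {i1, i2, i3, i4}"
    and ia_ib: "\<And>k l. k \<in> K \<Longrightarrow> l \<in> K \<Longrightarrow> ia k \<noteq> ib l"
    and ia_inj: "inj_on ia K" and ib_inj: "inj_on ib K"
    and cover: "UNIV = {i1, i2, i3, i4} \<union> ia ` K \<union> ib ` K"
begin

text \<open>The weights \<open>wd\<close>, \<open>wp\<close> and \<open>wk k\<close> span the same space as the rows of the matrix: \<open>wp\<close> is the last row,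
  the \<open>wk k\<close> are the middle rows, and \<open>wd\<close> is the first row minus the middle ones.\<close>

definition wd :: "'n \<Rightarrow> nat" where "wd j = (if j \<in> {i1, i2, i3, i4} then 1 else 0)"

definition wp :: "'n \<Rightarrow> nat" where
  "wp j = (if j = i2 then 1 else if j = i3 then 3 else if j = i4 then 4 else if j \<in> ib ` K then 1 else 0)"

definition wk :: "nat \<Rightarrow> 'n \<Rightarrow> nat" where "wk k j = (if j = ia k \<or> j = ib k then 1 else 0)"

lemma dist' [simp]:
  "i1 \<noteq> i2" "i1 \<noteq> i3" "i1 \<noteq> i4" "i2 \<noteq> i3" "i2 \<noteq> i4" "i3 \<noteq> i4"
  "i2 \<noteq> i1" "i3 \<noteq> i1" "i4 \<noteq> i1" "i3 \<noteq> i2" "i4 \<noteq> i2" "i4 \<noteq> i3"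
  using dist by auto

lemma block_dist [simp]:
  assumes "k \<in> K"
  shows "ia k \<noteq> i1" "ia k \<noteq> i2" "ia k \<noteq> i3" "ia k \<noteq> i4" "i1 \<noteq> ia k" "i2 \<noteq> ia k" "i3 \<noteq> ia k" "i4 \<noteq> ia k"
    "ib k \<noteq> i1" "ib k \<noteq> i2" "ib k \<noteq> i3" "ib k \<noteq> i4" "i1 \<noteq> ib k" "i2 \<noteq> ib k" "i3 \<noteq> ib k" "i4 \<noteq> ib k"
  using ia_new[OF assms] ib_new[OF assms] by auto

lemma block_dist2 [simp]:
  assumes "k \<in> K" "l \<in> K"
  shows "ia k \<noteq> ib l" "ib l \<noteq> ia k" "ia k = ia l \<longleftrightarrow> k = l" "ib k = ib l \<longleftrightarrow> k = l"
  using ia_ib[OF assms] assms ia_inj ib_inj by (auto simp: inj_on_def)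

lemma wd_simps [simp]: "wd i1 = 1" "wd i2 = 1" "wd i3 = 1" "wd i4 = 1"
  "k \<in> K \<Longrightarrow> wd (ia k) = 0" "k \<in> K \<Longrightarrow> wd (ib k) = 0"
  by (auto simp: wd_def)

lemma wp_simps [simp]: "wp i1 = 0" "wp i2 = 1" "wp i3 = 3" "wp i4 = 4"
  "k \<in> K \<Longrightarrow> wp (ia k) = 0" "k \<in> K \<Longrightarrow> wp (ib k) = 1"
  by (auto simp: wp_def)

lemma wk_simps [simp]:
  "k \<in> K \<Longrightarrow> wk k i1 = 0" "k \<in> K \<Longrightarrow> wk k i2 = 0" "k \<in> K \<Longrightarrow> wk k i3 = 0" "k \<in> K \<Longrightarrow> wk k i4 = 0"
  "k \<in> K \<Longrightarrow> l \<in> K \<Longrightarrow> wk k (ia l) = (if k = l then 1 else 0)"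
  "k \<in> K \<Longrightarrow> l \<in> K \<Longrightarrow> wk k (ib l) = (if k = l then 1 else 0)"
  by (auto simp: wk_def)

lemma index_cases:
  obtains "j = i1" | "j = i2" | "j = i3" | "j = i4" | k where "k \<in> K" "j = ia k" | k where "k \<in> K" "j = ib k"
proof -
  have "j \<in> {i1, i2, i3, i4} \<union> ia ` K \<union> ib ` K" using cover by blast
  then show ?thesis using that by blast
qed

lemma sum_index:
  fixes f :: "'n \<Rightarrow> 'b::comm_monoid_add"
  shows "sum f UNIV = f i1 + f i2 + f i3 + f i4 + (\<Sum>k\<in>K. f (ia k)) + (\<Sum>k\<in>K. f (ib k))"
proof -
  have d: "{i1, i2, i3, i4} \<inter> ia ` K = {}" "({i1, i2, i3, i4} \<union> ia ` K) \<inter> ib ` K = {}"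
    using ia_new ib_new ia_ib by auto
  have "sum f UNIV = sum f {i1, i2, i3, i4} + sum f (ia ` K) + sum f (ib ` K)"
    unfolding cover using d finK by (simp add: sum.union_disjoint del: Un_insert_left)
  moreover have "sum f {i1, i2, i3, i4} = f i1 + f i2 + f i3 + f i4" by (simp add: add_ac)
  ultimately show ?thesis using ia_inj ib_inj by (simp add: sum.reindex)
qed

text \<open>Two lists of directions are related if the corresponding monomials in the partial derivatives have
  the same multidegree, that is, if their difference is a toric operator.\<close>

definition weq :: "'n list \<Rightarrow> 'n list \<Rightarrow> bool" where
  "weq js ks \<longleftrightarrow> sum_list (map wd js) = sum_list (map wd ks) \<and> sum_list (map wp js) = sum_list (map wp ks) \<and>
     (\<forall>k\<in>K. sum_list (map (wk k) js) = sum_list (map (wk k) ks))"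

definition Euler :: "(complex^'n) set \<Rightarrow> ('n \<Rightarrow> nat) \<Rightarrow> complex \<Rightarrow> (complex^'n \<Rightarrow> complex) \<Rightarrow> bool" where
  "Euler U w c f \<longleftrightarrow> (\<forall>x\<in>U. (\<Sum>j\<in>UNIV. of_nat (w j) * x $ j * pd j f x) = c * f x)"

text \<open>The hypergeometric system in terms of these weights, for the degrees 1, 2 and 0.\<close>

definition sol :: "(complex^'n) set \<Rightarrow> (complex^'n \<Rightarrow> complex) \<Rightarrow> bool" where
  "sol U f \<longleftrightarrow> holomorphic_on_Cn f U \<and> Euler U wd 1 f \<and> Euler U wp 2 f \<and> (\<forall>k\<in>K. Euler U (wk k) 0 f) \<and>
     (\<forall>js ks. weq js ks \<longrightarrow> (\<forall>x\<in>U. pds js f x = pds ks f x))"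

lemma sol_holo: "sol U f \<Longrightarrow> holomorphic_on_Cn f U"
  by (simp add: sol_def)

lemma toric:
  "sol U f \<Longrightarrow> x \<in> U \<Longrightarrow> weq js ks \<Longrightarrow> pds js f x = pds ks f x"
  by (simp add: sol_def)

lemma Euler_pds:
  assumes "holomorphic_on_Cn f U" "open U" "Euler U w c f"
  shows "Euler U w (c - of_nat (sum_list (map w js))) (pds js f)"
proof (induction js)
  case (Cons j js)
  have "Euler U w (c - of_nat (sum_list (map w js)) - of_nat (w j)) (pd j (pds js f))"
    unfolding Euler_def
    using Euler_pd[OF pds_holo[OF assms(1,2), of js] assms(2), of "\<lambda>j. of_nat (w j)" "c - of_nat (sum_list (map w js))" _ j]
      Cons.IH by (simp add: Euler_def)
  then show ?case by (simp add: algebra_simps)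
qed (use assms in simp)

context
  fixes f U
  assumes sol: "sol U f" and U: "open U"
begin

lemma Euler_d:
  assumes "x \<in> U"
  shows "x $ i1 * pds (i1 # js) f x + x $ i2 * pds (i2 # js) f x + x $ i3 * pds (i3 # js) f x + x $ i4 * pds (i4 # js) f x
    = (1 - of_nat (sum_list (map wd js))) * pds js f x"
  using Euler_pds[OF sol_holo[OF sol] U, of wd 1 js] sol assms
  by (simp add: sol_def Euler_def sum_index)

lemma Euler_p:
  assumes "x \<in> U"
  shows "x $ i2 * pds (i2 # js) f x + 3 * x $ i3 * pds (i3 # js) f x + 4 * x $ i4 * pds (i4 # js) f x
      + (\<Sum>k\<in>K. x $ ib k * pds (ib k # js) f x)
    = (2 - of_nat (sum_list (map wp js))) * pds js f x"
  using Euler_pds[OF sol_holo[OF sol] U, of wp 2 js] sol assms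
  by (simp add: sol_def Euler_def sum_index)

lemma Euler_k:
  assumes x: "x \<in> U" and k: "k \<in> K"
  shows "x $ ia k * pds (ia k # js) f x + x $ ib k * pds (ib k # js) f x
    = - of_nat (sum_list (map (wk k) js)) * pds js f x"
proof -
  have "(\<Sum>l\<in>K. of_nat (wk k (ia l)) * x $ ia l * pds (ia l # js) f x) = x $ ia k * pds (ia k # js) f x"
    using k finK by (simp add: if_distrib if_distribR cong: if_cong sum.cong)
  moreover have "(\<Sum>l\<in>K. of_nat (wk k (ib l)) * x $ ib l * pds (ib l # js) f x) = x $ ib k * pds (ib k # js) f x"
    using k finK by (simp add: if_distrib if_distribR cong: if_cong sum.cong)
  moreover have "Euler U (wk k) 0 f" using sol k by (simp add: sol_def)
  from Euler_pds[OF sol_holo[OF sol] U this, of js]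
  have "(\<Sum>j\<in>UNIV. of_nat (wk k j) * x $ j * pds (j # js) f x) = - of_nat (sum_list (map (wk k) js)) * pds js f x"
    using x by (simp add: Euler_def)
  ultimately show ?thesis using k unfolding sum_index by simp
qed

end

lemma sol_zero: "sol U (\<lambda>x. 0)"
proof -
  have "pds js (\<lambda>x. 0) x = 0" for js :: "'n list" and x
    by (induction js arbitrary: x) (auto simp: pd_def)
  then show ?thesis by (auto simp: sol_def Euler_def)
qed

lemma sol_lincomb:
  assumes f: "sol U f" and g: "sol U g" and U: "open U"
  shows "sol U (\<lambda>x. f x + c * g x)"
proof -
  note h = sol_holo[OF f] sol_holo[OF g]
  have E: "Euler U w e (\<lambda>x. f x + c * g x)" if "Euler U w e f" "Euler U w e g" for w e
    unfolding Euler_def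
  proof
    fix x assume x: "x \<in> U"
    have "pd j (\<lambda>x. f x + c * g x) x = pd j f x + c * pd j g x" for j
      using pds_lincomb[OF h U x, of "[j]"] by simp
    then have "(\<Sum>j\<in>UNIV. of_nat (w j) * x $ j * pd j (\<lambda>x. f x + c * g x) x) =
        (\<Sum>j\<in>UNIV. of_nat (w j) * x $ j * pd j f x) + c * (\<Sum>j\<in>UNIV. of_nat (w j) * x $ j * pd j g x)"
      by (simp add: algebra_simps sum.distrib sum_distrib_left)
    then show "(\<Sum>j\<in>UNIV. of_nat (w j) * x $ j * pd j (\<lambda>x. f x + c * g x) x) = e * (f x + c * g x)"
      using that x by (simp add: Euler_def algebra_simps)
  qed
  show ?thesis unfolding sol_def
    using f g E h U by (auto simp: sol_def pds_lincomb[OF h U])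
qed

lemma sol_sum:
  assumes "\<And>i. i \<in> I \<Longrightarrow> sol U (f i)" and U: "open U" and "finite I"
  shows "sol U (\<lambda>x. \<Sum>i\<in>I. c i * f i x)"
  using assms(3,1)
proof (induction I rule: finite_induct)
  case (insert i I)
  have "sol U (\<lambda>x. (\<Sum>i\<in>I. c i * f i x) + c i * f i x)"
    using insert by (intro sol_lincomb U) auto
  then show ?case using insert by (simp add: add_ac)
qed (simp add: sol_zero)

text \<open>The list form of the toric equations agrees with the one that splits a kernel vector
  into its positive and its negative part.\<close>

lemma toric_iff:
  assumes f: "holomorphic_on_Cn f U" and U: "open U"
  shows "(\<forall>js ks. weq js ks \<longrightarrow> (\<forall>x\<in>U. pds js f x = pds ks f x)) \<longleftrightarrow>
    (\<forall>u::int^'n. (\<forall>w \<in> {wd, wp} \<union> wk ` K. (\<Sum>j\<in>UNIV. int (w j) * u $ j) = 0) \<longrightarrow>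
      (\<forall>x\<in>U. multi_pd (\<lambda>i. nat (u $ i)) f x = multi_pd (\<lambda>i. nat (- (u $ i))) f x))"
    (is "?L \<longleftrightarrow> ?R")
proof -
  have ex_list: "\<exists>js. \<forall>j. count_list js j = \<alpha> j" for \<alpha> :: "'n \<Rightarrow> nat"
  proof -
    obtain js where "mset js = Abs_multiset \<alpha>" using ex_mset by blast
    then have "count_list js j = \<alpha> j" for j
      by (metis (no_types, lifting) count_Abs_multiset count_mset finite)
    then show ?thesis by blast
  qed
  have sl: "int (sum_list (map w js)) = (\<Sum>j\<in>UNIV. int (w j) * int (count_list js j))" for w :: "'n \<Rightarrow> nat" and js
    using sum_list_map_eq_sum_count2[of js UNIV w] by (simp add: mult.commute)
  have weq_iff: "weq js ks \<longleftrightarrow> (\<forall>w \<in> {wd, wp} \<union> wk ` K. (\<Sum>j\<in>UNIV. int (w j) * (int (count_list js j) - int (count_list ks j))) = 0)"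
    for js ks
  proof -
    have "(\<Sum>j\<in>UNIV. int (w j) * (int (count_list js j) - int (count_list ks j))) = 0 \<longleftrightarrow>
        sum_list (map w js) = sum_list (map w ks)" for w
    proof -
      have "(\<Sum>j\<in>UNIV. int (w j) * (int (count_list js j) - int (count_list ks j))) =
        int (sum_list (map w js)) - int (sum_list (map w ks))"
        unfolding sl by (simp add: algebra_simps sum_subtractf)
      then show ?thesis by simp
    qed
    then show ?thesis by (auto simp: weq_def)
  qed
  show ?thesis
  proof
    assume L: ?L
    show ?R
    proof (intro allI impI ballI)
      fix u :: "int^'n" and x
      assume u: "\<forall>w\<in>{wd, wp} \<union> wk ` K. (\<Sum>j\<in>UNIV. int (w j) * u $ j) = 0" and x: "x \<in> U"
      obtain js where js: "\<And>j. count_list js j = nat (u $ j)" using ex_list[of "\<lambda>j. nat (u $ j)"] by auto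
      obtain ks where ks: "\<And>j. count_list ks j = nat (- (u $ j))" using ex_list[of "\<lambda>j. nat (- (u $ j))"] by auto
      have "int (count_list js j) - int (count_list ks j) = u $ j" for j
        by (simp add: js ks)
      then have "weq js ks" using u by (simp add: weq_iff)
      then show "multi_pd (\<lambda>i. nat (u $ i)) f x = multi_pd (\<lambda>i. nat (- (u $ i))) f x"
        using L x multi_pd_eq_pds[OF f U x js] multi_pd_eq_pds[OF f U x ks] by simp
    qed
  next
    assume R: ?R
    show ?L
    proof (intro allI impI ballI)
      fix js ks x assume eq: "weq js ks" and x: "x \<in> U"
      define u :: "int^'n" where "u = (\<chi> j. int (count_list js j) - int (count_list ks j))"
      have u: "\<forall>w\<in>{wd, wp} \<union> wk ` K. (\<Sum>j\<in>UNIV. int (w j) * u $ j) = 0"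
        using eq by (simp add: weq_iff u_def)
      obtain js' where js': "\<And>j. count_list js' j = nat (u $ j)" using ex_list[of "\<lambda>j. nat (u $ j)"] by auto
      obtain ks' where ks': "\<And>j. count_list ks' j = nat (- (u $ j))" using ex_list[of "\<lambda>j. nat (- (u $ j))"] by auto
      \<comment> \<open>the common part \<open>cs\<close> of both lists is stripped off, the equation for the disjoint remainders is used, and \<open>cs\<close> is applied to it\<close>
      obtain cs where cs: "\<And>j. count_list cs j = min (count_list js j) (count_list ks j)" using ex_list[of "\<lambda>j. min (count_list js j) (count_list ks j)"] by auto
      have *: "pds js' f y = pds ks' f y" if "y \<in> U" for y
        using R u that multi_pd_eq_pds[OF f U that js'] multi_pd_eq_pds[OF f U that ks'] by simp
      have "mset js = mset (cs @ js')"
        by (rule multiset_eqI) (simp add: count_mset cs js' u_def)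
      from pds_mset_eq[OF f U x this] have "pds js f x = pds cs (pds js' f) x" by simp
      also have "\<dots> = pds cs (pds ks' f) x" by (rule pds_cong[OF U x *])
      finally have js_eq: "pds js f x = pds cs (pds ks' f) x" .
      have ks_eq: "mset ks = mset (cs @ ks')"
        by (rule multiset_eqI) (simp add: count_mset cs ks' u_def)
      from js_eq pds_mset_eq[OF f U x ks_eq] show "pds js f x = pds ks f x" by simp
    qed
  qed
qed

end

section \<open>Sufficient conditions for the toric equations\<close>

text \<open>The derivative of one coordinate along another; as an opaque constant it keeps the derivatives of
  explicit formulas free of case distinctions.\<close>

definition kron :: "'a \<Rightarrow> 'a \<Rightarrow> complex" where "kron i j = (if i = j then 1 else 0)"

lemma kron_same [simp]: "kron i i = 1" and kron_diff [simp]: "i \<noteq> j \<Longrightarrow> kron i j = 0"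
  by (auto simp: kron_def)

lemma DERIV_coord:
  "((\<lambda>z. slice x j z $ i) has_field_derivative kron i j) (at w)"
  by (auto simp: kron_def)

text \<open>A form of the power rule whose exponent does not drop, so that it is uniform in \<open>m\<close>.\<close>

lemma DERIV_power_div:
  fixes f :: "complex \<Rightarrow> complex"
  assumes "(f has_field_derivative D) (at z)" "f z \<noteq> 0"
  shows "((\<lambda>z. f z ^ m) has_field_derivative (of_nat m * f z ^ m / f z * D)) (at z)"
proof -
  have "of_nat m * f z ^ (m - 1) = of_nat m * f z ^ m / f z"
    using assms(2) by (cases m) auto
  then show ?thesis using DERIV_power[OF assms(1), of m] by (simp add: algebra_simps)
qed

lemma split_last_two:
  assumes "length ys \<ge> 2"
  obtains ys' i j where "ys = ys' @ [i, j]"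
proof -
  obtain zs j where zs: "ys = zs @ [j]" using assms by (cases ys rule: rev_cases) auto
  then obtain ys' i where "zs = ys' @ [i]" using assms by (cases zs rule: rev_cases) auto
  then show ?thesis using that zs by simp
qed

context quartic_config
begin

abbreviation X :: "'n set" where "X \<equiv> {i1, i2, i3, i4}"

lemma X_wp_inj: "i \<in> X \<Longrightarrow> j \<in> X \<Longrightarrow> wp i = wp j \<Longrightarrow> i = j" by auto

lemma length_X: "set js \<subseteq> X \<Longrightarrow> sum_list (map wd js) = length js"
  by (induction js) auto

lemma X_wk: "k \<in> K \<Longrightarrow> set js \<subseteq> X \<Longrightarrow> sum_list (map (wk k) js) = 0"
  by (induction js) auto

lemma block_mem_iff:
  assumes "k \<in> K"
  shows "sum_list (map (wk k) js) = 0 \<longleftrightarrow> ia k \<notin> set js \<and> ib k \<notin> set js"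
  using assms by (induction js) (auto simp: wk_def)

lemma pds_member_zero:
  assumes "holomorphic_on_Cn f U" "open U" "\<And>x. x \<in> U \<Longrightarrow> pd j f x = 0" "j \<in> set js" "x \<in> U"
  shows "pds js f x = 0"
  using pds_zero_mset[of f U "[j]" x js] assms by simp

text \<open>For a function of the first four variables, the toric equations say that derivatives of equal order
  and equal weight agree. In order one nothing is required since the four weights are distinct; from order two on it
  suffices that the second derivatives form a family as in \<open>pds_family\<close> with base direction \<open>i1\<close>, which has
  weight zero.\<close>

lemma sol_block_free:
  assumes U: "open U" and f: "holomorphic_on_Cn f U" and E: "Euler U wd 1 f" "Euler U wp 2 f"
    and blk: "\<And>k x. k \<in> K \<Longrightarrow> x \<in> U \<Longrightarrow> pd (ia k) f x = 0" "\<And>k x. k \<in> K \<Longrightarrow> x \<in> U \<Longrightarrow> pd (ib k) f x = 0"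
    and G: "\<And>m. holomorphic_on_Cn (G m) U"
    and G2: "\<And>i j x. i \<in> X \<Longrightarrow> j \<in> X \<Longrightarrow> x \<in> U \<Longrightarrow> pd i (pd j f) x = G (wp i + wp j) x"
    and G3: "\<And>i m x. i \<in> X \<Longrightarrow> x \<in> U \<Longrightarrow> pd i (G m) x = pd i1 (G (m + wp i)) x"
  shows "sol U f"
  unfolding sol_def
proof (intro conjI f E ballI allI impI)
  fix k assume k: "k \<in> K"
  show "Euler U (wk k) 0 f"
    unfolding Euler_def sum_index using k blk by auto
next
  fix js ks x assume eq: "weq js ks" and x: "x \<in> U"
  have zero: "pds ms f x = 0" if "\<not> set ms \<subseteq> X" for ms
  proof -
    from that obtain j where j: "j \<in> set ms" "j \<notin> X" by blast
    have "\<And>x. x \<in> U \<Longrightarrow> pd j f x = 0"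
      using index_cases[of j] j(2) blk by (metis insert_iff)
    then show ?thesis using pds_member_zero[OF f U _ j(1) x] by blast
  qed
  have "set ms \<subseteq> X \<longleftrightarrow> (\<forall>k\<in>K. sum_list (map (wk k) ms) = 0)" for ms
  proof
    assume R: "\<forall>k\<in>K. sum_list (map (wk k) ms) = 0"
    show "set ms \<subseteq> X"
    proof
      fix j assume "j \<in> set ms"
      then show "j \<in> X" using R block_mem_iff index_cases[of j] by (metis insert_iff)
    qed
  qed (use X_wk in blast)
  then have iff: "set js \<subseteq> X \<longleftrightarrow> set ks \<subseteq> X" using eq by (simp add: weq_def del: sum_list_eq_0_iff)
  show "pds js f x = pds ks f x"
  proof (cases "set js \<subseteq> X")
    case False
    then show ?thesis using zero iff by simp
  next
    case True
    then have sub: "set js \<subseteq> X" "set ks \<subseteq> X" using iff by auto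
    have len: "length js = length ks" and wps: "sum_list (map wp js) = sum_list (map wp ks)"
      using eq sub by (auto simp: weq_def length_X)
    have form: "pds ms f x = pds (replicate (length ms - 2) i1) (G (sum_list (map wp ms))) x"
      if ms: "set ms \<subseteq> X" "length ms \<ge> 2" for ms
    proof -
      obtain ms' i j where ms_eq: "ms = ms' @ [i, j]"
        using split_last_two[OF ms(2)] by blast
      have "pds ms f x = pds ms' (pd i (pd j f)) x" by (simp add: ms_eq)
      also have "\<dots> = pds ms' (G (wp i + wp j)) x"
        using ms(1) by (intro pds_cong[OF U x] G2) (auto simp: ms_eq)
      also have "\<dots> = pds (replicate (length ms') i1) (G (wp i + wp j + sum_list (map wp ms'))) x"
        using ms(1) by (intro pds_family[where C = X and U = U] U G G3 x) (auto simp: ms_eq)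
      finally show ?thesis by (simp add: ms_eq add_ac)
    qed
    consider "js = []" | i where "js = [i]" | "length js \<ge> 2"
      by (cases js; cases "tl js") auto
    then show ?thesis
    proof cases
      case 1
      then show ?thesis using len by simp
    next
      case 2
      then obtain j where "ks = [j]" using len by (cases ks) auto
      then show ?thesis using 2 sub wps X_wp_inj[of i j] by auto
    next
      case 3
      then show ?thesis using form[OF sub(1)] form[OF sub(2)] len wps by simp
    qed
  qed
qed

text \<open>For a function that is linear in the first four variables and involves one pair besides, both sides
  of a toric equation vanish unless they contain exactly one of the first four directions or none. In the
  first case the mixed second derivatives form a family with base direction \<open>ia k\<close>; in the second case
  equal degree and weight already force equal monomials.\<close>

lemma sol_one_block:
  assumes U: "open U" and f: "holomorphic_on_Cn f U" and k: "k \<in> K"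
    and E: "Euler U wd 1 f" "Euler U wp 2 f" "Euler U (wk k) 0 f"
    and blk: "\<And>l x. l \<in> K \<Longrightarrow> l \<noteq> k \<Longrightarrow> x \<in> U \<Longrightarrow> pd (ia l) f x = 0"
      "\<And>l x. l \<in> K \<Longrightarrow> l \<noteq> k \<Longrightarrow> x \<in> U \<Longrightarrow> pd (ib l) f x = 0"
    and lin: "\<And>i j x. i \<in> X \<Longrightarrow> j \<in> X \<Longrightarrow> x \<in> U \<Longrightarrow> pd i (pd j f) x = 0"
    and L: "\<And>m. holomorphic_on_Cn (L m) U"
    and La: "\<And>i x. i \<in> X \<Longrightarrow> x \<in> U \<Longrightarrow> pd (ia k) (pd i f) x = L (wp i) x"
    and Lb: "\<And>i x. i \<in> X \<Longrightarrow> x \<in> U \<Longrightarrow> pd (ib k) (pd i f) x = L (wp i + 1) x"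
    and Lab: "\<And>m x. x \<in> U \<Longrightarrow> pd (ib k) (L m) x = pd (ia k) (L (m + 1)) x"
  shows "sol U f"
  unfolding sol_def
proof (intro conjI f E ballI allI impI)
  fix l assume l: "l \<in> K"
  show "Euler U (wk l) 0 f"
  proof (cases "l = k")
    case False
    have "(\<Sum>j\<in>UNIV. of_nat (wk l j) * x $ j * pd j f x) = 0" if "x \<in> U" for x
    proof -
      have "(\<Sum>m\<in>K. of_nat (wk l (ia m)) * x $ ia m * pd (ia m) f x) = 0"
        "(\<Sum>m\<in>K. of_nat (wk l (ib m)) * x $ ib m * pd (ib m) f x) = 0"
        using l False blk that by (auto intro!: sum.neutral)
      then show ?thesis unfolding sum_index using l by simp
    qed
    then show ?thesis by (simp add: Euler_def)
  qed (use E in simp)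
next
  fix js ks x assume eq: "weq js ks" and x: "x \<in> U"
  show "pds js f x = pds ks f x"
  proof (cases "\<exists>l\<in>K. l \<noteq> k \<and> sum_list (map (wk l) js) \<noteq> 0")
    case True
    then obtain l where l: "l \<in> K" "l \<noteq> k" "sum_list (map (wk l) js) \<noteq> 0" by blast
    have "pds ms f x = 0" if "sum_list (map (wk l) ms) \<noteq> 0" for ms
      using that l blk pds_member_zero[OF f U _ _ x] block_mem_iff[OF l(1)] by metis
    then show ?thesis using l eq by (simp add: weq_def del: sum_list_eq_0_iff)
  next
    case False
    let ?C = "{ia k, ib k}"
    have sub: "set ms \<subseteq> X \<union> ?C" if "\<forall>l\<in>K. l \<noteq> k \<longrightarrow> sum_list (map (wk l) ms) = 0" for ms
    proof
      fix j assume "j \<in> set ms"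
      then show "j \<in> X \<union> ?C" using that block_mem_iff index_cases[of j] by (metis UnI1 UnI2 insert_iff)
    qed
    have sj: "set js \<subseteq> X \<union> ?C" using False by (intro sub) blast
    have "\<forall>l\<in>K. l \<noteq> k \<longrightarrow> sum_list (map (wk l) ks) = 0" using False eq unfolding weq_def by metis
    then have sk: "set ks \<subseteq> X \<union> ?C" by (rule sub)
    \<comment> \<open>the directions are sorted into those among the first four and those in the pair\<close>
    have dec: "\<exists>xs bs. mset ms = mset (bs @ xs) \<and> set xs \<subseteq> X \<and> set bs \<subseteq> ?C \<and> sum_list (map wd ms) = length xs
        \<and> sum_list (map (wk k) ms) = length bs \<and> sum_list (map wp ms) = sum_list (map wp bs) + sum_list (map wp xs)"
      if "set ms \<subseteq> X \<union> ?C" for ms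
      using that
    proof (induction ms)
      case (Cons j ms)
      then obtain xs bs where IH: "mset ms = mset (bs @ xs)" "set xs \<subseteq> X" "set bs \<subseteq> ?C" "sum_list (map wd ms) = length xs"
        "sum_list (map (wk k) ms) = length bs" "sum_list (map wp ms) = sum_list (map wp bs) + sum_list (map wp xs)" by auto
      show ?case
      proof (cases "j \<in> X")
        case True
        then show ?thesis using IH k by (intro exI[of _ "j # xs"] exI[of _ bs]) auto
      next
        case False
        then show ?thesis using IH k Cons.prems by (intro exI[of _ xs] exI[of _ "j # bs"]) auto
      qed
    qed auto
    obtain xs bs where J: "mset js = mset (bs @ xs)" "set xs \<subseteq> X" "set bs \<subseteq> ?C" "sum_list (map wd js) = length xs"
        "sum_list (map (wk k) js) = length bs" "sum_list (map wp js) = sum_list (map wp bs) + sum_list (map wp xs)"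
      using dec[OF sj] by blast
    obtain xs' bs' where J': "mset ks = mset (bs' @ xs')" "set xs' \<subseteq> X" "set bs' \<subseteq> ?C" "sum_list (map wd ks) = length xs'"
        "sum_list (map (wk k) ks) = length bs'" "sum_list (map wp ks) = sum_list (map wp bs') + sum_list (map wp xs')"
      using dec[OF sk] by blast
    have len: "length xs = length xs'" "length bs = length bs'"
      and wps: "sum_list (map wp bs) + sum_list (map wp xs) = sum_list (map wp bs') + sum_list (map wp xs')"
      using eq J J' k by (auto simp: weq_def)
    have js: "pds js f x = pds bs (pds xs f) x" using pds_mset_eq[OF f U x J(1)] by simp
    have ks: "pds ks f x = pds bs' (pds xs' f) x" using pds_mset_eq[OF f U x J'(1)] by simp
    have two: "pds cs (pds ys f) x = 0" if h: "length ys \<ge> 2" "set ys \<subseteq> X" for cs ys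
    proof -
      obtain ys' i j where ys: "ys = ys' @ [i, j]"
        using split_last_two[OF h(1)] by blast
      have "pds ((cs @ ys') @ [i, j]) f x = 0"
        using h(2) lin by (intro pds_zero[OF U _ x]) (auto simp: ys)
      then show ?thesis by (simp add: ys)
    qed
    have one: "pds (cs @ [c]) (pds [i] f) x = pds (replicate (length cs) (ia k)) (L (wp i + sum_list (map wp (cs @ [c])))) x"
      if "i \<in> X" "set (cs @ [c]) \<subseteq> ?C" for i c cs
    proof -
      have "pds (cs @ [c]) (pds [i] f) x = pds cs (L (wp i + wp c)) x"
      proof -
        have "c = ia k \<or> c = ib k" using that by auto
        then have "\<And>x. x \<in> U \<Longrightarrow> pd c (pd i f) x = L (wp i + wp c) x"
          using La[OF that(1)] Lb[OF that(1)] k by auto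
        then show ?thesis using pds_cong[OF U x, of "pd c (pd i f)" "L (wp i + wp c)" cs] by simp
      qed
      also have "\<dots> = pds (replicate (length cs) (ia k)) (L (wp i + wp c + sum_list (map wp cs))) x"
        using that k Lab by (intro pds_family[where C = ?C and U = U] U L x) auto
      finally show ?thesis by (simp add: add_ac)
    qed
    consider "length xs = 0" | "length xs = 1" | "length xs \<ge> 2" by linarith
    then show ?thesis
    proof cases
      case 1
      then have e: "xs = []" "xs' = []" using len by auto
      have "mset bs = mset bs'"
      proof -
        have cnt: "mset cs = replicate_mset (length cs - sum_list (map wp cs)) (ia k) + replicate_mset (sum_list (map wp cs)) (ib k)
            \<and> sum_list (map wp cs) \<le> length cs"
          if "set cs \<subseteq> ?C" for cs using that
        proof (induction cs)
          case (Cons c cs)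
          then show ?case using k by (auto simp: Suc_diff_le)
        qed simp
        show ?thesis using cnt[OF J(3)] cnt[OF J'(3)] len wps e by simp
      qed
      then show ?thesis using e J J' pds_mset_eq[OF f U x, of js ks] by simp
    next
      case 2
      then obtain i i' where ii: "xs = [i]" "xs' = [i']" using len by (metis One_nat_def length_0_conv length_Suc_conv)
      then have iX: "i \<in> X" "i' \<in> X" using J J' by auto
      show ?thesis
      proof (cases bs rule: rev_cases)
        case Nil
        then have "i = i'" using wps len ii iX X_wp_inj[of i i'] by auto
        then show ?thesis using js ks ii Nil len by simp
      next
        case (snoc cs c)
        then obtain cs' c' where "bs' = cs' @ [c']" using len by (cases bs' rule: rev_cases) auto
        note s = snoc this
        show ?thesis unfolding js ks ii s
          using one[OF iX(1), of cs c] one[OF iX(2), of cs' c'] J(3) J'(3) s len wps ii by (simp add: add_ac)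
      qed
    next
      case 3
      then show ?thesis unfolding js ks using two J(2) J'(2) len by simp
    qed
  qed
qed

end

section \<open>Explicit solutions\<close>

context quartic_config
begin

text \<open>The solution that the four values of the antiderivative at the roots do not provide; \<open>KY\<close> lists its second
  derivatives by weight.\<close>

definition Y :: "complex^'n \<Rightarrow> complex" where "Y x = (x $ i2)\<^sup>2 / x $ i1"

definition KY :: "nat \<Rightarrow> complex^'n \<Rightarrow> complex" where
  "KY m x = (if m = 0 then 2 * (x $ i2)\<^sup>2 / x $ i1 ^ 3 else if m = 1 then - 2 * x $ i2 / (x $ i1)\<^sup>2
     else if m = 2 then 2 / x $ i1 else 0)"

lemma pd_Y:
  assumes "x $ i1 \<noteq> 0"
  shows "pd j Y x = 2 * kron i2 j * x $ i2 / x $ i1 - kron i1 j * (x $ i2)\<^sup>2 / (x $ i1)\<^sup>2"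
proof -
  have "((\<lambda>z. (slice x j z $ i2)\<^sup>2 / slice x j z $ i1) has_field_derivative
      (2 * x $ i2 * kron i2 j * x $ i1 - (x $ i2)\<^sup>2 * kron i1 j) / (x $ i1 * x $ i1)) (at (x $ j))"
    by ((rule derivative_eq_intros DERIV_coord refl | (simp add: assms; fail))+, (simp add: field_simps eval_nat_numeral assms)?)
  then have "pd j Y x = (2 * x $ i2 * kron i2 j * x $ i1 - (x $ i2)\<^sup>2 * kron i1 j) / (x $ i1 * x $ i1)"
    unfolding Y_def[abs_def] by (rule pd_eqI)
  then show ?thesis using assms by (simp add: field_simps power2_eq_square)
qed

lemma Y_hol:
  assumes "\<And>x. x \<in> U \<Longrightarrow> x $ i1 \<noteq> 0"
  shows "holomorphic_on_Cn Y U" "holomorphic_on_Cn (KY m) U"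
proof -
  show "holomorphic_on_Cn Y U" unfolding Y_def[abs_def]
    by (intro holo_divide holo_power holo_coord assms)
  have "m = 0 \<or> m = 1 \<or> m = 2 \<or> m > 2" by linarith
  then show "holomorphic_on_Cn (KY m) U" unfolding KY_def[abs_def]
    by (elim disjE) (auto intro!: holo_divide holo_power holo_coord holo_mult holo_const holo_uminus dest: assms)
qed

lemma pd_KY:
  assumes "x $ i1 \<noteq> 0"
  shows "pd j (KY m) x = (if m = 0 then 4 * kron i2 j * x $ i2 / x $ i1 ^ 3 - 6 * kron i1 j * (x $ i2)\<^sup>2 / x $ i1 ^ 4
    else if m = 1 then - 2 * kron i2 j / (x $ i1)\<^sup>2 + 4 * kron i1 j * x $ i2 / (x $ i1) ^ 3
    else if m = 2 then - 2 * kron i1 j / (x $ i1)\<^sup>2 else 0)"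
proof -
  have "((\<lambda>z. 2 * (slice x j z $ i2)\<^sup>2 / slice x j z $ i1 ^ 3) has_field_derivative
      4 * kron i2 j * x $ i2 / x $ i1 ^ 3 - 6 * kron i1 j * (x $ i2)\<^sup>2 / x $ i1 ^ 4) (at (x $ j))"
    by ((rule derivative_eq_intros DERIV_coord refl | (simp add: assms; fail))+, (simp add: field_simps eval_nat_numeral assms)?)
  moreover have "((\<lambda>z. - 2 * slice x j z $ i2 / (slice x j z $ i1)\<^sup>2) has_field_derivative
      - 2 * kron i2 j / (x $ i1)\<^sup>2 + 4 * kron i1 j * x $ i2 / (x $ i1) ^ 3) (at (x $ j))"
    by ((rule derivative_eq_intros DERIV_coord refl | (simp add: assms; fail))+, (simp add: field_simps eval_nat_numeral assms)?)
  moreover have "((\<lambda>z. 2 / slice x j z $ i1) has_field_derivative - 2 * kron i1 j / (x $ i1)\<^sup>2) (at (x $ j))"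
    by ((rule derivative_eq_intros DERIV_coord refl | (simp add: assms; fail))+, (simp add: field_simps eval_nat_numeral assms)?)
  ultimately show ?thesis unfolding KY_def[abs_def]
    by (auto intro!: pd_eqI)
qed

lemma Y_sol:
  assumes U: "open U" and nz: "\<And>x. x \<in> U \<Longrightarrow> x $ i1 \<noteq> 0"
  shows "sol U Y" "\<And>i j x. i \<in> X \<Longrightarrow> j \<in> X \<Longrightarrow> x \<in> U \<Longrightarrow> pd i (pd j Y) x = KY (wp i + wp j) x"
    "\<And>k x. k \<in> K \<Longrightarrow> x \<in> U \<Longrightarrow> pd (ia k) Y x = 0" "\<And>k x. k \<in> K \<Longrightarrow> x \<in> U \<Longrightarrow> pd (ib k) Y x = 0"
proof -
  show blk: "\<And>k x. k \<in> K \<Longrightarrow> x \<in> U \<Longrightarrow> pd (ia k) Y x = 0" "\<And>k x. k \<in> K \<Longrightarrow> x \<in> U \<Longrightarrow> pd (ib k) Y x = 0"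
    using nz by (auto simp: pd_Y)
  show G2: "pd i (pd j Y) x = KY (wp i + wp j) x" if "i \<in> X" "j \<in> X" "x \<in> U" for i j x
  proof -
    have "pd i (pd j Y) x = pd i (\<lambda>x. 2 * kron i2 j * x $ i2 / x $ i1 - kron i1 j * (x $ i2)\<^sup>2 / (x $ i1)\<^sup>2) x"
      by (rule pd_cong[OF U that(3)]) (use nz in \<open>simp add: pd_Y\<close>)
    also have "((\<lambda>z. 2 * kron i2 j * slice x i z $ i2 / slice x i z $ i1 - kron i1 j * (slice x i z $ i2)\<^sup>2 / (slice x i z $ i1)\<^sup>2) has_field_derivative
      2 * kron i2 j * kron i2 i / x $ i1 - 2 * kron i2 j * kron i1 i * x $ i2 / (x $ i1)\<^sup>2
       - 2 * kron i1 j * kron i2 i * x $ i2 / (x $ i1)\<^sup>2 + 2 * kron i1 j * kron i1 i * (x $ i2)\<^sup>2 / (x $ i1) ^ 3) (at (x $ i))"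
      by ((rule derivative_eq_intros DERIV_coord refl | (simp add: nz that; fail))+, (simp add: field_simps eval_nat_numeral nz that)?)
    then have "pd i (\<lambda>x. 2 * kron i2 j * x $ i2 / x $ i1 - kron i1 j * (x $ i2)\<^sup>2 / (x $ i1)\<^sup>2) x =
       2 * kron i2 j * kron i2 i / x $ i1 - 2 * kron i2 j * kron i1 i * x $ i2 / (x $ i1)\<^sup>2
       - 2 * kron i1 j * kron i2 i * x $ i2 / (x $ i1)\<^sup>2 + 2 * kron i1 j * kron i1 i * (x $ i2)\<^sup>2 / (x $ i1) ^ 3"
      by (rule pd_eqI)
    also have "\<dots> = KY (wp i + wp j) x"
      using that(1,2) by (auto simp: KY_def)
    finally show ?thesis .
  qed
  show "sol U Y"
  proof (rule sol_block_free[OF U _ _ _ blk _ G2])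
    show "holomorphic_on_Cn Y U" "holomorphic_on_Cn (KY m) U" for m using Y_hol nz by blast+
    show "Euler U wd 1 Y" "Euler U wp 2 Y"
      unfolding Euler_def sum_index
      using nz by (auto simp: pd_Y Y_def field_simps power2_eq_square)
    show "pd i (KY m) x = pd i1 (KY (m + wp i)) x" if "i \<in> X" "x \<in> U" for i m x
      using that nz by (auto simp: pd_KY)
  qed
qed

lemma sum_index_one_block:
  fixes f :: "'n \<Rightarrow> complex"
  assumes k: "k \<in> K" and z: "\<And>l. l \<in> K \<Longrightarrow> l \<noteq> k \<Longrightarrow> f (ia l) = 0 \<and> f (ib l) = 0"
  shows "sum f UNIV = f i1 + f i2 + f i3 + f i4 + f (ia k) + f (ib k)"
proof -
  have "(\<Sum>l\<in>K. f (ia l)) = f (ia k)" "(\<Sum>l\<in>K. f (ib l)) = f (ib k)"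
    using z k finK by (auto simp: sum.remove[of K k] intro!: sum.neutral)
  then show ?thesis by (simp add: sum_index)
qed

text \<open>The antiderivative \<open>- x1/(2 t^2) - x2/t + x3 t + x4 t^2/2\<close> of \<open>(x1 + x2 t + x3 t^3 + x4 t^4)/t^3\<close>,
  evaluated at the zero \<open>t = - a_k/b_k\<close> of the linear polynomial, is \<open>P k + Q k\<close>. The monomial \<open>t^2\<close> is
  missing from the quartic, so no toric equation couples the part with negative powers to the part with positive
  powers, and \<open>P k\<close> and \<open>Q k\<close> are solutions separately. This doubling is responsible for the rank jump.\<close>

definition P :: "nat \<Rightarrow> complex^'n \<Rightarrow> complex" where
  "P k x = x $ i2 * x $ ib k / x $ ia k - x $ i1 * (x $ ib k)\<^sup>2 / (2 * (x $ ia k)\<^sup>2)"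

definition Q :: "nat \<Rightarrow> complex^'n \<Rightarrow> complex" where
  "Q k x = x $ i4 * (x $ ia k)\<^sup>2 / (2 * (x $ ib k)\<^sup>2) - x $ i3 * x $ ia k / x $ ib k"

text \<open>The mixed second derivatives of \<open>P k\<close> and \<open>Q k\<close> by weight. The second family continues beyond the weights that
  occur, as the recursion between neighbours demands.\<close>

definition LP :: "nat \<Rightarrow> nat \<Rightarrow> complex^'n \<Rightarrow> complex" where
  "LP k m x = (if m = 0 then (x $ ib k)\<^sup>2 / x $ ia k ^ 3 else if m = 1 then - x $ ib k / (x $ ia k)\<^sup>2
     else if m = 2 then 1 / x $ ia k else 0)"

definition LQ :: "nat \<Rightarrow> nat \<Rightarrow> complex^'n \<Rightarrow> complex" where
  "LQ k m x = (if m < 3 then 0 else - ((- x $ ia k / x $ ib k) ^ (m - 3) / x $ ib k))"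

lemma pd_P:
  fixes x :: "complex^'n"
  assumes "x $ ia k \<noteq> 0"
  shows "pd j (P k) x = kron i2 j * x $ ib k / x $ ia k - kron i1 j * (x $ ib k)\<^sup>2 / (2 * (x $ ia k)\<^sup>2)
     + kron (ib k) j * (x $ i2 / x $ ia k - x $ i1 * x $ ib k / (x $ ia k)\<^sup>2)
     + kron (ia k) j * (x $ i1 * (x $ ib k)\<^sup>2 / x $ ia k ^ 3 - x $ i2 * x $ ib k / (x $ ia k)\<^sup>2)"
  unfolding P_def[abs_def]
  by (rule pd_eqI, (rule derivative_eq_intros DERIV_coord refl | (simp add: assms; fail))+, (simp add: field_simps eval_nat_numeral assms)?)

lemma pd_Q:
  assumes "x $ ib k \<noteq> 0"
  shows "pd j (Q k) x = kron i4 j * (x $ ia k)\<^sup>2 / (2 * (x $ ib k)\<^sup>2) - kron i3 j * x $ ia k / x $ ib k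
     + kron (ia k) j * (x $ i4 * x $ ia k / (x $ ib k)\<^sup>2 - x $ i3 / x $ ib k)
     + kron (ib k) j * (x $ i3 * x $ ia k / (x $ ib k)\<^sup>2 - x $ i4 * (x $ ia k)\<^sup>2 / x $ ib k ^ 3)"
  unfolding Q_def[abs_def]
  by (rule pd_eqI, (rule derivative_eq_intros DERIV_coord refl | (simp add: assms; fail))+, (simp add: field_simps eval_nat_numeral assms)?)

lemma pd_LP:
  assumes "x $ ia k \<noteq> 0"
  shows "pd j (LP k m) x =
    (if m = 0 then 2 * kron (ib k) j * x $ ib k / x $ ia k ^ 3 - 3 * kron (ia k) j * (x $ ib k)\<^sup>2 / x $ ia k ^ 4
     else if m = 1 then - kron (ib k) j / (x $ ia k)\<^sup>2 + 2 * kron (ia k) j * x $ ib k / x $ ia k ^ 3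
     else if m = 2 then - kron (ia k) j / (x $ ia k)\<^sup>2 else 0)"
proof -
  have "((\<lambda>z. (slice x j z $ ib k)\<^sup>2 / slice x j z $ ia k ^ 3) has_field_derivative
     2 * kron (ib k) j * x $ ib k / x $ ia k ^ 3 - 3 * kron (ia k) j * (x $ ib k)\<^sup>2 / x $ ia k ^ 4) (at (x $ j))"
    by ((rule derivative_eq_intros DERIV_coord refl | (simp add: assms; fail))+, (simp add: field_simps eval_nat_numeral assms)?)
  moreover have "((\<lambda>z. - slice x j z $ ib k / (slice x j z $ ia k)\<^sup>2) has_field_derivative
     - kron (ib k) j / (x $ ia k)\<^sup>2 + 2 * kron (ia k) j * x $ ib k / x $ ia k ^ 3) (at (x $ j))"
    by ((rule derivative_eq_intros DERIV_coord refl | (simp add: assms; fail))+, (simp add: field_simps eval_nat_numeral assms)?)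
  moreover have "((\<lambda>z. 1 / slice x j z $ ia k) has_field_derivative - kron (ia k) j / (x $ ia k)\<^sup>2) (at (x $ j))"
    by ((rule derivative_eq_intros DERIV_coord refl | (simp add: assms; fail))+, (simp add: field_simps eval_nat_numeral assms)?)
  ultimately show ?thesis unfolding LP_def[abs_def] by (auto intro!: pd_eqI)
qed

lemma P_sol:
  assumes U: "open U" and k: "k \<in> K" and nz: "\<And>x. x \<in> U \<Longrightarrow> x $ ia k \<noteq> 0"
  shows "sol U (P k)"
proof (rule sol_one_block[OF U _ k, where L = "LP k"])
  show "holomorphic_on_Cn (P k) U" unfolding P_def[abs_def]
    by (intro holo_divide holo_power holo_coord holo_mult holo_diff holo_const) (use nz in auto)
  show "holomorphic_on_Cn (LP k m) U" for m unfolding LP_def[abs_def]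
    by (cases "m = 0"; cases "m = 1"; cases "m = 2") (auto intro!: holo_divide holo_power holo_coord holo_mult holo_const holo_uminus dest: nz)
  have z: "pd (ia l) (P k) x = 0 \<and> pd (ib l) (P k) x = 0" if "l \<in> K" "l \<noteq> k" "x \<in> U" for l x
    using that nz k by (auto simp: pd_P)
  have s: "(\<Sum>j\<in>UNIV. of_nat (w j) * x $ j * pd j (P k) x) = of_nat (w i1) * x $ i1 * pd i1 (P k) x
      + of_nat (w i2) * x $ i2 * pd i2 (P k) x + of_nat (w i3) * x $ i3 * pd i3 (P k) x + of_nat (w i4) * x $ i4 * pd i4 (P k) x
      + of_nat (w (ia k)) * x $ ia k * pd (ia k) (P k) x + of_nat (w (ib k)) * x $ ib k * pd (ib k) (P k) x"
    if "x \<in> U" for w :: "'n \<Rightarrow> nat" and x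
    using z[OF _ _ that] by (intro sum_index_one_block[OF k]) simp
  show "Euler U wd 1 (P k)" "Euler U wp 2 (P k)" "Euler U (wk k) 0 (P k)"
    unfolding Euler_def
    by (rule ballI, simp only: s, simp add: nz k pd_P P_def field_simps eval_nat_numeral)+
  show "pd (ia l) (P k) x = 0" "pd (ib l) (P k) x = 0" if "l \<in> K" "l \<noteq> k" "x \<in> U" for l x
    using that nz k by (auto simp: pd_P)
  have dd: "pd i (pd j (P k)) x = pd i (\<lambda>x. kron i2 j * x $ ib k / x $ ia k - kron i1 j * (x $ ib k)\<^sup>2 / (2 * (x $ ia k)\<^sup>2)) x"
    if "j \<in> X" "x \<in> U" for i j x
    by (rule pd_cong[OF U that(2)]) (use nz that k in \<open>auto simp: pd_P\<close>)
  have ee: "pd i (\<lambda>x. kron i2 j * x $ ib k / x $ ia k - kron i1 j * (x $ ib k)\<^sup>2 / (2 * (x $ ia k)\<^sup>2)) x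
     = kron i2 j * (kron (ib k) i / x $ ia k - kron (ia k) i * x $ ib k / (x $ ia k)\<^sup>2)
       - kron i1 j * (kron (ib k) i * x $ ib k / (x $ ia k)\<^sup>2 - kron (ia k) i * (x $ ib k)\<^sup>2 / x $ ia k ^ 3)"
    if "x \<in> U" for i j x
    by (rule pd_eqI, (rule derivative_eq_intros DERIV_coord refl | (simp add: nz[OF that]; fail))+, (simp add: field_simps eval_nat_numeral nz[OF that])?)
  note de = trans[OF dd ee]
  show "pd i (pd j (P k)) x = 0" if "i \<in> X" "j \<in> X" "x \<in> U" for i j x
    using that k by (auto simp: de)
  show "pd (ia k) (pd i (P k)) x = LP k (wp i) x" "pd (ib k) (pd i (P k)) x = LP k (wp i + 1) x"
    if "i \<in> X" "x \<in> U" for i x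
    using that k nz by (auto simp: de LP_def)
  show "pd (ib k) (LP k m) x = pd (ia k) (LP k (m + 1)) x" if "x \<in> U" for m x
    using nz[OF that] k by (auto simp: pd_LP)
qed

lemma pd_LQ:
  assumes "x $ ib k \<noteq> 0" "x $ ia k \<noteq> 0" and k: "k \<in> K"
  shows "pd (ib k) (LQ k m) x = pd (ia k) (LQ k (m + 1)) x"
proof -
  have a: "pd (ia k) (LQ k (n + 3)) x = - (of_nat n * (- x $ ia k / x $ ib k) ^ n / (x $ ia k * x $ ib k))" for n
  proof -
    have "((\<lambda>z. - ((- slice x (ia k) z $ ia k / slice x (ia k) z $ ib k) ^ n / slice x (ia k) z $ ib k)) has_field_derivative
       - (of_nat n * (- x $ ia k / x $ ib k) ^ n / (x $ ia k * x $ ib k))) (at (x $ ia k))"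
      by ((rule derivative_eq_intros DERIV_power_div DERIV_coord refl | (simp add: assms; fail))+, (simp add: field_simps eval_nat_numeral assms)?)
    then show ?thesis unfolding LQ_def[abs_def] by (intro pd_eqI) simp
  qed
  have b: "pd (ib k) (LQ k (n + 3)) x = (of_nat n + 1) * (- x $ ia k / x $ ib k) ^ n / (x $ ib k)\<^sup>2" for n
  proof -
    have "((\<lambda>z. - ((- slice x (ib k) z $ ia k / slice x (ib k) z $ ib k) ^ n / slice x (ib k) z $ ib k)) has_field_derivative
       (of_nat n + 1) * (- x $ ia k / x $ ib k) ^ n / (x $ ib k)\<^sup>2) (at (x $ ib k))"
      by ((rule derivative_eq_intros DERIV_power_div DERIV_coord refl | (simp add: assms; fail))+, (simp add: field_simps eval_nat_numeral assms)?)
    then show ?thesis unfolding LQ_def[abs_def] by (intro pd_eqI) simp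
  qed
  consider "m < 2" | "m = 2" | n where "m = n + 3"
    by (metis One_nat_def Suc_1 add.commute less_antisym linorder_neqE_nat nat_le_iff_add not_less numeral_3_eq_3)
  then show ?thesis
  proof cases
    case 1
    then have "LQ k m = (\<lambda>x. 0)" "LQ k (m + 1) = (\<lambda>x. 0)" by (auto simp: LQ_def fun_eq_iff)
    then show ?thesis by simp
  next
    case 2
    then have "LQ k m = (\<lambda>x. 0)" by (auto simp: LQ_def fun_eq_iff)
    then show ?thesis using a[of 0] 2 by simp
  next
    case 3
    have "m + 1 = (n + 1) + 3" using 3 by simp
    then have "pd (ia k) (LQ k (m + 1)) x = - (of_nat (n + 1) * (- x $ ia k / x $ ib k) ^ (n + 1) / (x $ ia k * x $ ib k))"
      using a[of "n + 1"] by (simp only:)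
    also have "\<dots> = (of_nat n + 1) * (- x $ ia k / x $ ib k) ^ n / (x $ ib k)\<^sup>2"
      using assms by (simp add: field_simps power2_eq_square)
    finally show ?thesis using b[of n] 3 by simp
  qed
qed

lemma Q_sol:
  assumes U: "open U" and k: "k \<in> K" and nz: "\<And>x. x \<in> U \<Longrightarrow> x $ ib k \<noteq> 0"
    and nza: "\<And>x. x \<in> U \<Longrightarrow> x $ ia k \<noteq> 0"
  shows "sol U (Q k)"
proof (rule sol_one_block[OF U _ k, where L = "LQ k"])
  show "holomorphic_on_Cn (Q k) U" unfolding Q_def[abs_def]
    by (intro holo_divide holo_power holo_coord holo_mult holo_diff holo_const) (use nz in auto)
  show "holomorphic_on_Cn (LQ k m) U" for m unfolding LQ_def[abs_def]
    by (cases "m < 3") (auto intro!: holo_divide holo_power holo_coord holo_mult holo_const holo_uminus dest: nz)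
  have z: "pd (ia l) (Q k) x = 0 \<and> pd (ib l) (Q k) x = 0" if "l \<in> K" "l \<noteq> k" "x \<in> U" for l x
    using that nz k by (auto simp: pd_Q)
  have s: "(\<Sum>j\<in>UNIV. of_nat (w j) * x $ j * pd j (Q k) x) = of_nat (w i1) * x $ i1 * pd i1 (Q k) x
      + of_nat (w i2) * x $ i2 * pd i2 (Q k) x + of_nat (w i3) * x $ i3 * pd i3 (Q k) x + of_nat (w i4) * x $ i4 * pd i4 (Q k) x
      + of_nat (w (ia k)) * x $ ia k * pd (ia k) (Q k) x + of_nat (w (ib k)) * x $ ib k * pd (ib k) (Q k) x"
    if "x \<in> U" for w :: "'n \<Rightarrow> nat" and x
    using z[OF _ _ that] by (intro sum_index_one_block[OF k]) simp
  show "Euler U wd 1 (Q k)" "Euler U wp 2 (Q k)" "Euler U (wk k) 0 (Q k)"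
    unfolding Euler_def
    by (rule ballI, simp only: s, simp add: nz k pd_Q Q_def field_simps eval_nat_numeral)+
  show "pd (ia l) (Q k) x = 0" "pd (ib l) (Q k) x = 0" if "l \<in> K" "l \<noteq> k" "x \<in> U" for l x
    using that nz k by (auto simp: pd_Q)
  have dd: "pd i (pd j (Q k)) x = pd i (\<lambda>x. kron i4 j * (x $ ia k)\<^sup>2 / (2 * (x $ ib k)\<^sup>2) - kron i3 j * x $ ia k / x $ ib k) x"
    if "j \<in> X" "x \<in> U" for i j x
    by (rule pd_cong[OF U that(2)]) (use nz that k in \<open>auto simp: pd_Q\<close>)
  have ee: "pd i (\<lambda>x. kron i4 j * (x $ ia k)\<^sup>2 / (2 * (x $ ib k)\<^sup>2) - kron i3 j * x $ ia k / x $ ib k) x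
     = kron i4 j * (kron (ia k) i * x $ ia k / (x $ ib k)\<^sup>2 - kron (ib k) i * (x $ ia k)\<^sup>2 / x $ ib k ^ 3)
       - kron i3 j * (kron (ia k) i / x $ ib k - kron (ib k) i * x $ ia k / (x $ ib k)\<^sup>2)"
    if "x \<in> U" for i j x
    by (rule pd_eqI, (rule derivative_eq_intros DERIV_coord refl | (simp add: nz[OF that]; fail))+, (simp add: field_simps eval_nat_numeral nz[OF that])?)
  note de = trans[OF dd ee]
  show "pd i (pd j (Q k)) x = 0" if "i \<in> X" "j \<in> X" "x \<in> U" for i j x
    using that k by (auto simp: de)
  show "pd (ia k) (pd i (Q k)) x = LQ k (wp i) x" "pd (ib k) (pd i (Q k)) x = LQ k (wp i + 1) x"
    if "i \<in> X" "x \<in> U" for i x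
    using that k nz by (auto simp: de LQ_def field_simps eval_nat_numeral)
  show "pd (ib k) (LQ k m) x = pd (ia k) (LQ k (m + 1)) x" if "x \<in> U" for m x
    using pd_LQ[OF nz[OF that] nza[OF that] k] .
qed

text \<open>The derivative of the quartic with respect to \<open>t\<close> at the root \<open>\<rho>\<close>.\<close>

definition df :: "(complex^'n \<Rightarrow> complex) \<Rightarrow> complex^'n \<Rightarrow> complex" where
  "df \<rho> x = x $ i2 + 3 * x $ i3 * (\<rho> x)\<^sup>2 + 4 * x $ i4 * \<rho> x ^ 3"

definition is_root :: "(complex^'n) set \<Rightarrow> (complex^'n \<Rightarrow> complex) \<Rightarrow> bool" where
  "is_root U \<rho> \<longleftrightarrow> holomorphic_on_Cn \<rho> U \<and> (\<forall>x\<in>U. \<rho> x \<noteq> 0 \<and> df \<rho> x \<noteq> 0 \<and>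
     x $ i1 + x $ i2 * \<rho> x + x $ i3 * \<rho> x ^ 3 + x $ i4 * \<rho> x ^ 4 = 0)"

text \<open>The antiderivative evaluated at a root of the quartic.\<close>

definition F :: "(complex^'n \<Rightarrow> complex) \<Rightarrow> complex^'n \<Rightarrow> complex" where
  "F \<rho> x = - x $ i1 / (2 * (\<rho> x)\<^sup>2) - x $ i2 / \<rho> x + x $ i3 * \<rho> x + x $ i4 * (\<rho> x)\<^sup>2 / 2"

text \<open>The second derivatives of \<open>F \<rho>\<close> by weight.\<close>

definition KF :: "(complex^'n \<Rightarrow> complex) \<Rightarrow> nat \<Rightarrow> complex^'n \<Rightarrow> complex" where
  "KF \<rho> m x = - (\<rho> x ^ m / (\<rho> x ^ 3 * df \<rho> x))"

context
  fixes U \<rho>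
  assumes U: "open U" and root: "is_root U \<rho>"
begin

lemma root_hol: "holomorphic_on_Cn \<rho> U" using root by (simp add: is_root_def)

lemma root_facts:
  assumes "x \<in> U"
  shows "\<rho> x \<noteq> 0" "df \<rho> x \<noteq> 0" "x $ i1 + x $ i2 * \<rho> x + x $ i3 * \<rho> x ^ 3 + x $ i4 * \<rho> x ^ 4 = 0"
  using root assms by (auto simp: is_root_def)

lemma DERIV_root: "x \<in> U \<Longrightarrow> ((\<lambda>z. \<rho> (slice x j z)) has_field_derivative pd j \<rho> x) (at (x $ j))"
  by (rule holo_has_derivative(2)[OF root_hol])

lemma pd_root_aux:
  assumes x: "x \<in> U"
  shows "kron i1 j + kron i2 j * \<rho> x + kron i3 j * \<rho> x ^ 3 + kron i4 j * \<rho> x ^ 4 + df \<rho> x * pd j \<rho> x = 0"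
proof -
  have "pd j (\<lambda>x. x $ i1 + x $ i2 * \<rho> x + x $ i3 * \<rho> x ^ 3 + x $ i4 * \<rho> x ^ 4) x = pd j (\<lambda>x. 0) x"
    by (rule pd_cong[OF U x root_facts(3)])
  moreover have "pd j (\<lambda>x. x $ i1 + x $ i2 * \<rho> x + x $ i3 * \<rho> x ^ 3 + x $ i4 * \<rho> x ^ 4) x =
     kron i1 j + kron i2 j * \<rho> x + kron i3 j * \<rho> x ^ 3 + kron i4 j * \<rho> x ^ 4 + df \<rho> x * pd j \<rho> x"
    by (rule pd_eqI, (rule derivative_eq_intros DERIV_coord DERIV_root x refl)+)
       (simp add: df_def algebra_simps eval_nat_numeral)
  ultimately show ?thesis by simp
qed

lemma pd_root:
  assumes x: "x \<in> U"
  shows "j \<in> X \<Longrightarrow> pd j \<rho> x = - (\<rho> x ^ wp j / df \<rho> x)"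
    and "k \<in> K \<Longrightarrow> pd (ia k) \<rho> x = 0" "k \<in> K \<Longrightarrow> pd (ib k) \<rho> x = 0"
proof -
  show "pd j \<rho> x = - (\<rho> x ^ wp j / df \<rho> x)" if "j \<in> X"
  proof -
    have "\<rho> x ^ wp j + df \<rho> x * pd j \<rho> x = 0" using pd_root_aux[OF x, of j] that by auto
    then show ?thesis using root_facts(2)[OF x] by (simp add: field_simps add_eq_0_iff)
  qed
  show "pd (ia k) \<rho> x = 0" "pd (ib k) \<rho> x = 0" if "k \<in> K"
    using pd_root_aux[OF x, of "ia k"] pd_root_aux[OF x, of "ib k"] that root_facts(2)[OF x] by auto
qed

text \<open>The root is a critical point of the antiderivative, so the motion of the root does not contribute
  and only the coefficients are differentiated.\<close>

lemma pd_F: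
  assumes x: "x \<in> U"
  shows "pd j (F \<rho>) x = - kron i1 j / (2 * (\<rho> x)\<^sup>2) - kron i2 j / \<rho> x + kron i3 j * \<rho> x + kron i4 j * (\<rho> x)\<^sup>2 / 2"
proof -
  \<comment> \<open>the last summand is the derivative of the antiderivative at the root times the derivative of the root\<close>
  have "pd j (F \<rho>) x = - kron i1 j / (2 * (\<rho> x)\<^sup>2) - kron i2 j / \<rho> x + kron i3 j * \<rho> x + kron i4 j * (\<rho> x)\<^sup>2 / 2
     + (x $ i1 + x $ i2 * \<rho> x + x $ i3 * \<rho> x ^ 3 + x $ i4 * \<rho> x ^ 4) / \<rho> x ^ 3 * pd j \<rho> x"
    unfolding F_def[abs_def]
    by (rule pd_eqI, (rule derivative_eq_intros DERIV_coord DERIV_root x refl | (simp add: root_facts(1)[OF x]; fail))+, (simp add: field_simps eval_nat_numeral root_facts(1)[OF x])?)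
  then show ?thesis using root_facts(3)[OF x] by simp
qed

lemma KF_hol: "holomorphic_on_Cn (KF \<rho> m) U"
  unfolding KF_def[abs_def]
proof (intro holo_uminus holo_divide holo_power holo_mult root_hol)
  show "holomorphic_on_Cn (df \<rho>) U" unfolding df_def[abs_def]
    by (intro holo_add holo_mult holo_const holo_coord holo_power root_hol)
qed (use root_facts in auto)

text \<open>The right-hand side depends on \<open>m\<close> and \<open>j\<close> only through \<open>m + wp j\<close>.\<close>

lemma pd_KF:
  assumes x: "x \<in> U" and j: "j \<in> X"
  shows "pd j (KF \<rho> m) x = ((of_nat (m + wp j) - 3) * \<rho> x ^ (m + wp j) * df \<rho> x
     - \<rho> x ^ (m + wp j) * \<rho> x * (6 * x $ i3 * \<rho> x + 12 * x $ i4 * (\<rho> x)\<^sup>2)) / (\<rho> x ^ 4 * df \<rho> x ^ 3)"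
proof -
  define r where "r = pd j \<rho> x"
  define f2 where "f2 = 6 * x $ i3 * \<rho> x + 12 * x $ i4 * (\<rho> x)\<^sup>2"
  note nz = root_facts(1,2)[OF x]
  have "((\<lambda>z. df \<rho> (slice x j z)) has_field_derivative
      (kron i2 j + 3 * kron i3 j * (\<rho> x)\<^sup>2 + 4 * kron i4 j * \<rho> x ^ 3 + f2 * r)) (at (x $ j))"
    unfolding df_def[abs_def]
    by ((rule derivative_eq_intros DERIV_coord DERIV_root x refl)+, simp add: r_def f2_def algebra_simps eval_nat_numeral)
  moreover have "kron i2 j + 3 * kron i3 j * (\<rho> x)\<^sup>2 + 4 * kron i4 j * \<rho> x ^ 3 = of_nat (wp j) * \<rho> x ^ wp j / \<rho> x"
    using j nz by (auto simp: eval_nat_numeral)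
  ultimately have Ddf: "((\<lambda>z. df \<rho> (slice x j z)) has_field_derivative
      (of_nat (wp j) * \<rho> x ^ wp j / \<rho> x + f2 * r)) (at (x $ j))" by simp
  have R: "r = - (\<rho> x ^ wp j / df \<rho> x)" unfolding r_def by (rule pd_root(1)[OF x j])
  have Dr: "((\<lambda>z. \<rho> (slice x j z)) has_field_derivative r) (at (x $ j))"
    unfolding r_def by (rule DERIV_root[OF x])
  have "pd j (KF \<rho> m) x = - (((of_nat m - 3) * \<rho> x ^ m / \<rho> x * r) / (\<rho> x ^ 3 * df \<rho> x)
      - \<rho> x ^ m * (of_nat (wp j) * \<rho> x ^ wp j / \<rho> x + f2 * r) / (\<rho> x ^ 3 * (df \<rho> x)\<^sup>2))"
    unfolding KF_def[abs_def]
    by (rule pd_eqI, (rule derivative_eq_intros DERIV_power_div[OF Dr] Ddf refl | (simp add: nz; fail))+, (simp add: field_simps eval_nat_numeral nz)?)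
  also have "\<dots> = ((of_nat m - 3 + of_nat (wp j)) * (\<rho> x ^ m * \<rho> x ^ wp j) * df \<rho> x
     - (\<rho> x ^ m * \<rho> x ^ wp j) * \<rho> x * f2) / (\<rho> x ^ 4 * df \<rho> x ^ 3)"
    unfolding R using nz by (simp add: field_simps eval_nat_numeral)
  finally show ?thesis unfolding f2_def by (simp add: power_add algebra_simps)
qed

lemma F_sol:
  shows "sol U (F \<rho>)" "\<And>i j x. i \<in> X \<Longrightarrow> j \<in> X \<Longrightarrow> x \<in> U \<Longrightarrow> pd i (pd j (F \<rho>)) x = KF \<rho> (wp i + wp j) x"
    "\<And>k x. k \<in> K \<Longrightarrow> x \<in> U \<Longrightarrow> pd (ia k) (F \<rho>) x = 0" "\<And>k x. k \<in> K \<Longrightarrow> x \<in> U \<Longrightarrow> pd (ib k) (F \<rho>) x = 0"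
proof -
  show blk: "\<And>k x. k \<in> K \<Longrightarrow> x \<in> U \<Longrightarrow> pd (ia k) (F \<rho>) x = 0" "\<And>k x. k \<in> K \<Longrightarrow> x \<in> U \<Longrightarrow> pd (ib k) (F \<rho>) x = 0"
    by (auto simp: pd_F)
  show G2: "pd i (pd j (F \<rho>)) x = KF \<rho> (wp i + wp j) x" if "i \<in> X" "j \<in> X" "x \<in> U" for i j x
  proof -
    note nz = root_facts[OF that(3)]
    have "pd i (pd j (F \<rho>)) x = pd i (\<lambda>x. - kron i1 j / (2 * (\<rho> x)\<^sup>2) - kron i2 j / \<rho> x + kron i3 j * \<rho> x + kron i4 j * (\<rho> x)\<^sup>2 / 2) x"
      by (rule pd_cong[OF U that(3) pd_F])
    also have "\<dots> = (\<rho> x ^ wp j / \<rho> x ^ 3) * pd i \<rho> x"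
      by (rule pd_eqI, (rule derivative_eq_intros DERIV_root that(3) refl | (simp add: nz; fail))+)
         (use nz that(2) in \<open>auto simp: field_simps eval_nat_numeral\<close>)
    also have "\<dots> = KF \<rho> (wp i + wp j) x"
      using nz by (simp add: pd_root(1)[OF that(3,1)] KF_def power_add field_simps)
    finally show ?thesis .
  qed
  show "sol U (F \<rho>)"
  proof (rule sol_block_free[OF U _ _ _ blk KF_hol G2])
    show "holomorphic_on_Cn (F \<rho>) U" unfolding F_def[abs_def]
      by (intro holo_divide holo_power holo_coord holo_mult holo_diff holo_add holo_uminus holo_const root_hol)
         (use root_facts in auto)
    show "Euler U wd 1 (F \<rho>)"
      unfolding Euler_def sum_index by (auto simp: pd_F F_def)
    show "Euler U wp 2 (F \<rho>)"
      unfolding Euler_def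
    proof
      fix x assume x: "x \<in> U"
      note nz = root_facts[OF x]
      have "(\<Sum>j\<in>UNIV. of_nat (wp j) * x $ j * pd j (F \<rho>) x) - 2 * F \<rho> x =
        (x $ i1 + x $ i2 * \<rho> x + x $ i3 * \<rho> x ^ 3 + x $ i4 * \<rho> x ^ 4) / (\<rho> x)\<^sup>2"
        unfolding sum_index using x nz(1) by (simp add: pd_F F_def field_simps eval_nat_numeral)
      then show "(\<Sum>j\<in>UNIV. of_nat (wp j) * x $ j * pd j (F \<rho>) x) = 2 * F \<rho> x" using nz(3) by simp
    qed
    show "pd i (KF \<rho> m) x = pd i1 (KF \<rho> (m + wp i)) x" if "i \<in> X" "x \<in> U" for i m x
      using pd_KF[OF that(2,1), of m] pd_KF[OF that(2), of i1 "m + wp i"] by simp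
  qed
qed

end

end

section \<open>Splitting off the linear polynomials\<close>

context quartic_config
begin

text \<open>The resultant of the quartic and the linear polynomial \<open>a_k + b_k t\<close>.\<close>

definition res :: "nat \<Rightarrow> complex^'n \<Rightarrow> complex" where
  "res k x = x $ i1 * x $ ib k ^ 4 - x $ i2 * x $ ia k * x $ ib k ^ 3 - x $ i3 * x $ ia k ^ 3 * x $ ib k + x $ i4 * x $ ia k ^ 4"

text \<open>The quartic and the linear polynomials keep their degrees, have no zero at the origin, and the linear ones
  share no zero with the quartic or with each other.\<close>

definition adm :: "complex^'n \<Rightarrow> bool" where
  "adm x \<longleftrightarrow> x $ i1 \<noteq> 0 \<and> x $ i4 \<noteq> 0 \<and> (\<forall>k\<in>K. x $ ia k \<noteq> 0 \<and> x $ ib k \<noteq> 0 \<and> res k x \<noteq> 0) \<and>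
     (\<forall>k\<in>K. \<forall>l\<in>K. k \<noteq> l \<longrightarrow> x $ ia k * x $ ib l - x $ ia l * x $ ib k \<noteq> 0)"

text \<open>The Euler relations of third order allow the replacement of third by second derivatives in the cubic
  relations. The resulting linear system for the second derivatives has the resultant as its determinant.\<close>

lemma block_algebra:
  fixes a b x1 x2 x3 x4 g22 g24 g44 g222 g224 g244 g444 :: complex
  defines "y \<equiv> a * x2 - b * x1" and "z \<equiv> a * x4 - b * x3"
  assumes "y * g22 + z * g24 = 0" "y * g24 + z * g44 = 0"
    and "y * g222 + z * g224 = - a * g22" "y * g224 + z * g244 = - a * g24" "y * g244 + z * g444 = - a * g44"
    and "a ^ 3 * g222 = - (b ^ 3) * g224" "a ^ 3 * g224 = - (b ^ 3) * g244" "a ^ 3 * g244 = - (b ^ 3) * g444"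
    and a: "a \<noteq> 0" and r: "x1 * b ^ 4 - x2 * a * b ^ 3 - x3 * a ^ 3 * b + x4 * a ^ 4 \<noteq> 0"
  shows "g22 = 0" "g24 = 0" "g44 = 0"
proof -
  have "a * (a ^ 3 * g22 + b ^ 3 * g24) = 0" using assms(5,6,8,9) by algebra
  then have 1: "a ^ 3 * g22 + b ^ 3 * g24 = 0" using a by simp
  have "a * (a ^ 3 * g24 + b ^ 3 * g44) = 0" using assms(6,7,9,10) by algebra
  then have 2: "a ^ 3 * g24 + b ^ 3 * g44 = 0" using a by simp
  have "(x1 * b ^ 4 - x2 * a * b ^ 3 - x3 * a ^ 3 * b + x4 * a ^ 4) * g24 = 0"
    using assms(3) 1 unfolding y_def z_def by algebra
  then show 3: "g24 = 0" using r by simp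
  show "g22 = 0" using 1 3 a by simp
  have "(x1 * b ^ 4 - x2 * a * b ^ 3 - x3 * a ^ 3 * b + x4 * a ^ 4) * g44 = 0"
    using assms(4) 2 unfolding y_def z_def by algebra
  then show "g44 = 0" using r by simp
qed

context
  fixes f U
  assumes sol: "sol U f" and U: "open U" and adm: "\<And>x. x \<in> U \<Longrightarrow> adm x"
begin

lemma perm: "x \<in> U \<Longrightarrow> mset js = mset ks \<Longrightarrow> pds js f x = pds ks f x"
  by (rule pds_mset_eq[OF sol_holo[OF sol] U])

text \<open>The toric equation between two pairs and the two homogeneity relations form a linear system whose
  determinant vanishes only where the two linear polynomials have a common zero.\<close>

lemma mixed_blocks:
  assumes k: "k \<in> K" and l: "l \<in> K" and kl: "k \<noteq> l" and x: "x \<in> U"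
    and c: "c \<in> {ia k, ib k}" "c' \<in> {ia l, ib l}"
  shows "pds [c, c'] f x = 0"
proof -
  have nz: "x $ ia k \<noteq> 0" "x $ ia l \<noteq> 0" "x $ ia k * x $ ib l - x $ ia l * x $ ib k \<noteq> 0"
    using adm[OF x] k l kl by (auto simp: adm_def)
  have lk: "l \<noteq> k" using kl by simp
  define W where "W = pds [ib k, ib l] f x"
  define V where "V = pds [ia k, ib l] f x"
  have V': "pds [ib k, ia l] f x = V"
    unfolding V_def using k l kl lk by (intro toric[OF sol x]) (simp add: weq_def)
  have 1: "x $ ia k * V + x $ ib k * W = 0"
    using Euler_k[OF sol U x k, of "[ib l]"] k l kl by (simp add: V_def W_def)
  have "x $ ia l * pds [ia l, ib k] f x + x $ ib l * pds [ib l, ib k] f x = 0"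
    using Euler_k[OF sol U x l, of "[ib k]"] k l lk by simp
  moreover have "pds [ia l, ib k] f x = pds [ib k, ia l] f x" "pds [ib l, ib k] f x = W"
    unfolding W_def by (rule perm[OF x]; simp)+
  ultimately have 2: "x $ ia l * V + x $ ib l * W = 0" using V' by simp
  have "(x $ ia k * x $ ib l - x $ ia l * x $ ib k) * W = 0" using 1 2 by algebra
  then have W0: "W = 0" using nz by simp
  then have V0: "V = 0" using 1 nz by simp
  have "x $ ia l * pds [ia l, ia k] f x + x $ ib l * pds [ib l, ia k] f x = 0"
    using Euler_k[OF sol U x l, of "[ia k]"] k l lk by simp
  moreover have "pds [ib l, ia k] f x = V" "pds [ia l, ia k] f x = pds [ia k, ia l] f x"
    unfolding V_def by (rule perm[OF x]; simp)+
  ultimately have "pds [ia k, ia l] f x = 0" using V0 nz by simp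
  then show ?thesis using c V' V0 W0 by (auto simp: V_def W_def)
qed

text \<open>Homogeneity in the pair exchanges \<open>ia k\<close> for \<open>ib k\<close> at the cost of the factor \<open>- b/a\<close>. Hence on derivatives in
  the direction \<open>ib k\<close> a quadratic toric equation becomes proportionality of two first derivatives.\<close>

lemma block_shift:
  assumes k: "k \<in> K" and x: "x \<in> U" and J: "set J \<subseteq> X"
  shows "x $ ia k * pds (i1 # J @ [ib k]) f x = - (x $ ib k) * pds (i2 # J @ [ib k]) f x"
    and "x $ ia k * pds (i3 # J @ [ib k]) f x = - (x $ ib k) * pds (i4 # J @ [ib k]) f x"
proof -
  have gen: "x $ ia k * pds (i # J @ [ib k]) f x = - (x $ ib k) * pds (j # J @ [ib k]) f x"
    if "i \<in> X" "j \<in> X" "wp i + 1 = wp j" for i j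
  proof -
    have "pds (i # J @ [ib k]) f x = pds (j # J @ [ia k]) f x"
      using that k by (intro toric[OF sol x]) (auto simp: weq_def)
    also have "\<dots> = pds (ia k # j # J) f x" by (rule perm[OF x]) simp
    finally have 1: "pds (i # J @ [ib k]) f x = pds (ia k # j # J) f x" .
    have 2: "pds (j # J @ [ib k]) f x = pds (ib k # j # J) f x" by (rule perm[OF x]) simp
    have "sum_list (map (wk k) (j # J)) = 0" using that J k by (intro X_wk) auto
    then have "x $ ia k * pds (ia k # j # J) f x + x $ ib k * pds (ib k # j # J) f x = 0"
      using Euler_k[OF sol U x k, of "j # J"] by (simp del: sum_list_eq_0_iff)
    then show ?thesis unfolding 1 2 by (simp add: add_eq_0_iff)
  qed
  show "x $ ia k * pds (i1 # J @ [ib k]) f x = - (x $ ib k) * pds (i2 # J @ [ib k]) f x"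
    "x $ ia k * pds (i3 # J @ [ib k]) f x = - (x $ ib k) * pds (i4 # J @ [ib k]) f x"
    by (rule gen; simp)+
qed

lemma block_Euler:
  assumes k: "k \<in> K" and x: "x \<in> U" and J: "set J \<subseteq> X"
  shows "(x $ ia k * x $ i2 - x $ ib k * x $ i1) * pds (i2 # J @ [ib k]) f x
      + (x $ ia k * x $ i4 - x $ ib k * x $ i3) * pds (i4 # J @ [ib k]) f x
    = x $ ia k * ((1 - of_nat (length J)) * pds (J @ [ib k]) f x)"
proof -
  have "x $ i1 * pds (i1 # J @ [ib k]) f x + x $ i2 * pds (i2 # J @ [ib k]) f x + x $ i3 * pds (i3 # J @ [ib k]) f x
      + x $ i4 * pds (i4 # J @ [ib k]) f x = (1 - of_nat (length J)) * pds (J @ [ib k]) f x"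
    using Euler_d[OF sol U x, of "J @ [ib k]"] k J by (simp add: length_X)
  then show ?thesis using block_shift[OF k x J] by algebra
qed

text \<open>By the shift relations only the derivatives in the directions \<open>i2\<close> and \<open>i4\<close> matter, and the three cubic
  toric equations turn into the three proportionalities that \<open>block_algebra\<close> needs.\<close>

lemma block_second:
  assumes k: "k \<in> K" and x: "x \<in> U" and ij: "i \<in> X" "j \<in> X"
  shows "pds [i, j, ib k] f x = 0"
proof -
  let ?a = "x $ ia k" and ?b = "x $ ib k"
  let ?g = "\<lambda>J. pds (J @ [ib k]) f x"
  have a: "?a \<noteq> 0" "res k x \<noteq> 0" using adm[OF x] k by (auto simp: adm_def)
  note E = block_Euler[OF k x] and S = block_shift[OF k x]
  have p: "?g js = ?g ks" if "mset js = mset ks" for js ks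
    using that by (intro perm[OF x]) simp
  have t: "?g [i1, i1, i3] = ?g [i2, i2, i2]" "?g [i1, i3, i3] = ?g [i4, i2, i2]" "?g [i3, i3, i3] = ?g [i4, i4, i2]"
    by (rule toric[OF sol x], use k in \<open>simp add: weq_def\<close>)+
  have c1: "?a ^ 3 * ?g [i2, i2, i2] = - (?b ^ 3) * ?g [i4, i2, i2]"
  proof -
    have "?a * ?g [i1, i1, i3] = - ?b * ?g [i2, i1, i3]" using S(1)[of "[i1, i3]"] by simp
    moreover have "?a * ?g [i1, i2, i3] = - ?b * ?g [i2, i2, i3]" using S(1)[of "[i2, i3]"] by simp
    moreover have "?a * ?g [i3, i2, i2] = - ?b * ?g [i4, i2, i2]" using S(2)[of "[i2, i2]"] by simp
    moreover have "?g [i2, i1, i3] = ?g [i1, i2, i3]" "?g [i2, i2, i3] = ?g [i3, i2, i2]" by (rule p; simp)+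
    ultimately show ?thesis using t(1) by algebra
  qed
  have c2: "?a ^ 3 * ?g [i4, i2, i2] = - (?b ^ 3) * ?g [i4, i4, i2]"
  proof -
    have "?a * ?g [i1, i3, i3] = - ?b * ?g [i2, i3, i3]" using S(1)[of "[i3, i3]"] by simp
    moreover have "?a * ?g [i3, i2, i3] = - ?b * ?g [i4, i2, i3]" using S(2)[of "[i2, i3]"] by simp
    moreover have "?a * ?g [i3, i4, i2] = - ?b * ?g [i4, i4, i2]" using S(2)[of "[i4, i2]"] by simp
    moreover have "?g [i2, i3, i3] = ?g [i3, i2, i3]" "?g [i4, i2, i3] = ?g [i3, i4, i2]" by (rule p; simp)+
    ultimately show ?thesis using t(2) by algebra
  qed
  have c3: "?a ^ 3 * ?g [i4, i4, i2] = - (?b ^ 3) * ?g [i4, i4, i4]"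
  proof -
    have "?a * ?g [i3, i3, i3] = - ?b * ?g [i4, i3, i3]" using S(2)[of "[i3, i3]"] by simp
    moreover have "?a * ?g [i3, i4, i3] = - ?b * ?g [i4, i4, i3]" using S(2)[of "[i4, i3]"] by simp
    moreover have "?a * ?g [i3, i4, i4] = - ?b * ?g [i4, i4, i4]" using S(2)[of "[i4, i4]"] by simp
    moreover have "?g [i4, i3, i3] = ?g [i3, i4, i3]" "?g [i4, i4, i3] = ?g [i3, i4, i4]" by (rule p; simp)+
    ultimately show ?thesis using t(3) by algebra
  qed
  have q: "?g [i2, i4] = ?g [i4, i2]" "?g [i2, i4, i2] = ?g [i4, i2, i2]" "?g [i2, i4, i4] = ?g [i4, i4, i2]"
    by (rule p; simp)+
  have e1: "(?a * x $ i2 - ?b * x $ i1) * ?g [i2, i2] + (?a * x $ i4 - ?b * x $ i3) * ?g [i4, i2] = 0"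
    using E[of "[i2]"] by simp
  have e2: "(?a * x $ i2 - ?b * x $ i1) * ?g [i4, i2] + (?a * x $ i4 - ?b * x $ i3) * ?g [i4, i4] = 0"
    using E[of "[i4]"] q by simp
  have e3: "(?a * x $ i2 - ?b * x $ i1) * ?g [i2, i2, i2] + (?a * x $ i4 - ?b * x $ i3) * ?g [i4, i2, i2] = - ?a * ?g [i2, i2]"
    using E[of "[i2, i2]"] by simp
  have e4: "(?a * x $ i2 - ?b * x $ i1) * ?g [i4, i2, i2] + (?a * x $ i4 - ?b * x $ i3) * ?g [i4, i4, i2] = - ?a * ?g [i4, i2]"
    using E[of "[i4, i2]"] q by simp
  have e5: "(?a * x $ i2 - ?b * x $ i1) * ?g [i4, i4, i2] + (?a * x $ i4 - ?b * x $ i3) * ?g [i4, i4, i4] = - ?a * ?g [i4, i4]"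
    using E[of "[i4, i4]"] q by simp
  note Z = block_algebra[OF e1 e2 e3 e4 e5 c1 c2 c3 a(1) a(2)[unfolded res_def]]
  have z2: "?g [j, i2] = 0" "?g [j, i4] = 0" if "j \<in> X" for j
    using that S(1)[of "[i2]"] S(2)[of "[i2]"] S(1)[of "[i4]"] S(2)[of "[i4]"] Z q a(1) by auto
  have "?g [i, j] = 0"
  proof -
    have "?g [i2, j] = 0" "?g [i4, j] = 0" using z2[OF ij(2)] p[of "[i2, j]" "[j, i2]"] p[of "[i4, j]" "[j, i4]"] by simp_all
    then show ?thesis using ij S(1)[of "[j]"] S(2)[of "[j]"] a(1) by auto
  qed
  then show ?thesis by simp
qed

text \<open>What is left of the dependence on the pair is governed by the homogeneity relations alone: the
  derivative in \<open>i2\<close> is homogeneous like \<open>1/a\<close> and the one in \<open>i4\<close> like \<open>a^2/b^3\<close>.\<close>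

lemma block_constant_zero:
  assumes k: "k \<in> K" and x: "x \<in> U"
  shows "j \<in> {i2, i4} \<Longrightarrow> i \<in> X \<Longrightarrow> pd i (pds [j, ib k] f) x = 0"
    and "j \<in> {i2, i4} \<Longrightarrow> l \<in> K \<Longrightarrow> l \<noteq> k \<Longrightarrow> c \<in> {ia l, ib l} \<Longrightarrow> pd c (pds [j, ib k] f) x = 0"
    and "x $ ia k * pd (ia k) (pds [i2, ib k] f) x = - pds [i2, ib k] f x" "pd (ib k) (pds [i2, ib k] f) x = 0"
    and "x $ ia k * pd (ia k) (pds [i4, ib k] f) x = 2 * pds [i4, ib k] f x"
    and "x $ ib k * pd (ib k) (pds [i4, ib k] f) x = - 3 * pds [i4, ib k] f x"
proof -
  have nz: "x $ ia k \<noteq> 0" "x $ ib k \<noteq> 0" using adm[OF x] k by (auto simp: adm_def)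
  show A: "pd i (pds [j, ib k] f) x = 0" if "j \<in> {i2, i4}" "i \<in> X" for i j
    using block_second[OF k x, of i j] that by auto
  show B: "pd c (pds [j, ib k] f) x = 0" if "j \<in> {i2, i4}" "l \<in> K" "l \<noteq> k" "c \<in> {ia l, ib l}" for j l c
  proof -
    have "pds [c, j, ib k] f x = 0"
    proof (rule pds_zero_mset[OF sol_holo[OF sol] U _ x])
      show "pds [c, ib k] f x = 0" if "x \<in> U" for x
        using mixed_blocks[OF \<open>l \<in> K\<close> k \<open>l \<noteq> k\<close> that \<open>c \<in> {ia l, ib l}\<close>] by simp
      show "mset [c, ib k] \<subseteq># mset [c, j, ib k]" by simp
    qed
    then show ?thesis by simp
  qed
  have Ep: "x $ ib k * pd (ib k) (pds [j, ib k] f) x = (2 - of_nat (wp j) - 1) * pds [j, ib k] f x"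
    if "j \<in> {i2, i4}" for j
  proof -
    have "(\<Sum>l\<in>K. x $ ib l * pds (ib l # [j, ib k]) f x) = x $ ib k * pds (ib k # [j, ib k]) f x"
    proof -
      have "pds (ib l # [j, ib k]) f x = 0" if "l \<in> K" "l \<noteq> k" for l
        using B[OF \<open>j \<in> {i2, i4}\<close> that] by simp
      then show ?thesis using k finK by (simp add: sum.remove[of K k] sum.neutral del: foldr_Cons)
    qed
    then show ?thesis using Euler_p[OF sol U x, of "[j, ib k]"] A[OF that] k by (simp add: algebra_simps)
  qed
  have Ek: "x $ ia k * pd (ia k) (pds [j, ib k] f) x + x $ ib k * pd (ib k) (pds [j, ib k] f) x = - pds [j, ib k] f x"
    if "j \<in> {i2, i4}" for j
    using Euler_k[OF sol U x k, of "[j, ib k]"] that k by auto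
  show I: "pd (ib k) (pds [i2, ib k] f) x = 0" using Ep[of i2] nz by simp
  show "x $ ia k * pd (ia k) (pds [i2, ib k] f) x = - pds [i2, ib k] f x" using Ek[of i2] I by simp
  show J: "x $ ib k * pd (ib k) (pds [i4, ib k] f) x = - 3 * pds [i4, ib k] f x" using Ep[of i4] by simp
  show "x $ ia k * pd (ia k) (pds [i4, ib k] f) x = 2 * pds [i4, ib k] f x"
    using Ek[of i4] J by (simp add: algebra_simps)
qed

text \<open>Up to the explicit homogeneous factors, the two remaining derivatives are constant on connected sets. Their
  values are the coefficients of \<open>P k\<close> and \<open>Q k\<close> in \<open>f\<close>.\<close>

lemma block_constants:
  assumes k: "k \<in> K" and conn: "connected U"
  obtains C D where "\<And>x. x \<in> U \<Longrightarrow> pd (ib k) f x = C * pd (ib k) (P k) x + D * pd (ib k) (Q k) x"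
proof (cases "U = {}")
  case False
  then obtain x0 where x0: "x0 \<in> U" by blast
  have nz: "x $ ia k \<noteq> 0" "x $ ib k \<noteq> 0" if "x \<in> U" for x using adm[OF that] k by (auto simp: adm_def)
  define c where "c = (\<lambda>x. x $ ia k * pds [i2, ib k] f x)"
  define e where "e = (\<lambda>x. x $ ib k ^ 3 / (x $ ia k)\<^sup>2 * pds [i4, ib k] f x)"
  note h = sol_holo[OF sol]
  have hp: "holomorphic_on_Cn (pds js f) U" for js by (rule pds_holo[OF h U])
  have hq: "holomorphic_on_Cn (\<lambda>x. x $ ib k ^ 3 / (x $ ia k)\<^sup>2) U"
    by (intro holo_divide holo_power holo_coord) (use nz in auto)
  have ch: "holomorphic_on_Cn c U" "holomorphic_on_Cn e U"
    unfolding c_def e_def by (intro holo_mult holo_coord hp hq)+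
  have pc: "pd j c x = kron (ia k) j * pds [i2, ib k] f x + x $ ia k * pd j (pds [i2, ib k] f) x" if "x \<in> U" for j x
    unfolding c_def using that by (subst pd_mult[OF holo_coord hp that]) (simp add: pd_coord kron_def)
  have pq: "pd j (\<lambda>x. x $ ib k ^ 3 / (x $ ia k)\<^sup>2) x = 3 * (x $ ib k)\<^sup>2 * kron (ib k) j / (x $ ia k)\<^sup>2
      - 2 * x $ ib k ^ 3 * kron (ia k) j / x $ ia k ^ 3" if "x \<in> U" for j x
    by (rule pd_eqI, (rule derivative_eq_intros DERIV_coord refl | (simp add: nz that; fail))+)
       (simp add: nz[OF that] field_simps eval_nat_numeral)
  have pe: "pd j e x = (3 * (x $ ib k)\<^sup>2 * kron (ib k) j / (x $ ia k)\<^sup>2 - 2 * x $ ib k ^ 3 * kron (ia k) j / x $ ia k ^ 3) * pds [i4, ib k] f x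
       + x $ ib k ^ 3 / (x $ ia k)\<^sup>2 * pd j (pds [i4, ib k] f) x" if "x \<in> U" for j x
    unfolding e_def using that by (subst pd_mult[OF hq hp that]) (simp add: pq)
  note B = block_constant_zero[OF k]
  have c0: "pd j c x = 0" if x: "x \<in> U" for j x
  proof (cases rule: index_cases[of j])
    case (5 l) then show ?thesis using pc[OF x, of j] B[OF x] k by (cases "l = k") auto
  next
    case (6 l) then show ?thesis using pc[OF x, of j] B[OF x] k by (cases "l = k") auto
  qed (use pc[OF x, of j] B(1)[OF x] k in auto)
  have e0: "pd j e x = 0" if x: "x \<in> U" for j x
  proof (cases rule: index_cases[of j])
    case (5 l)
    show ?thesis
    proof (cases "l = k")
      case True
      have "pd (ia k) (pds [i4, ib k] f) x = 2 * pds [i4, ib k] f x / x $ ia k"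
        using B(5)[OF x] nz[OF x] by (simp add: field_simps)
      then show ?thesis using pe[OF x, of j] 5 True k nz[OF x] by (simp add: field_simps eval_nat_numeral)
    qed (use 5 pe[OF x, of j] B[OF x] k in auto)
  next
    case (6 l)
    show ?thesis
    proof (cases "l = k")
      case True
      have "pd (ib k) (pds [i4, ib k] f) x = - 3 * pds [i4, ib k] f x / x $ ib k"
        using B(6)[OF x] nz[OF x] by (simp add: field_simps)
      then show ?thesis using pe[OF x, of j] 6 True k nz[OF x] by (simp add: field_simps eval_nat_numeral)
    qed (use 6 pe[OF x, of j] B[OF x] k in auto)
  qed (use pe[OF x, of j] B(1)[OF x] k in auto)
  show ?thesis
  proof
    fix x assume x: "x \<in> U"
    have "c x = c x0" "e x = e x0"
      using holo_constant[OF ch(1) U conn c0 x x0] holo_constant[OF ch(2) U conn e0 x x0] by auto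
    then have 1: "x $ ia k * pds [i2, ib k] f x = c x0" "x $ ib k ^ 3 * pds [i4, ib k] f x = e x0 * (x $ ia k)\<^sup>2"
      using nz[OF x] by (auto simp: c_def e_def field_simps)
    have 2: "(x $ ia k * x $ i2 - x $ ib k * x $ i1) * pds [i2, ib k] f x + (x $ ia k * x $ i4 - x $ ib k * x $ i3) * pds [i4, ib k] f x
        = x $ ia k * pd (ib k) f x"
      using block_Euler[OF k x, of "[]"] by simp
    have "pd (ib k) f x = ((x $ ia k * x $ i2 - x $ ib k * x $ i1) * (c x0 / x $ ia k)
       + (x $ ia k * x $ i4 - x $ ib k * x $ i3) * (e x0 * (x $ ia k)\<^sup>2 / x $ ib k ^ 3)) / x $ ia k"
    proof -
      have "pds [i2, ib k] f x = c x0 / x $ ia k" "pds [i4, ib k] f x = e x0 * (x $ ia k)\<^sup>2 / x $ ib k ^ 3"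
        using 1 nz[OF x] by (auto simp: field_simps)
      from 2[unfolded this] show ?thesis using nz[OF x] by (metis nonzero_mult_div_cancel_left)
    qed
    then show "pd (ib k) f x = c x0 * pd (ib k) (P k) x + (- e x0) * pd (ib k) (Q k) x"
      using nz[OF x] k by (simp add: pd_P pd_Q field_simps eval_nat_numeral)
  qed
qed (use that in auto)

end

end

section \<open>Solutions in the coefficients of the quartic\<close>

text \<open>For a root \<open>r\<close> of the quartic, the linear form that pairs a sequence with the coefficients of the
  quartic divided by \<open>t - r\<close>. On the powers of the roots these forms are a dual basis up to scaling.\<close>

definition Lam :: "complex \<Rightarrow> complex \<Rightarrow> complex \<Rightarrow> complex \<Rightarrow> (nat \<Rightarrow> complex) \<Rightarrow> complex" where
  "Lam x2 x3 x4 r G = x4 * G 3 + (x4 * r + x3) * G 2 + (x4 * r\<^sup>2 + x3 * r) * G 1 + (x4 * r ^ 3 + x3 * r\<^sup>2 + x2) * G 0"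

lemma Lam_sum: "finite I \<Longrightarrow> Lam x2 x3 x4 r (\<lambda>m. \<Sum>j\<in>I. e j * g j m) = (\<Sum>j\<in>I. e j * Lam x2 x3 x4 r (g j))"
  by (induction I rule: finite_induct) (simp_all add: Lam_def algebra_simps)

lemma Lam_diff: "Lam x2 x3 x4 r (\<lambda>m. g m - h m) = Lam x2 x3 x4 r g - Lam x2 x3 x4 r h"
  by (simp add: Lam_def algebra_simps)

lemma cubic_four_zeros:
  fixes c0 c1 c2 c3 :: complex and \<rho> :: "nat \<Rightarrow> complex"
  assumes inj: "inj_on \<rho> {..<4}" and z: "\<And>j. j < 4 \<Longrightarrow> c0 + c1 * \<rho> j + c2 * \<rho> j ^ 2 + c3 * \<rho> j ^ 3 = 0"
  shows "c0 = 0" "c1 = 0" "c2 = 0" "c3 = 0"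
proof -
  let ?p = "[:c0, c1, c2, c3:]"
  have "?p = 0"
  proof (rule ccontr)
    assume nz: "?p \<noteq> 0"
    have "\<rho> ` {..<4} \<subseteq> {t. poly ?p t = 0}"
      using z by (auto simp: algebra_simps power2_eq_square power3_eq_cube)
    then have "card (\<rho> ` {..<4}) \<le> card {t. poly ?p t = 0}"
      using poly_roots_finite[OF nz] by (intro card_mono) auto
    also have "\<dots> \<le> degree ?p" by (rule card_poly_roots_bound[OF nz])
    also have "\<dots> \<le> 3" by (simp add: degree_pCons_eq_if)
    finally show False using inj by (simp add: card_image)
  qed
  then show "c0 = 0" "c1 = 0" "c2 = 0" "c3 = 0" by auto
qed

context
  fixes x1 x2 x3 x4 :: complex and \<rho> :: "nat \<Rightarrow> complex"
  assumes inj: "inj_on \<rho> {..<4}" and x4: "x4 \<noteq> 0"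
    and root: "\<And>j. j < 4 \<Longrightarrow> x1 + x2 * \<rho> j + x3 * \<rho> j ^ 3 + x4 * \<rho> j ^ 4 = 0"
begin

lemma Lam_roots:
  assumes "i < 4" "j < 4"
  shows "Lam x2 x3 x4 (\<rho> i) (\<lambda>m. \<rho> j ^ m) = (if j = i then x2 + 3 * x3 * (\<rho> i)\<^sup>2 + 4 * x4 * \<rho> i ^ 3 else 0)"
proof (cases "j = i")
  case True
  then show ?thesis by (simp add: Lam_def algebra_simps eval_nat_numeral)
next
  case False
  then have "\<rho> j - \<rho> i \<noteq> 0" using inj assms by (auto simp: inj_on_def)
  moreover have "(\<rho> j - \<rho> i) * Lam x2 x3 x4 (\<rho> i) (\<lambda>m. \<rho> j ^ m) = 0"
    using root[OF assms(1)] root[OF assms(2)] unfolding Lam_def by algebra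
  ultimately show ?thesis using False by simp
qed

lemma roots_simple:
  assumes i: "i < 4"
  shows "x2 + 3 * x3 * (\<rho> i)\<^sup>2 + 4 * x4 * \<rho> i ^ 3 \<noteq> 0"
proof
  assume "x2 + 3 * x3 * (\<rho> i)\<^sup>2 + 4 * x4 * \<rho> i ^ 3 = 0"
  then have "(x4 * \<rho> i ^ 3 + x3 * (\<rho> i)\<^sup>2 + x2) + (x4 * (\<rho> i)\<^sup>2 + x3 * \<rho> i) * \<rho> j + (x4 * \<rho> i + x3) * \<rho> j ^ 2 + x4 * \<rho> j ^ 3 = 0"
    if "j < 4" for j
    using Lam_roots[OF i that] by (simp add: Lam_def algebra_simps split: if_splits)
  from cubic_four_zeros(4)[OF inj this] x4 show False by simp
qed

lemma power_sums_independent: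
  assumes z: "\<And>m. m < 4 \<Longrightarrow> (\<Sum>j<4. e j * \<rho> j ^ m) = 0" and i: "i < 4"
  shows "e i = 0"
proof -
  have "Lam x2 x3 x4 (\<rho> i) (\<lambda>m. \<Sum>j<4. e j * \<rho> j ^ m) = 0"
    using z[of 0] z[of 1] z[of 2] z[of 3] by (simp add: Lam_def)
  moreover have "Lam x2 x3 x4 (\<rho> i) (\<lambda>m. \<Sum>j<4. e j * \<rho> j ^ m) =
      (\<Sum>j<4. e j * (if j = i then x2 + 3 * x3 * (\<rho> i)\<^sup>2 + 4 * x4 * \<rho> i ^ 3 else 0))"
    using i by (simp add: Lam_sum Lam_roots)
  ultimately have "e i * (x2 + 3 * x3 * (\<rho> i)\<^sup>2 + 4 * x4 * \<rho> i ^ 3) = 0"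
    using i by (simp add: if_distrib cong: if_cong)
  then show ?thesis using roots_simple[OF i] by simp
qed

text \<open>A solution of the linear recurrence whose characteristic polynomial has distinct roots is a combination of the
  sequences of their powers, with coefficients given by the forms \<open>Lam\<close>. The explicit coefficients are needed because
  they inherit holomorphy from the sequence.\<close>

lemma interpolation:
  assumes rec: "\<And>q. q < 5 \<Longrightarrow> x1 * G q + x2 * G (q + 1) + x3 * G (q + 3) + x4 * G (q + 4) = 0" and m: "m \<le> 8"
  shows "G m = (\<Sum>j<4. Lam x2 x3 x4 (\<rho> j) G / (x2 + 3 * x3 * (\<rho> j)\<^sup>2 + 4 * x4 * \<rho> j ^ 3) * \<rho> j ^ m)"
proof -
  define d where "d = (\<lambda>j. x2 + 3 * x3 * (\<rho> j)\<^sup>2 + 4 * x4 * \<rho> j ^ 3)"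
  define S where "S = (\<lambda>m. \<Sum>j<4. Lam x2 x3 x4 (\<rho> j) G / d j * \<rho> j ^ m)"
  define N where "N = (\<lambda>m. G m - S m)"
  have "Lam x2 x3 x4 (\<rho> i) N = 0" if i: "i < 4" for i
  proof -
    have "Lam x2 x3 x4 (\<rho> i) S = (\<Sum>j<4. Lam x2 x3 x4 (\<rho> j) G / d j * (if j = i then d i else 0))"
      unfolding S_def by (subst Lam_sum) (use i in \<open>auto simp: Lam_roots d_def intro!: sum.cong\<close>)
    also have "\<dots> = Lam x2 x3 x4 (\<rho> i) G"
      using i roots_simple[OF i] by (simp add: if_distrib d_def cong: if_cong)
    finally show ?thesis unfolding N_def Lam_diff by simp
  qed
  then have "(x4 * N 3 + x3 * N 2 + x2 * N 0) + (x4 * N 2 + x3 * N 1) * \<rho> i + (x4 * N 1 + x3 * N 0) * \<rho> i ^ 2 + x4 * N 0 * \<rho> i ^ 3 = 0"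
    if "i < 4" for i
    using that by (simp add: Lam_def algebra_simps)
  note z = cubic_four_zeros[OF inj this]
  have N0: "N 0 = 0" using z(4) x4 by simp
  have N1: "N 1 = 0" using z(3) x4 N0 by simp
  have N2: "N 2 = 0" using z(2) x4 N1 by simp
  have N3: "N 3 = 0" using z(1) x4 N0 N2 by simp
  have recN: "x1 * N q + x2 * N (q + 1) + x3 * N (q + 3) + x4 * N (q + 4) = 0" if "q < 5" for q
  proof -
    have "x1 * S q + x2 * S (q + 1) + x3 * S (q + 3) + x4 * S (q + 4) =
      (\<Sum>j<4. Lam x2 x3 x4 (\<rho> j) G / d j * \<rho> j ^ q * (x1 + x2 * \<rho> j + x3 * \<rho> j ^ 3 + x4 * \<rho> j ^ 4))"
      unfolding S_def sum_distrib_left sum.distrib[symmetric]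
      by (intro sum.cong refl) (simp add: power_add algebra_simps)
    also have "\<dots> = 0" using root by (intro sum.neutral) simp
    finally have "x1 * S q + x2 * S (q + 1) + x3 * S (q + 3) + x4 * S (q + 4) = 0" .
    moreover have "x1 * N q + x2 * N (q + 1) + x3 * N (q + 3) + x4 * N (q + 4) =
        (x1 * G q + x2 * G (q + 1) + x3 * G (q + 3) + x4 * G (q + 4)) - (x1 * S q + x2 * S (q + 1) + x3 * S (q + 3) + x4 * S (q + 4))"
      by (simp add: N_def algebra_simps)
    ultimately show ?thesis using rec[OF that] by (simp only:) simp
  qed
  have "N 4 = 0" using recN[of 0] N0 N1 N3 x4 by simp
  moreover have "N 5 = 0" using recN[of 1] N1 N2 calculation x4 by (simp add: eval_nat_numeral)
  moreover have "N 6 = 0" using recN[of 2] N2 N3 calculation x4 by simp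
  moreover have "N 7 = 0" using recN[of 3] N3 calculation x4 by simp
  moreover have "N 8 = 0" using recN[of 4] calculation x4 by simp
  moreover have "m = 0 \<or> m = 1 \<or> m = 2 \<or> m = 3 \<or> m = 4 \<or> m = 5 \<or> m = 6 \<or> m = 7 \<or> m = 8" using m by linarith
  ultimately have "N m = 0" using N0 N1 N2 N3 by (elim disjE) simp_all
  then show ?thesis by (simp add: N_def S_def d_def)
qed

end

context quartic_config
begin

text \<open>A pair of directions among the first four for each total weight from 0 to 8. By the toric equations, the
  derivatives along these nine pairs are all the second derivatives there are; weight 4 arises from two pairs.\<close>

definition gl :: "nat \<Rightarrow> 'n list" where
  "gl m = [[i1,i1],[i1,i2],[i2,i2],[i1,i3],[i1,i4],[i2,i4],[i3,i3],[i3,i4],[i4,i4]] ! m"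

lemma gl_cases:
  assumes "m \<le> 8"
  obtains i j where "i \<in> X" "j \<in> X" "gl m = [i, j]" "wp i + wp j = m"
proof -
  have "m = 0 \<or> m = 1 \<or> m = 2 \<or> m = 3 \<or> m = 4 \<or> m = 5 \<or> m = 6 \<or> m = 7 \<or> m = 8" using assms by linarith
  then have "\<exists>i j. i \<in> X \<and> j \<in> X \<and> gl m = [i, j] \<and> wp i + wp j = m"
    by (elim disjE) (auto simp: gl_def)
  then show ?thesis using that by blast
qed

lemma weq_X: "set js \<subseteq> X \<Longrightarrow> set ks \<subseteq> X \<Longrightarrow> length js = length ks \<Longrightarrow> sum_list (map wp js) = sum_list (map wp ks) \<Longrightarrow> weq js ks"
  by (simp add: weq_def length_X X_wk del: sum_list_eq_0_iff)

lemma X_wp_le: "i \<in> X \<Longrightarrow> wp i \<le> 4" by auto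

lemma gl_toric:
  assumes f: "sol U f" and x: "x \<in> U" and ij: "i \<in> X" "j \<in> X"
  shows "pds [i, j] f x = pds (gl (wp i + wp j)) f x"
proof -
  have "wp i + wp j \<le> 8" using X_wp_le ij by fastforce
  then obtain a b where "a \<in> X" "b \<in> X" "gl (wp i + wp j) = [a, b]" "wp a + wp b = wp i + wp j" by (rule gl_cases)
  then show ?thesis using ij by (intro toric[OF f x] weq_X) auto
qed

lemma gl_toric3:
  assumes f: "sol U f" and x: "x \<in> U" and ij: "i \<in> X" "j \<in> X" and m: "m \<le> 8" "n \<le> 8" "m + wp i = n + wp j"
  shows "pd i (pds (gl m) f) x = pd j (pds (gl n) f) x"
proof -
  obtain a b where ab: "a \<in> X" "b \<in> X" "gl m = [a, b]" "wp a + wp b = m" using m(1) by (rule gl_cases)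
  obtain c e where ce: "c \<in> X" "e \<in> X" "gl n = [c, e]" "wp c + wp e = n" using m(2) by (rule gl_cases)
  have "pds (i # gl m) f x = pds (j # gl n) f x"
    using ab ce ij m by (intro toric[OF f x] weq_X) auto
  then show ?thesis by simp
qed

definition block_free :: "(complex^'n) set \<Rightarrow> (complex^'n \<Rightarrow> complex) \<Rightarrow> bool" where
  "block_free U f \<longleftrightarrow> (\<forall>k\<in>K. \<forall>x\<in>U. pd (ia k) f x = 0 \<and> pd (ib k) f x = 0)"

text \<open>The left-hand side of the recurrence with shift 2. For the shifts 0, 1, 3, 4 the corresponding expression is
  the Euler relation of a first derivative and vanishes, but no variable has weight 2.\<close>

definition R :: "(complex^'n \<Rightarrow> complex) \<Rightarrow> complex^'n \<Rightarrow> complex" where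
  "R f x = x $ i1 * pds (gl 2) f x + x $ i2 * pds (gl 3) f x + x $ i3 * pds (gl 5) f x + x $ i4 * pds (gl 6) f x"

context
  fixes f U
  assumes sol: "sol U f" and U: "open U" and bf: "block_free U f"
begin

lemma block_pds:
  assumes x: "x \<in> U" and k: "k \<in> K" and c: "c \<in> {ia k, ib k}"
  shows "pd c (pds js f) x = 0"
proof -
  have "pds (c # js) f x = 0"
  proof (rule pds_member_zero[OF sol_holo[OF sol] U _ _ x])
    show "pd c f x = 0" if "x \<in> U" for x using bf k c that by (auto simp: block_free_def)
  qed simp
  then show ?thesis by simp
qed

lemma gl_recurrence:
  assumes x: "x \<in> U" and i: "i \<in> X"
  shows "x $ i1 * pds (gl (wp i)) f x + x $ i2 * pds (gl (wp i + 1)) f x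
    + x $ i3 * pds (gl (wp i + 3)) f x + x $ i4 * pds (gl (wp i + 4)) f x = 0"
proof -
  have "wd i = 1" using i by auto
  then have "x $ i1 * pds [i1, i] f x + x $ i2 * pds [i2, i] f x + x $ i3 * pds [i3, i] f x + x $ i4 * pds [i4, i] f x = 0"
    using Euler_d[OF sol U x, of "[i]"] by simp
  moreover have "pds [i1, i] f x = pds (gl (wp i)) f x" "pds [i2, i] f x = pds (gl (wp i + 1)) f x"
    "pds [i3, i] f x = pds (gl (wp i + 3)) f x" "pds [i4, i] f x = pds (gl (wp i + 4)) f x"
    using gl_toric[OF sol x _ i] by (simp_all add: add.commute del: foldr_Cons)
  ultimately show ?thesis by (simp only:)
qed

lemma gl_Euler_d:
  assumes x: "x \<in> U" and m: "m \<le> 8"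
  shows "x $ i1 * pd i1 (pds (gl m) f) x + x $ i2 * pd i2 (pds (gl m) f) x + x $ i3 * pd i3 (pds (gl m) f) x
     + x $ i4 * pd i4 (pds (gl m) f) x = - pds (gl m) f x"
proof -
  obtain a b where "a \<in> X" "b \<in> X" "gl m = [a, b]" "wp a + wp b = m" using m by (rule gl_cases)
  then have "sum_list (map wd (gl m)) = 2" by auto
  then show ?thesis using Euler_d[OF sol U x, of "gl m"] by simp
qed

lemma gl_Euler_p:
  assumes x: "x \<in> U" and m: "m \<le> 8"
  shows "x $ i2 * pd i2 (pds (gl m) f) x + 3 * x $ i3 * pd i3 (pds (gl m) f) x
     + 4 * x $ i4 * pd i4 (pds (gl m) f) x = (2 - of_nat m) * pds (gl m) f x"
proof -
  obtain a b where "a \<in> X" "b \<in> X" "gl m = [a, b]" "wp a + wp b = m" using m by (rule gl_cases)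
  then have "sum_list (map wp (gl m)) = m" by auto
  moreover have "(\<Sum>k\<in>K. x $ ib k * pds (ib k # gl m) f x) = 0"
    using block_pds[OF x] by (intro sum.neutral) auto
  ultimately show ?thesis using Euler_p[OF sol U x, of "gl m"] by simp
qed

text \<open>First derivatives have degree \<open>2 - wp i\<close> for the weight \<open>wp\<close>, which is nonzero because no variable has
  weight 2; so the Euler relations recover first derivatives from second ones, and the function from those.\<close>

lemma zero_if_second_derivatives_zero:
  assumes z: "\<And>m x. m \<le> 8 \<Longrightarrow> x \<in> U \<Longrightarrow> pds (gl m) f x = 0" and x: "x \<in> U"
  shows "f x = 0"
proof -
  have zz: "pds [j, i] f x = 0" if "i \<in> X" "j \<in> X" for i j
    using gl_toric[OF sol x that(2,1)] z[OF _ x, of "wp j + wp i"] X_wp_le[OF that(1)] X_wp_le[OF that(2)] by simp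
  have "pds [i] f x = 0" if i: "i \<in> X" for i
  proof -
    have "(\<Sum>k\<in>K. x $ ib k * pds (ib k # [i]) f x) = 0"
      using block_pds[OF x, of _ _ "[i]"] by (intro sum.neutral) auto
    then have "(2 - of_nat (wp i)) * pds [i] f x = 0"
      using Euler_p[OF sol U x, of "[i]"] zz[OF i, of i2] zz[OF i, of i3] zz[OF i, of i4] by simp
    moreover have "(2 - of_nat (wp i) :: complex) \<noteq> 0" using i by auto
    ultimately show ?thesis by (metis mult_eq_0_iff)
  qed
  from this[of i1] this[of i2] this[of i3] this[of i4]
  show ?thesis using Euler_d[OF sol U x, of "[]"] by simp
qed

text \<open>Differentiating the missing relation gives the Euler relation of a second derivative plus a term that cancels
  its right-hand side. So the relation holds up to a constant, and this constant is the extra degree of freedom.\<close>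

lemma R_constant:
  assumes "connected U" "x \<in> U" "y \<in> U"
  shows "R f x = R f y"
proof (rule holo_constant[OF _ U assms(1) _ assms(2,3)])
  have hp: "holomorphic_on_Cn (pds js f) U" for js by (rule pds_holo[OF sol_holo[OF sol] U])
  show "holomorphic_on_Cn (R f) U" unfolding R_def[abs_def] by (intro holo_add holo_mult holo_coord hp)
  fix j x assume x: "x \<in> U"
  have pR: "pd j (R f) x = kron i1 j * pds (gl 2) f x + kron i2 j * pds (gl 3) f x + kron i3 j * pds (gl 5) f x + kron i4 j * pds (gl 6) f x
     + (x $ i1 * pd j (pds (gl 2) f) x + x $ i2 * pd j (pds (gl 3) f) x + x $ i3 * pd j (pds (gl 5) f) x + x $ i4 * pd j (pds (gl 6) f) x)"
    unfolding R_def[abs_def]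
    by (rule pd_eqI, (rule derivative_eq_intros DERIV_coord holo_has_derivative(2)[OF hp x] refl)+) simp
  show "pd j (R f) x = 0"
  proof (cases "j \<in> X")
    case True
    have m: "2 + wp j \<le> 8" using X_wp_le[OF True] by simp
    have e: "pd j (pds (gl (2 + wp i)) f) x = pd i (pds (gl (2 + wp j)) f) x" if "i \<in> X" for i
      using X_wp_le[OF that] X_wp_le[OF True] by (intro gl_toric3[OF sol x True that]) auto
    have "x $ i1 * pd j (pds (gl 2) f) x + x $ i2 * pd j (pds (gl 3) f) x + x $ i3 * pd j (pds (gl 5) f) x + x $ i4 * pd j (pds (gl 6) f) x
       = - pds (gl (2 + wp j)) f x"
      using gl_Euler_d[OF x m] e[of i1] e[of i2] e[of i3] e[of i4] by simp
    moreover have "kron i1 j * pds (gl 2) f x + kron i2 j * pds (gl 3) f x + kron i3 j * pds (gl 5) f x + kron i4 j * pds (gl 6) f x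
       = pds (gl (2 + wp j)) f x" using True by (auto simp: eval_nat_numeral)
    ultimately show ?thesis unfolding pR by simp
  next
    case False
    then obtain k where k: "k \<in> K" "j \<in> {ia k, ib k}" by (cases rule: index_cases[of j]) auto
    then show ?thesis unfolding pR using False by (auto simp: block_pds[OF x k])
  qed
qed

end

lemma block_free_F: "open U \<Longrightarrow> is_root U \<rho> \<Longrightarrow> block_free U (F \<rho>)"
  using F_sol(3,4) by (auto simp: block_free_def)

lemma gl_F:
  assumes U: "open U" and \<rho>: "is_root U \<rho>" and x: "x \<in> U" and m: "m \<le> 8"
  shows "pds (gl m) (F \<rho>) x = KF \<rho> m x"
proof -
  obtain a b where "a \<in> X" "b \<in> X" "gl m = [a, b]" "wp a + wp b = m" using m by (rule gl_cases)
  then show ?thesis using F_sol(2)[OF U \<rho> _ _ x, of a b] by simp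
qed

lemma gl_Y:
  assumes U: "open U" and nz: "\<And>x. x \<in> U \<Longrightarrow> x $ i1 \<noteq> 0" and x: "x \<in> U" and m: "m \<le> 8"
  shows "pds (gl m) Y x = KY m x"
proof -
  obtain a b where "a \<in> X" "b \<in> X" "gl m = [a, b]" "wp a + wp b = m" using m by (rule gl_cases)
  then show ?thesis using Y_sol(2)[OF U nz _ _ x, of a b] by simp
qed

lemma KF_add: "KF \<rho> (m + n) x = \<rho> x ^ n * KF \<rho> m x"
  by (simp add: KF_def power_add)

lemma block_free_lincomb:
  assumes "open U" "holomorphic_on_Cn f U" "holomorphic_on_Cn g U" "block_free U f" "block_free U g"
  shows "block_free U (\<lambda>x. f x + c * g x)"
  using assms pds_lincomb[OF assms(2,3,1), of _ "[_]" c] by (auto simp: block_free_def)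

lemma block_free_sum:
  assumes U: "open U" and "\<And>i. i \<in> I \<Longrightarrow> holomorphic_on_Cn (f i) U" "\<And>i. i \<in> I \<Longrightarrow> block_free U (f i)"
  shows "block_free U (\<lambda>x. \<Sum>i\<in>I. c i * f i x)"
proof -
  have "pd j (\<lambda>x. \<Sum>i\<in>I. c i * f i x) x = (\<Sum>i\<in>I. c i * pd j (f i) x)" if "x \<in> U" for j x
    using pds_sum[OF assms(2) U that, where js = "[j]" and I = I] by simp
  then show ?thesis using assms(3) by (auto simp: block_free_def intro!: sum.neutral)
qed

text \<open>The nine second derivatives satisfy the full recurrence, so they are combinations of the second derivatives
  \<open>KF (\<rho> j)\<close> with coefficient functions \<open>c j\<close>. Comparing first derivatives of both sides, the toric
  relations give \<open>pd i (c j) = \<rho> j ^ wp i * pd i1 (c j)\<close>, and the Euler relation for \<open>wp\<close> then multiplies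
  \<open>pd i1 (c j)\<close> by the derivative of the quartic at a simple root. Hence the \<open>c j\<close> are constant.\<close>

lemma block_free_span:
  fixes \<rho> :: "nat \<Rightarrow> complex^'n \<Rightarrow> complex"
  assumes U: "open U" "connected U" and nz: "\<And>x. x \<in> U \<Longrightarrow> x $ i4 \<noteq> 0"
    and f: "sol U f" "block_free U f" and R: "\<And>x. x \<in> U \<Longrightarrow> R f x = 0"
    and \<rho>: "\<And>j. j < 4 \<Longrightarrow> is_root U (\<rho> j)" and inj: "\<And>x. x \<in> U \<Longrightarrow> inj_on (\<lambda>j. \<rho> j x) {..<4}"
  obtains c where "\<And>x. x \<in> U \<Longrightarrow> f x = (\<Sum>j<4. c j * F (\<rho> j) x)"
proof (cases "U = {}")
  case False
  then obtain x0 where x0: "x0 \<in> U" by blast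
  let ?G = "\<lambda>m. pds (gl m) f"
  have hp: "holomorphic_on_Cn (pds js f) U" for js by (rule pds_holo[OF sol_holo[OF f(1)] U(1)])
  have rt: "x $ i1 + x $ i2 * \<rho> j x + x $ i3 * \<rho> j x ^ 3 + x $ i4 * \<rho> j x ^ 4 = 0" if "x \<in> U" "j < 4" for x j
    using root_facts(3)[OF U(1) \<rho>[OF that(2)] that(1)] .
  define c where "c = (\<lambda>j x. - (\<rho> j x ^ 3) * Lam (x $ i2) (x $ i3) (x $ i4) (\<rho> j x) (\<lambda>m. ?G m x))"
  have ch: "holomorphic_on_Cn (c j) U" if "j < 4" for j
    unfolding c_def Lam_def
    by (intro holo_mult holo_uminus holo_power holo_add holo_coord hp root_hol[OF U(1) \<rho>[OF that]])
  have Kh: "holomorphic_on_Cn (KF (\<rho> j) m) U" if "j < 4" for j m by (rule KF_hol[OF U(1) \<rho>[OF that]])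
  have Gc: "?G m x = (\<Sum>j<4. c j x * KF (\<rho> j) m x)" if x: "x \<in> U" and m: "m \<le> 8" for x m
  proof -
    have rec: "x $ i1 * ?G q x + x $ i2 * ?G (q + 1) x + x $ i3 * ?G (q + 3) x + x $ i4 * ?G (q + 4) x = 0" if "q < 5" for q
    proof -
      have "q = wp i1 \<or> q = wp i2 \<or> q = 2 \<or> q = wp i3 \<or> q = wp i4" using that by (simp, linarith)
      then show ?thesis
      proof (elim disjE)
        \<comment> \<open>only here the hypothesis on \<open>R\<close> enters\<close>
        assume "q = 2" then show ?thesis using R[OF x] by (simp add: R_def)
      qed (use gl_recurrence[OF f(1) U(1) f(2) x] in \<open>auto simp del: wp_simps\<close>)
    qed
    have "?G m x = (\<Sum>j<4. Lam (x $ i2) (x $ i3) (x $ i4) (\<rho> j x) (\<lambda>m. ?G m x) /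
        (x $ i2 + 3 * x $ i3 * (\<rho> j x)\<^sup>2 + 4 * x $ i4 * \<rho> j x ^ 3) * \<rho> j x ^ m)"
      by (rule interpolation[OF inj[OF x] nz[OF x] rt[OF x], where G = "\<lambda>m. ?G m x", OF _ rec m])
    also have "\<dots> = (\<Sum>j<4. c j x * KF (\<rho> j) m x)"
      using root_facts(1,2)[OF U(1) \<rho> x] by (intro sum.cong) (auto simp: c_def KF_def df_def)
    finally show ?thesis .
  qed
  have pG: "pd i (?G m) x = (\<Sum>j<4. pd i (c j) x * KF (\<rho> j) m x) + (\<Sum>j<4. c j x * pd i (KF (\<rho> j) m) x)"
    if x: "x \<in> U" and m: "m \<le> 8" for x m i
  proof -
    have "pd i (?G m) x = pd i (\<lambda>x. \<Sum>j<4. c j x * KF (\<rho> j) m x) x"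
      by (rule pd_cong[OF U(1) x Gc[OF _ m]])
    also have "\<dots> = (\<Sum>j<4. pd i (\<lambda>x. c j x * KF (\<rho> j) m x) x)"
      using ch Kh by (intro pd_sum[OF _ x] holo_mult) auto
    also have "\<dots> = (\<Sum>j<4. pd i (c j) x * KF (\<rho> j) m x + c j x * pd i (KF (\<rho> j) m) x)"
      using ch Kh by (intro sum.cong refl pd_mult[OF _ _ x]) auto
    finally show ?thesis by (simp add: sum.distrib)
  qed
  have indep: "e i = 0" if x: "x \<in> U" and z: "\<And>m. m < 4 \<Longrightarrow> (\<Sum>j<4. e j * KF (\<rho> j) m x) = 0" and i: "i < 4" for x i and e
  proof -
    let ?s = "\<lambda>j. - 1 / (\<rho> j x ^ 3 * df (\<rho> j) x)"
    have "(\<Sum>j<4. e j * ?s j * \<rho> j x ^ m) = 0" if "m < 4" for m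
      using z[OF that] by (simp add: KF_def)
    from power_sums_independent[OF inj[OF x] nz[OF x] rt[OF x], where e = "\<lambda>j. e j * ?s j", OF _ this i]
    show ?thesis using root_facts(1,2)[OF U(1) \<rho>[OF i] x] by simp
  qed
  have bK: "pd i (KF (\<rho> j) m) x = pd i (pds (gl m) (F (\<rho> j))) x" if "x \<in> U" "m \<le> 8" "j < 4" for i j m x
    by (rule pd_cong[OF U(1) that(1)]) (use gl_F[OF U(1) \<rho>[OF that(3)] _ that(2)] in simp)
  have c0: "pd i (c j) x = 0" if x: "x \<in> U" and j: "j < 4" for x i j
  proof (cases "i \<in> X")
    case False
    then obtain k where k: "k \<in> K" "i \<in> {ia k, ib k}" by (cases rule: index_cases[of i]) auto
    have "(\<Sum>j<4. pd i (c j) x * KF (\<rho> j) m x) = 0" if m: "m < 4" for m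
    proof -
      have "pd i (KF (\<rho> j) m) x = 0" if "j < 4" for j
        using bK[OF x _ that, of m i] m block_pds[OF F_sol(1)[OF U(1) \<rho>[OF that]] U(1) block_free_F[OF U(1) \<rho>[OF that]] x k] by simp
      then have "(\<Sum>j<4. c j x * pd i (KF (\<rho> j) m) x) = 0" by (intro sum.neutral) simp
      then show ?thesis using pG[OF x, of m i] m block_pds[OF f(1) U(1) f(2) x k, of "gl m"] by simp
    qed
    then show ?thesis by (rule indep[OF x _ j])
  next
    case True
    \<comment> \<open>toric relations between the coefficient functions\<close>
    have sh: "pd i (c j) x = \<rho> j x ^ wp i * pd i1 (c j) x" if i: "i \<in> X" and j: "j < 4" for i j
    proof -
      have "(\<Sum>j<4. (pd i (c j) x - \<rho> j x ^ wp i * pd i1 (c j) x) * KF (\<rho> j) m x) = 0" if m: "m < 4" for m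
      proof -
        have m8: "m \<le> 8" "m + wp i \<le> 8" using m X_wp_le[OF i] by auto
        have "pd i (?G m) x = pd i1 (?G (m + wp i)) x"
          using m8 by (intro gl_toric3[OF f(1) x i]) auto
        moreover have "(\<Sum>j<4. c j x * pd i (KF (\<rho> j) m) x) = (\<Sum>j<4. c j x * pd i1 (KF (\<rho> j) (m + wp i)) x)"
          using pd_KF[OF U(1) \<rho> x i, of _ m] pd_KF[OF U(1) \<rho> x, of _ i1 "m + wp i"]
          by (intro sum.cong) auto
        ultimately have "(\<Sum>j<4. pd i (c j) x * KF (\<rho> j) m x) = (\<Sum>j<4. pd i1 (c j) x * KF (\<rho> j) (m + wp i) x)"
          using pG[OF x m8(1), of i] pG[OF x m8(2), of i1] by simp
        then show ?thesis by (simp add: KF_add sum_subtractf algebra_simps)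
      qed
      from indep[OF x this j] show ?thesis by simp
    qed
    have "(\<Sum>j<4. (x $ i2 * pd i2 (c j) x + 3 * x $ i3 * pd i3 (c j) x + 4 * x $ i4 * pd i4 (c j) x) * KF (\<rho> j) m x) = 0"
      if m: "m < 4" for m
    proof -
      have m8: "m \<le> 8" using m by simp
      \<comment> \<open>the Euler relation that \<open>F (\<rho> j)\<close> itself satisfies is subtracted\<close>
      have EF: "x $ i2 * pd i2 (KF (\<rho> j) m) x + 3 * x $ i3 * pd i3 (KF (\<rho> j) m) x + 4 * x $ i4 * pd i4 (KF (\<rho> j) m) x
          = (2 - of_nat m) * KF (\<rho> j) m x" if "j < 4" for j
        unfolding bK[OF x m8 that] gl_F[OF U(1) \<rho>[OF that] x m8, symmetric]
        by (rule gl_Euler_p[OF F_sol(1)[OF U(1) \<rho>[OF that]] U(1) block_free_F[OF U(1) \<rho>[OF that]] x m8])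
      have "(\<Sum>j<4. (x $ i2 * pd i2 (c j) x + 3 * x $ i3 * pd i3 (c j) x + 4 * x $ i4 * pd i4 (c j) x) * KF (\<rho> j) m x)
         + (\<Sum>j<4. c j x * (x $ i2 * pd i2 (KF (\<rho> j) m) x + 3 * x $ i3 * pd i3 (KF (\<rho> j) m) x + 4 * x $ i4 * pd i4 (KF (\<rho> j) m) x))
        = x $ i2 * pd i2 (?G m) x + 3 * x $ i3 * pd i3 (?G m) x + 4 * x $ i4 * pd i4 (?G m) x"
        unfolding pG[OF x m8] by (simp add: algebra_simps sum.distrib sum_distrib_left)
      also have "\<dots> = (2 - of_nat m) * ?G m x" by (rule gl_Euler_p[OF f(1) U(1) f(2) x m8])
      also have "\<dots> = (\<Sum>j<4. c j x * ((2 - of_nat m) * KF (\<rho> j) m x))"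
        unfolding Gc[OF x m8] sum_distrib_left by (intro sum.cong refl) (simp add: mult.left_commute)
      also have "\<dots> = (\<Sum>j<4. c j x * (x $ i2 * pd i2 (KF (\<rho> j) m) x + 3 * x $ i3 * pd i3 (KF (\<rho> j) m) x + 4 * x $ i4 * pd i4 (KF (\<rho> j) m) x))"
        using EF by (intro sum.cong) auto
      finally show ?thesis by simp
    qed
    from indep[OF x this j]
    have "x $ i2 * pd i2 (c j) x + 3 * x $ i3 * pd i3 (c j) x + 4 * x $ i4 * pd i4 (c j) x = 0" .
    then have "\<rho> j x * df (\<rho> j) x * pd i1 (c j) x = 0"
      using sh[of i2 j] sh[of i3 j] sh[of i4 j] j by (simp add: df_def algebra_simps eval_nat_numeral)
    then have "pd i1 (c j) x = 0" using root_facts(1,2)[OF U(1) \<rho>[OF j] x] by simp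
    then show ?thesis using sh[OF True j] by simp
  qed
  have cc: "c j x = c j x0" if "x \<in> U" "j < 4" for j x
    by (rule holo_constant[OF ch[OF that(2)] U c0[OF _ that(2)] that(1) x0])
  show ?thesis
  proof
    \<comment> \<open>the combination with the values at \<open>x0\<close> as coefficients has the same second derivatives as \<open>f\<close>\<close>
    define h where "h = (\<lambda>x. \<Sum>j<4. c j x0 * F (\<rho> j) x)"
    have hs: "sol U h" unfolding h_def using F_sol(1)[OF U(1) \<rho>] by (intro sol_sum U) auto
    have hb: "block_free U h" unfolding h_def
      using sol_holo[OF F_sol(1)[OF U(1) \<rho>]] block_free_F[OF U(1) \<rho>] by (intro block_free_sum U) auto
    have ds: "sol U (\<lambda>x. f x + (-1) * h x)" by (rule sol_lincomb[OF f(1) hs U(1)])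
    have db: "block_free U (\<lambda>x. f x + (-1) * h x)"
      by (rule block_free_lincomb[OF U(1) sol_holo[OF f(1)] sol_holo[OF hs] f(2) hb])
    have z: "pds (gl m) (\<lambda>x. f x + (-1) * h x) x = 0" if m: "m \<le> 8" and x: "x \<in> U" for m x
    proof -
      have "pds (gl m) h x = (\<Sum>j<4. c j x0 * pds (gl m) (F (\<rho> j)) x)"
        unfolding h_def by (rule pds_sum[OF _ U(1) x]) (use sol_holo[OF F_sol(1)[OF U(1) \<rho>]] in auto)
      also have "\<dots> = ?G m x" unfolding Gc[OF x m]
        using gl_F[OF U(1) \<rho> x m] cc[OF x] by (intro sum.cong) auto
      finally show ?thesis
        using pds_lincomb[OF sol_holo[OF f(1)] sol_holo[OF hs] U(1) x, of "gl m" "-1"] by simp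
    qed
    show "f x = (\<Sum>j<4. c j x0 * F (\<rho> j) x)" if "x \<in> U" for x
      using zero_if_second_derivatives_zero[OF ds U(1) db z that] by (simp add: h_def)
  qed
qed (use that in auto)

end

section \<open>The dimension of the solution space\<close>

context quartic_config
begin

text \<open>The discriminant of the quartic, up to sign.\<close>

definition disc :: "complex^'n \<Rightarrow> complex" where
  "disc x = 27 * (x $ i1 * (x $ i3)\<^sup>2 + (x $ i2)\<^sup>2 * x $ i4)\<^sup>2 - 4 * (4 * x $ i1 * x $ i4 - x $ i2 * x $ i3) ^ 3"

text \<open>The factors say that the configuration is admissible and that all radicands in the solution of
  the quartic are nonzero.\<close>

definition sing :: "complex^'n \<Rightarrow> complex" where
  "sing x = x $ i1 * x $ i4 * (4 * x $ i1 * x $ i4 - x $ i2 * x $ i3) * (x $ i3 ^ 3 + 8 * x $ i2 * (x $ i4)\<^sup>2) * disc x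
     * (\<Prod>k\<in>K. x $ ia k * x $ ib k * res k x) * (\<Prod>k\<in>K. \<Prod>l\<in>K - {k}. x $ ia k * x $ ib l - x $ ia l * x $ ib k)"

lemma sing_polynomial: "polynomial_on_Cn sing"
  unfolding sing_def[abs_def] disc_def res_def by (intro polynomial_intros)

lemma sing_nonzero: "sing \<noteq> (\<lambda>_. 0)"
proof
  assume z: "sing = (\<lambda>_. 0)"
  \<comment> \<open>the quartic \<open>1 + t + t^4\<close> and the linear polynomials with zeros at the negative integers\<close>
  define x :: "complex^'n" where "x = (\<chi> j. if j = i3 then 0 else if j \<in> ia ` K then of_nat (Suc (inv_into K ia j)) else 1)"
  have xi: "x $ i1 = 1" "x $ i2 = 1" "x $ i3 = 0" "x $ i4 = 1"
    using ia_new by (auto simp: x_def)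
  have xa: "x $ ia k = of_nat (Suc k)" if "k \<in> K" for k
    using that ia_inj by (simp add: x_def inv_into_f_f)
  have xb: "x $ ib k = 1" if "k \<in> K" for k
    using that ia_ib[OF _ that] by (auto simp: x_def)
  have "res k x \<noteq> 0" if k: "k \<in> K" for k
  proof
    assume "res k x = 0"
    then have "of_nat (1 + Suc k ^ 4) = (of_nat (Suc k) :: complex)"
      using k by (simp add: res_def xi xa xb add_eq_0_iff algebra_simps)
    then have "1 + Suc k ^ 4 = Suc k" by (rule of_nat_eq_iff[THEN iffD1])
    moreover have "Suc k \<le> Suc k ^ 4" by (rule self_le_power) auto
    ultimately show False by simp
  qed
  moreover have "x $ ia k * x $ ib l - x $ ia l * x $ ib k \<noteq> 0" if "k \<in> K" "l \<in> K - {k}" for k l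
    using that by (simp add: xa xb)
  moreover have "x $ ia k \<noteq> 0" if "k \<in> K" for k unfolding xa[OF that] by (rule of_nat_neq_0)
  ultimately have "sing x \<noteq> 0"
    using finK by (simp add: sing_def disc_def xi xb)
  then show False using z by simp
qed

lemma sing_adm:
  assumes "sing x \<noteq> 0"
  shows "adm x" "4 * x $ i1 * x $ i4 - x $ i2 * x $ i3 \<noteq> 0" "x $ i3 ^ 3 + 8 * x $ i2 * (x $ i4)\<^sup>2 \<noteq> 0" "disc x \<noteq> 0"
proof -
  show "4 * x $ i1 * x $ i4 - x $ i2 * x $ i3 \<noteq> 0" "x $ i3 ^ 3 + 8 * x $ i2 * (x $ i4)\<^sup>2 \<noteq> 0" "disc x \<noteq> 0"
    using assms by (auto simp: sing_def)
  have "(\<Prod>k\<in>K. x $ ia k * x $ ib k * res k x) \<noteq> 0" "(\<Prod>k\<in>K. \<Prod>l\<in>K - {k}. x $ ia k * x $ ib l - x $ ia l * x $ ib k) \<noteq> 0"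
    "x $ i1 \<noteq> 0" "x $ i4 \<noteq> 0"
    using assms by (auto simp: sing_def)
  then show "adm x" using finK unfolding adm_def by (simp add: prod_zero_iff)
qed

lemma pds_P_block:
  assumes U: "open U" and k: "k \<in> K" and l: "l \<in> K" and nz: "\<And>x. x \<in> U \<Longrightarrow> x $ ia k \<noteq> 0 \<and> x $ ib k \<noteq> 0" and x: "x \<in> U"
    and j: "j \<in> {i2, i4}"
  shows "pds [j, ib l] (P k) x = (if l = k \<and> j = i2 then 1 / x $ ia k else 0)"
    and "pds [j, ib l] (Q k) x = (if l = k \<and> j = i4 then - ((x $ ia k)\<^sup>2 / x $ ib k ^ 3) else 0)"
proof -
  have P1: "pds [j, ib l] (P k) x = pd j (\<lambda>x. if l = k then x $ i2 / x $ ia k - x $ i1 * x $ ib k / (x $ ia k)\<^sup>2 else 0) x" for j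
    using nz k l by (auto intro!: pd_cong[OF U x] simp: pd_P)
  have P2: "pd j (\<lambda>x. x $ i2 / x $ ia k - x $ i1 * x $ ib k / (x $ ia k)\<^sup>2) x = (if j = i2 then 1 / x $ ia k else 0)" if "j \<in> {i2, i4}" for j
    by (rule pd_eqI, (rule derivative_eq_intros DERIV_coord refl | (simp add: nz x; fail))+)
       (use that nz[OF x] k in \<open>auto simp: power2_eq_square\<close>)
  have Q1: "pds [j, ib l] (Q k) x = pd j (\<lambda>x. if l = k then x $ i3 * x $ ia k / (x $ ib k)\<^sup>2 - x $ i4 * (x $ ia k)\<^sup>2 / x $ ib k ^ 3 else 0) x" for j
    using nz k l by (auto intro!: pd_cong[OF U x] simp: pd_Q)
  have Q2: "pd j (\<lambda>x. x $ i3 * x $ ia k / (x $ ib k)\<^sup>2 - x $ i4 * (x $ ia k)\<^sup>2 / x $ ib k ^ 3) x = (if j = i4 then - ((x $ ia k)\<^sup>2 / x $ ib k ^ 3) else 0)" if "j \<in> {i2, i4}" for j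
    by (rule pd_eqI, (rule derivative_eq_intros DERIV_coord refl | (simp add: nz x; fail))+)
       (use that nz[OF x] k in \<open>auto simp: eval_nat_numeral\<close>)
  show "pds [j, ib l] (P k) x = (if l = k \<and> j = i2 then 1 / x $ ia k else 0)"
    unfolding P1 using P2[OF j] by (cases "l = k") auto
  show "pds [j, ib l] (Q k) x = (if l = k \<and> j = i4 then - ((x $ ia k)\<^sup>2 / x $ ib k ^ 3) else 0)"
    unfolding Q1 using Q2[OF j] by (cases "l = k") auto
qed

text \<open>The basis is indexed by pairs of a kind and a number, where the kinds 0 to 3 stand for \<open>P\<close>, \<open>Q\<close>, \<open>Y\<close>
  and \<open>F\<close>.\<close>

definition bas :: "(nat \<Rightarrow> complex^'n \<Rightarrow> complex) \<Rightarrow> nat \<times> nat \<Rightarrow> complex^'n \<Rightarrow> complex" where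
  "bas \<rho> i = (if fst i = 0 then P (snd i) else if fst i = 1 then Q (snd i) else if fst i = 2 then Y else F (\<rho> (snd i)))"

definition idx :: "(nat \<times> nat) set" where
  "idx = {0, 1} \<times> K \<union> {(2, 0)} \<union> {3} \<times> {..<4}"

lemma idx_finite: "finite idx" and idx_card: "card idx = 2 * card K + 5"
proof -
  show "finite idx" using finK by (simp add: idx_def)
  have "card ({0, 1 :: nat} \<times> K \<union> {(2, 0)}) = card ({0, 1 :: nat} \<times> K) + 1"
    using finK by (subst card_Un_disjoint) auto
  moreover have "card idx = card ({0, 1 :: nat} \<times> K \<union> {(2, 0)}) + card ({3 :: nat} \<times> {..<4 :: nat})"
    unfolding idx_def using finK by (intro card_Un_disjoint) auto
  ultimately show "card idx = 2 * card K + 5" by (simp add: card_cartesian_product)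
qed

lemma sum_idx:
  fixes g :: "nat \<times> nat \<Rightarrow> complex"
  shows "sum g idx = (\<Sum>k\<in>K. g (0, k)) + (\<Sum>k\<in>K. g (1, k)) + g (2, 0) + (\<Sum>j<4. g (3, j))"
proof -
  have "sum g ({0, 1} \<times> K) = (\<Sum>t\<in>{0,1}. \<Sum>k\<in>K. g (t, k))"
    by (simp add: sum.cartesian_product del: sum.insert)
  moreover have "sum g ({3} \<times> {..<4}) = (\<Sum>t\<in>{3}. \<Sum>j<4. g (t, j))"
    by (simp only: sum.cartesian_product) simp
  moreover have "sum g idx = sum g ({0, 1} \<times> K) + g (2, 0) + sum g ({3} \<times> {..<4})"
    unfolding idx_def using finK by (subst sum.union_disjoint; (subst sum.union_disjoint)?) auto
  ultimately show ?thesis by simp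
qed

context
  fixes U :: "(complex^'n) set" and \<rho> :: "nat \<Rightarrow> complex^'n \<Rightarrow> complex"
  assumes U: "open U" "connected U" "U \<noteq> {}" and adm: "\<And>x. x \<in> U \<Longrightarrow> adm x"
    and \<rho>: "\<And>j. j < 4 \<Longrightarrow> is_root U (\<rho> j)" and inj: "\<And>x. x \<in> U \<Longrightarrow> inj_on (\<lambda>j. \<rho> j x) {..<4}"
begin

lemma nz1: "x \<in> U \<Longrightarrow> x $ i1 \<noteq> 0" and nz4: "x \<in> U \<Longrightarrow> x $ i4 \<noteq> 0"
  and nzab: "x \<in> U \<Longrightarrow> k \<in> K \<Longrightarrow> x $ ia k \<noteq> 0 \<and> x $ ib k \<noteq> 0"
  using adm by (auto simp: adm_def)

lemma bas_sol: "i \<in> idx \<Longrightarrow> sol U (bas \<rho> i)"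
  using P_sol[OF U(1)] Q_sol[OF U(1)] Y_sol(1)[OF U(1) nz1] F_sol(1)[OF U(1) \<rho>] nzab
  by (auto simp: idx_def bas_def)

lemma R_value:
  shows "x \<in> U \<Longrightarrow> R Y x = 2" and "x \<in> U \<Longrightarrow> j < 4 \<Longrightarrow> R (F (\<rho> j)) x = 0"
proof -
  show "R Y x = 2" if "x \<in> U"
    using that nz1[OF that] by (simp add: R_def gl_Y[OF U(1) nz1] KY_def)
  show "R (F (\<rho> j)) x = 0" if x: "x \<in> U" and j: "j < 4"
  proof -
    have "KF (\<rho> j) 3 x = \<rho> j x * KF (\<rho> j) 2 x"
      using KF_add[of "\<rho> j" 2 1 x] by (simp add: eval_nat_numeral)
    then have "R (F (\<rho> j)) x = KF (\<rho> j) 2 x * (x $ i1 + x $ i2 * \<rho> j x + x $ i3 * \<rho> j x ^ 3 + x $ i4 * \<rho> j x ^ 4)"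
      using KF_add[of "\<rho> j" 2 3 x] KF_add[of "\<rho> j" 2 4 x]
      by (simp add: R_def gl_F[OF U(1) \<rho>[OF j] x] algebra_simps)
    then show ?thesis using root_facts(3)[OF U(1) \<rho>[OF j] x] by simp
  qed
qed

text \<open>The coefficients are split off in turn: first those of \<open>P k\<close> and \<open>Q k\<close>, which leaves a function of the
  first four variables; then that of \<open>Y\<close>, which makes \<open>R\<close> vanish; the rest is a combination of the
  root solutions.\<close>

lemma span_bas:
  assumes f: "sol U f"
  shows "\<exists>c. \<forall>x\<in>U. f x = (\<Sum>i\<in>idx. c i * bas \<rho> i x)"
proof -
  have "\<exists>C D. \<forall>x\<in>U. pd (ib k) f x = C * pd (ib k) (P k) x + D * pd (ib k) (Q k) x" if "k \<in> K" for k
    using block_constants[OF f U(1) adm that U(2)] by metis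
  then obtain C D where CD: "\<And>k x. k \<in> K \<Longrightarrow> x \<in> U \<Longrightarrow> pd (ib k) f x = C k * pd (ib k) (P k) x + D k * pd (ib k) (Q k) x"
    by metis
  have Ps: "sol U (P k)" "sol U (Q k)" if "k \<in> K" for k using P_sol[OF U(1) that] Q_sol[OF U(1) that] nzab that by auto
  define p where "p = (\<lambda>x. \<Sum>k\<in>K. C k * P k x)"
  define q where "q = (\<lambda>x. \<Sum>k\<in>K. D k * Q k x)"
  have pq: "sol U p" "sol U q" unfolding p_def q_def using Ps finK by (auto intro!: sol_sum U)
  define f1 where "f1 = (\<lambda>x. (f x + (-1) * p x) + (-1) * q x)"
  have f1: "sol U f1" unfolding f1_def by (intro sol_lincomb f pq U)
  have pb: "pd (ib k) f1 x = 0" if k: "k \<in> K" and x: "x \<in> U" for k x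
  proof -
    have z: "pd (ib k) (P l) x = 0" "pd (ib k) (Q l) x = 0" if "l \<in> K" "l \<noteq> k" for l
      using that k nzab[OF x] by (auto simp: pd_P pd_Q)
    have "pd (ib k) p x = (\<Sum>l\<in>K. C l * pd (ib k) (P l) x)"
      unfolding p_def using pds_sum[of K P U x "[ib k]" C] sol_holo[OF Ps(1)] U(1) x by simp
    also have "\<dots> = C k * pd (ib k) (P k) x" using z k finK by (simp add: sum.remove[of K k] sum.neutral)
    finally have 1: "pd (ib k) p x = C k * pd (ib k) (P k) x" .
    have "pd (ib k) q x = (\<Sum>l\<in>K. D l * pd (ib k) (Q l) x)"
      unfolding q_def using pds_sum[of K Q U x "[ib k]" D] sol_holo[OF Ps(2)] U(1) x by simp
    also have "\<dots> = D k * pd (ib k) (Q k) x" using z k finK by (simp add: sum.remove[of K k] sum.neutral)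
    finally have 2: "pd (ib k) q x = D k * pd (ib k) (Q k) x" .
    have "pd (ib k) f1 x = pd (ib k) (\<lambda>x. f x + (-1) * p x) x + (-1) * pd (ib k) q x"
      unfolding f1_def
      using pds_lincomb[OF sol_holo[OF sol_lincomb[OF f pq(1) U(1)]] sol_holo[OF pq(2)] U(1) x, of "[ib k]" "-1" "-1"] by simp
    also have "pd (ib k) (\<lambda>x. f x + (-1) * p x) x = pd (ib k) f x + (-1) * pd (ib k) p x"
      using pds_lincomb[OF sol_holo[OF f] sol_holo[OF pq(1)] U(1) x, of "[ib k]" "-1"] by simp
    finally show ?thesis using 1 2 CD[OF k x] by simp
  qed
  have bf1: "block_free U f1"
    unfolding block_free_def
  proof (intro ballI conjI pb)
    fix k x assume k: "k \<in> K" and x: "x \<in> U"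
    then show "pd (ia k) f1 x = 0"
      using Euler_k[OF f1 U(1) x k, of "[]"] pb[OF k x] nzab[OF x k] by simp
  qed
  obtain x0 where x0: "x0 \<in> U" using U(3) by blast
  define r where "r = R f1 x0 / 2"
  have Ys: "sol U Y" "block_free U Y" using Y_sol[OF U(1) nz1] by (auto simp: block_free_def)
  define f2 where "f2 = (\<lambda>x. f1 x + (- r) * Y x)"
  have f2: "sol U f2" "block_free U f2" unfolding f2_def
    by (intro sol_lincomb block_free_lincomb f1 Ys U bf1 sol_holo)+
  have R2: "R f2 x = 0" if x: "x \<in> U" for x
  proof -
    have "R f2 x = R f1 x + (- r) * R Y x"
      unfolding R_def f2_def pds_lincomb[OF sol_holo[OF f1] sol_holo[OF Ys(1)] U(1) x] by (simp add: algebra_simps)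
    then show ?thesis using R_constant[OF f1 U(1) bf1 U(2) x x0] R_value(1)[OF x] by (simp add: r_def)
  qed
  obtain e where e: "\<And>x. x \<in> U \<Longrightarrow> f2 x = (\<Sum>j<4. e j * F (\<rho> j) x)"
    using block_free_span[where \<rho> = \<rho>, OF U(1,2) nz4 f2 R2 \<rho> inj] by blast
  show ?thesis
  proof (intro exI[of _ "\<lambda>(t, k). if t = 0 then C k else if t = 1 then D k else if t = 2 then r else e k"] ballI)
    fix x assume x: "x \<in> U"
    have "f x = p x + q x + r * Y x + f2 x" by (simp add: f1_def f2_def)
    then show "f x = (\<Sum>i\<in>idx. (case i of (t, k) \<Rightarrow> if t = 0 then C k else if t = 1 then D k else if t = 2 then r else e k) * bas \<rho> i x)"
      unfolding sum_idx e[OF x] p_def q_def by (simp add: bas_def)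
  qed
qed

text \<open>The functionals that produce the coefficients in the proof of spanning also separate them: the derivatives
  along \<open>[i2, ib k]\<close> and \<open>[i4, ib k]\<close>, then \<open>R\<close>, then the second derivatives at one point.\<close>

lemma indep_bas:
  assumes z: "\<And>x. x \<in> U \<Longrightarrow> (\<Sum>i\<in>idx. c i * bas \<rho> i x) = 0" and i: "i \<in> idx"
  shows "c i = 0"
proof -
  obtain x where x: "x \<in> U" using U(3) by blast
  have D: "(\<Sum>i\<in>idx. c i * pds js (bas \<rho> i) x) = 0" for js
  proof -
    have "pds js (\<lambda>x. \<Sum>i\<in>idx. c i * bas \<rho> i x) x = (\<Sum>i\<in>idx. c i * pds js (bas \<rho> i) x)"
      by (rule pds_sum[OF sol_holo[OF bas_sol] U(1) x])
    moreover have "pds js (\<lambda>x. \<Sum>i\<in>idx. c i * bas \<rho> i x) x = 0"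
      using pds_zero[OF U(1), of "[]" "\<lambda>x. \<Sum>i\<in>idx. c i * bas \<rho> i x" x js] z x by simp
    ultimately show ?thesis by simp
  qed
  have YF0: "pds [j, ib l] Y x = 0" "m < 4 \<Longrightarrow> pds [j, ib l] (F (\<rho> m)) x = 0" if l: "l \<in> K" for j l m
    using pds_zero[OF U(1), of "[ib l]" Y x "[j]"] pds_zero[OF U(1), of "[ib l]" "F (\<rho> m)" x "[j]"] x
      Y_sol(4)[OF U(1) nz1 l] F_sol(4)[OF U(1) \<rho> l] by auto
  have PQ: "c (0, l) = 0 \<and> c (1, l) = 0" if l: "l \<in> K" for l
  proof -
    note B = pds_P_block[OF U(1) _ l _ x]
    have gen: "(\<Sum>k\<in>K. c (0, k) * pds [j, ib l] (P k) x) + (\<Sum>k\<in>K. c (1, k) * pds [j, ib l] (Q k) x) = 0" for j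
      using D[of "[j, ib l]"] YF0[OF l, where j = j] unfolding sum_idx by (simp add: bas_def del: foldr_Cons)
    have "(\<Sum>k\<in>K. c (0, k) * pds [i2, ib l] (P k) x) = c (0, l) * (1 / x $ ia l)"
      using B(1)[of _ i2] nzab l finK
      by (simp add: sum.remove[of K l] sum.neutral del: foldr_Cons)
    moreover have "(\<Sum>k\<in>K. c (1, k) * pds [i2, ib l] (Q k) x) = 0"
      using B(2)[of _ i2] nzab l finK by (intro sum.neutral) (simp del: foldr_Cons)
    ultimately have 0: "c (0, l) = 0" using gen[of i2] nzab[OF x l] by simp
    have "(\<Sum>k\<in>K. c (1, k) * pds [i4, ib l] (Q k) x) = c (1, l) * (- ((x $ ia l)\<^sup>2 / x $ ib l ^ 3))"
      using B(2)[of _ i4] nzab l finK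
      by (simp add: sum.remove[of K l] sum.neutral del: foldr_Cons)
    moreover have "(\<Sum>k\<in>K. c (0, k) * pds [i4, ib l] (P k) x) = 0"
      using B(1)[of _ i4] nzab l finK by (intro sum.neutral) (simp del: foldr_Cons)
    ultimately have "c (1, l) = 0" using gen[of i4] nzab[OF x l] by simp
    with 0 show ?thesis by simp
  qed
  have G: "c (2, 0) * pds js Y x + (\<Sum>j<4. c (3, j) * pds js (F (\<rho> j)) x) = 0" for js
    using D[of js] PQ unfolding sum_idx by (simp add: bas_def)
  have "c (2, 0) * R Y x + (\<Sum>j<4. c (3, j) * R (F (\<rho> j)) x) = 0"
  proof -
    have "c (2, 0) * R Y x + (\<Sum>j<4. c (3, j) * R (F (\<rho> j)) x) =
      x $ i1 * (c (2, 0) * pds (gl 2) Y x + (\<Sum>j<4. c (3, j) * pds (gl 2) (F (\<rho> j)) x))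
      + x $ i2 * (c (2, 0) * pds (gl 3) Y x + (\<Sum>j<4. c (3, j) * pds (gl 3) (F (\<rho> j)) x))
      + x $ i3 * (c (2, 0) * pds (gl 5) Y x + (\<Sum>j<4. c (3, j) * pds (gl 5) (F (\<rho> j)) x))
      + x $ i4 * (c (2, 0) * pds (gl 6) Y x + (\<Sum>j<4. c (3, j) * pds (gl 6) (F (\<rho> j)) x))"
      by (simp add: R_def algebra_simps sum.distrib sum_distrib_left)
    then show ?thesis unfolding G by simp
  qed
  then have c2: "c (2, 0) = 0" using R_value(1)[OF x] R_value(2)[OF x] by simp
  have c3: "c (3, m) = 0" if m: "m < 4" for m
  proof -
    have "(\<Sum>j<4. c (3, j) * (- 1 / (\<rho> j x ^ 3 * df (\<rho> j) x)) * \<rho> j x ^ n) = 0" if "n < 4" for n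
    proof -
      have "(\<Sum>j<4. c (3, j) * pds (gl n) (F (\<rho> j)) x) = 0" using G[of "gl n"] c2 by simp
      moreover have "pds (gl n) (F (\<rho> j)) x = - 1 / (\<rho> j x ^ 3 * df (\<rho> j) x) * \<rho> j x ^ n" if "j < 4" for j
        using gl_F[OF U(1) \<rho>[OF that] x] \<open>n < 4\<close> by (simp add: KF_def)
      ultimately show ?thesis by (simp add: mult.assoc)
    qed
    from power_sums_independent[OF inj[OF x] nz4[OF x] root_facts(3)[OF U(1) \<rho> x],
        where e = "\<lambda>j. c (3, j) * (- 1 / (\<rho> j x ^ 3 * df (\<rho> j) x))", OF _ this m]
    show ?thesis using root_facts(1,2)[OF U(1) \<rho>[OF m] x] by simp
  qed
  show ?thesis using i PQ c2 c3 by (auto simp: idx_def)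
qed

end

lemma sol_cong:
  assumes U: "open U" and f: "sol U f" and eq: "\<And>x. x \<in> U \<Longrightarrow> f x = g x"
  shows "sol U g"
proof -
  have p: "pds js g x = pds js f x" if "x \<in> U" for js x
    using pds_cong[OF U that eq, where js = js] by simp
  have "holomorphic_on_Cn g U" by (rule holo_cong[OF sol_holo[OF f] U eq])
  then show ?thesis using f p p[of _ "[_]"] eq by (auto simp: sol_def Euler_def)
qed

lemma solution_space_dim:
  assumes U: "open U" "simply_connected U" "U \<noteq> {}" and s: "U \<subseteq> {x. sing x \<noteq> 0}"
  shows "has_finite_dim {f. sol U f \<and> (\<forall>x. x \<notin> U \<longrightarrow> f x = 0)} (2 * card K + 5)"
proof -
  have s': "sing x \<noteq> 0" if "x \<in> U" for x using s that by auto
  note A = sing_adm[OF s']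
  have conn: "connected U" using U(2) by (rule simply_connected_imp_connected)
  have nz: "x $ i1 \<noteq> 0" "x $ i4 \<noteq> 0" if "x \<in> U" for x using A(1)[OF that] by (auto simp: adm_def)
  obtain \<rho> :: "nat \<Rightarrow> complex^'n \<Rightarrow> complex" where r: "\<And>j. holomorphic_on_Cn (\<rho> j) U"
    "\<And>x. x \<in> U \<Longrightarrow> inj_on (\<lambda>j. \<rho> j x) {..<4}"
    "\<And>j x. x \<in> U \<Longrightarrow> x $ i1 + x $ i2 * \<rho> j x + x $ i3 * \<rho> j x ^ 3 + x $ i4 * \<rho> j x ^ 4 = 0"
    using quartic_root_functions[OF U(1,2) holo_coord holo_coord holo_coord holo_coord nz(2) A(2,3) A(4)[unfolded disc_def]]
    by blast
  have root: "is_root U (\<rho> j)" if "j < 4" for j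
    unfolding is_root_def
  proof (intro conjI ballI r(1,3))
    fix x assume x: "x \<in> U"
    show "\<rho> j x \<noteq> 0" using r(3)[OF x, of j] nz(1)[OF x] by auto
    show "df (\<rho> j) x \<noteq> 0"
      using roots_simple[OF r(2)[OF x] nz(2)[OF x] r(3)[OF x] that] by (simp add: df_def)
  qed
  note ctx = U(1) conn U(3) A(1) root r(2)
  define b where "b = (\<lambda>i x. if x \<in> U then bas \<rho> i x else 0)"
  show ?thesis unfolding idx_card[symmetric]
  proof (rule has_finite_dimI[where b = b, OF idx_finite])
    fix c :: "nat \<times> nat \<Rightarrow> complex"
    have "sol U (\<lambda>x. \<Sum>i\<in>idx. c i * bas \<rho> i x)"
      by (rule sol_sum[OF bas_sol[OF ctx] U(1) idx_finite])
    moreover have "(\<Sum>i\<in>idx. c i * b i x) = (if x \<in> U then \<Sum>i\<in>idx. c i * bas \<rho> i x else 0)" for x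
      by (simp add: b_def)
    ultimately show "(\<lambda>x. \<Sum>i\<in>idx. c i * b i x) \<in> {f. sol U f \<and> (\<forall>x. x \<notin> U \<longrightarrow> f x = 0)}"
      using sol_cong[OF U(1), of "\<lambda>x. \<Sum>i\<in>idx. c i * bas \<rho> i x" "\<lambda>x. \<Sum>i\<in>idx. c i * b i x"] by simp
  next
    fix f assume "f \<in> {f. sol U f \<and> (\<forall>x. x \<notin> U \<longrightarrow> f x = 0)}"
    then have f: "sol U f" "\<And>x. x \<notin> U \<Longrightarrow> f x = 0" by auto
    obtain c where "\<forall>x\<in>U. f x = (\<Sum>i\<in>idx. c i * bas \<rho> i x)" using span_bas[OF ctx f(1)] by blast
    then have "f x = (\<Sum>i\<in>idx. c i * b i x)" for x using f(2) by (cases "x \<in> U") (auto simp: b_def)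
    then have "f = (\<lambda>x. \<Sum>i\<in>idx. c i * b i x)" by (rule ext)
    then show "\<exists>c. f = (\<lambda>x. \<Sum>i\<in>idx. c i * b i x)" by blast
  next
    fix c i assume z: "(\<lambda>x. \<Sum>i\<in>idx. c i * b i x) = (\<lambda>x. 0)" and i: "i \<in> idx"
    have zz: "(\<Sum>i\<in>idx. c i * bas \<rho> i x) = 0" if "x \<in> U" for x
      using fun_cong[OF z, of x] that by (simp add: b_def)
    show "c i = 0" by (rule indep_bas[OF ctx zz i])
  qed
qed

end

section \<open>The volume of the polytope\<close>

text \<open>By Fubini it suffices to consider a line in the direction \<open>a\<close>, on which \<open>l\<close> is constant and the map is
  affine. Shears and scalings of one coordinate are maps of this form.\<close>

lemma emeasure_coordinate_affine:
  fixes a :: "'a::euclidean_space"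
  assumes a: "a \<in> Basis" and c: "c \<noteq> 0" and l [measurable]: "l \<in> borel_measurable borel"
    and inv: "\<And>x t. l (x + t *\<^sub>R a) = l x" and S: "S \<in> sets borel"
  shows "emeasure lborel S = ennreal \<bar>c\<bar> * emeasure lborel ((\<lambda>x. x + ((c - 1) * (x \<bullet> a) + l x) *\<^sub>R a) -` S)"
proof -
  define T where "T = (\<lambda>x. x + ((c - 1) * (x \<bullet> a) + l x) *\<^sub>R a)"
  have T [measurable]: "T \<in> borel_measurable borel" unfolding T_def by measurable
  have TS: "T -` S \<in> sets borel" using measurable_sets[OF T S] by simp
  define B where "B = Basis - {a}"
  have B: "finite B" "a \<notin> B" "insert a B = Basis" using a by (auto simp: B_def)
  define v where "v = (\<lambda>f :: 'a \<Rightarrow> real. \<Sum>b\<in>B. f b *\<^sub>R b)"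
  interpret product_sigma_finite "\<lambda>_::'a. lborel :: real measure"
    by (simp add: product_sigma_finite_def lborel.sigma_finite_measure_axioms)
  have E: "(\<integral>\<^sup>+x. g x \<partial>lborel) = (\<integral>\<^sup>+f. (\<integral>\<^sup>+y. g (y *\<^sub>R a + v f) \<partial>lborel) \<partial>(Pi\<^sub>M B (\<lambda>_. lborel)))"
    if g [measurable]: "g \<in> borel_measurable borel" for g :: "'a \<Rightarrow> ennreal"
  proof -
    have "(\<integral>\<^sup>+x. g x \<partial>lborel) = (\<integral>\<^sup>+f. g (\<Sum>b\<in>Basis. f b *\<^sub>R b) \<partial>(Pi\<^sub>M Basis (\<lambda>_. lborel)))"
      by (subst lborel_eq, subst nn_integral_distr) auto
    also have "\<dots> = (\<integral>\<^sup>+f. g (\<Sum>b\<in>insert a B. f b *\<^sub>R b) \<partial>(Pi\<^sub>M (insert a B) (\<lambda>_. lborel)))"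
      by (simp only: B(3))
    also have "\<dots> = (\<integral>\<^sup>+f. (\<integral>\<^sup>+y. g (\<Sum>b\<in>insert a B. (f(a := y)) b *\<^sub>R b) \<partial>lborel) \<partial>(Pi\<^sub>M B (\<lambda>_. lborel)))"
      by (rule product_nn_integral_insert[OF B(1,2)]) measurable
    also have "(\<lambda>f y. g (\<Sum>b\<in>insert a B. (f(a := y)) b *\<^sub>R b)) = (\<lambda>f y. g (y *\<^sub>R a + v f))"
    proof (intro ext arg_cong[where f = g])
      fix f y
      have "(\<Sum>b\<in>B. (f(a := y)) b *\<^sub>R b) = v f" unfolding v_def using B(2) by (intro sum.cong) auto
      then show "(\<Sum>b\<in>insert a B. (f(a := y)) b *\<^sub>R b) = y *\<^sub>R a + v f" using B(1,2) by simp
    qed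
    finally show ?thesis .
  qed
  have va: "v f \<bullet> a = 0" for f
    unfolding v_def using a by (auto simp: inner_sum_left B_def inner_Basis intro!: sum.neutral)
  have Tv: "T (y *\<^sub>R a + v f) = (l (v f) + c * y) *\<^sub>R a + v f" for y f
  proof -
    have "l (y *\<^sub>R a + v f) = l (v f)" using inv[of "v f" y] by (simp add: add.commute)
    then show ?thesis using a by (simp add: T_def va inner_add_left algebra_simps)
  qed
  have "emeasure lborel S = (\<integral>\<^sup>+x. indicator S x \<partial>lborel)" using S by simp
  also have "\<dots> = (\<integral>\<^sup>+f. (\<integral>\<^sup>+y. indicator S (y *\<^sub>R a + v f) \<partial>lborel) \<partial>(Pi\<^sub>M B (\<lambda>_. lborel)))"
    using S by (intro E) simp
  also have "\<dots> = (\<integral>\<^sup>+f. (\<integral>\<^sup>+y. ennreal \<bar>c\<bar> * indicator (T -` S) (y *\<^sub>R a + v f) \<partial>lborel) \<partial>(Pi\<^sub>M B (\<lambda>_. lborel)))"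
  proof (rule nn_integral_cong)
    fix f
    have m1: "(\<lambda>y. indicator S (y *\<^sub>R a + v f) :: ennreal) \<in> borel_measurable borel" using S by measurable
    have m2: "(\<lambda>y. indicator (T -` S) (y *\<^sub>R a + v f) :: ennreal) \<in> borel_measurable borel" using TS by measurable
    have "(\<integral>\<^sup>+y. indicator S (y *\<^sub>R a + v f) \<partial>lborel) = ennreal \<bar>c\<bar> * (\<integral>\<^sup>+y. indicator S ((l (v f) + c * y) *\<^sub>R a + v f) \<partial>lborel)"
      by (rule nn_integral_real_affine[OF m1 c])
    also have "\<dots> = ennreal \<bar>c\<bar> * (\<integral>\<^sup>+y. indicator (T -` S) (y *\<^sub>R a + v f) \<partial>lborel)"
      by (simp add: indicator_def Tv)
    also have "\<dots> = (\<integral>\<^sup>+y. ennreal \<bar>c\<bar> * indicator (T -` S) (y *\<^sub>R a + v f) \<partial>lborel)"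
      using m2 by (simp add: nn_integral_cmult)
    finally show "(\<integral>\<^sup>+y. indicator S (y *\<^sub>R a + v f) \<partial>lborel) = (\<integral>\<^sup>+y. ennreal \<bar>c\<bar> * indicator (T -` S) (y *\<^sub>R a + v f) \<partial>lborel)" .
  qed
  also have "\<dots> = (\<integral>\<^sup>+x. ennreal \<bar>c\<bar> * indicator (T -` S) x \<partial>lborel)"
    using TS by (intro E[symmetric]) simp
  also have "\<dots> = ennreal \<bar>c\<bar> * emeasure lborel (T -` S)" using TS by (simp add: nn_integral_cmult)
  finally show ?thesis by (simp add: T_def)
qed

definition reset :: "'d \<Rightarrow> (real^'d \<Rightarrow> real) \<Rightarrow> real^'d \<Rightarrow> real^'d" where
  "reset r u x = (\<chi> i. if i = r then u x else x $ i)"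

lemma emeasure_reset:
  fixes r :: "'d::finite"
  assumes c: "c \<noteq> 0" and l: "l \<in> borel_measurable borel" and inv: "\<And>x t. l (x + axis r t) = l x" and S: "S \<in> sets borel"
  shows "emeasure lborel S = ennreal \<bar>c\<bar> * emeasure lborel (reset r (\<lambda>x. c * x $ r + l x) -` S)"
    and "reset r (\<lambda>x. c * x $ r + l x) -` S \<in> sets borel"
proof -
  have ax: "t *\<^sub>R axis r (1::real) = axis r t" for t by (auto simp: vec_eq_iff axis_def)
  have eq: "reset r (\<lambda>x. c * x $ r + l x) = (\<lambda>x. x + ((c - 1) * (x \<bullet> axis r 1) + l x) *\<^sub>R axis r 1)"
  proof
    fix x
    have "x \<bullet> axis r 1 = x $ r" by (simp add: inner_axis)
    then show "reset r (\<lambda>x. c * x $ r + l x) x = x + ((c - 1) * (x \<bullet> axis r 1) + l x) *\<^sub>R axis r 1"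
      by (simp add: reset_def vec_eq_iff axis_def algebra_simps)
  qed
  show "emeasure lborel S = ennreal \<bar>c\<bar> * emeasure lborel (reset r (\<lambda>x. c * x $ r + l x) -` S)"
    unfolding eq by (rule emeasure_coordinate_affine[OF _ c l _ S]) (auto simp: ax inv axis_in_Basis_iff)
  have "(\<lambda>x. x + ((c - 1) * (x \<bullet> axis r 1) + l x) *\<^sub>R axis r 1) \<in> borel_measurable borel"
    using l by measurable
  from measurable_sets[OF this S] show "reset r (\<lambda>x. c * x $ r + l x) -` S \<in> sets borel"
    unfolding eq by simp
qed


lemma std_simplex_vec:
  "convex hull (insert 0 Basis) = {x::real^'d. (\<forall>i. 0 \<le> x $ i) \<and> (\<Sum>i\<in>UNIV. x $ i) \<le> 1}"
proof -
  have B: "(Basis :: (real^'d) set) = range (\<lambda>i. axis i 1)" by (auto simp: Basis_vec_def)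
  have "inj (\<lambda>i. axis i 1 :: real^'d)" by (auto simp: inj_on_def axis_eq_axis)
  then have "(\<Sum>b\<in>Basis. x \<bullet> b) = (\<Sum>i\<in>UNIV. x $ i)" for x :: "real^'d"
    unfolding B by (simp add: sum.reindex inner_axis)
  moreover have "(\<forall>b\<in>Basis. 0 \<le> x \<bullet> b) \<longleftrightarrow> (\<forall>i. 0 \<le> x $ i)" for x :: "real^'d"
    unfolding B by (auto simp: inner_axis)
  ultimately show ?thesis unfolding std_simplex by simp
qed

text \<open>The region below the graph of a linear form over a simplex is cut along the partial sums of the
  form; each slice becomes a standard simplex after two coordinate changes.\<close>

lemma slice_volume:
  fixes s :: "real^'d::finite \<Rightarrow> real"
  assumes pq: "p \<noteq> q" and c: "c > 0" and s: "s \<in> borel_measurable borel" and inv: "\<And>x t. s (x + axis q t) = s x"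
  defines "M \<equiv> {y. (\<forall>i. i \<noteq> q \<longrightarrow> 0 \<le> y $ i) \<and> (\<Sum>i\<in>UNIV - {q}. y $ i) \<le> 1 \<and> s y \<le> y $ q \<and> y $ q \<le> s y + c * y $ p}"
  obtains N where "M \<subseteq> N" "N \<in> sets borel" "emeasure lborel N = ennreal (c / fact CARD('d))"
proof -
  let ?D = "convex hull (insert 0 Basis) :: (real^'d) set"
  have D: "?D \<in> sets borel"
    by (intro borel_closed compact_imp_closed finite_imp_compact_convex_hull) simp
  define l1 where "l1 = (\<lambda>x::real^'d. - x $ q)"
  define l2 where "l2 = (\<lambda>x. - s x / c)"
  define N1 where "N1 = reset p (\<lambda>x. 1 * x $ p + l1 x) -` ?D"
  define N where "N = reset q (\<lambda>x. (1 / c) * x $ q + l2 x) -` N1"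
  have l1: "l1 \<in> borel_measurable borel" "\<And>x t. l1 (x + axis p t) = l1 x"
    using pq by (auto simp: l1_def axis_def intro!: borel_measurable_continuous_onI continuous_intros)
  have l2: "l2 \<in> borel_measurable borel" "\<And>x t. l2 (x + axis q t) = l2 x"
    using s by (auto simp: l2_def inv)
  note r1 = emeasure_reset[of 1 l1 p, OF _ l1 D, folded N1_def]
  have N1b: "N1 \<in> sets borel" using r1(2) by simp
  note r2 = emeasure_reset[of "1 / c" l2 q, OF _ l2 N1b, folded N_def]
  show ?thesis
  proof
    show "N \<in> sets borel" using r2(2) c by simp
    have "ennreal (1 / fact CARD('d)) = emeasure lborel N1"
      using r1(1) emeasure_std_simplex[where 'a = "real^'d"] by simp
    also have "\<dots> = ennreal (1 / c) * emeasure lborel N" using r2(1) c by simp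
    finally have "ennreal c * ennreal (1 / fact CARD('d)) = ennreal c * (ennreal (1 / c) * emeasure lborel N)" by simp
    also have "\<dots> = emeasure lborel N"
      using c by (simp add: mult.assoc[symmetric] ennreal_mult[symmetric])
    finally show "emeasure lborel N = ennreal (c / fact CARD('d))"
      using c by (simp add: ennreal_mult[symmetric])
    show "M \<subseteq> N"
    proof
      fix y assume y: "y \<in> M"
      define \<tau> where "\<tau> = (y $ q - s y) / c"
      have t: "0 \<le> \<tau>" "\<tau> \<le> y $ p" using y c by (auto simp: M_def \<tau>_def field_simps)
      define t where "t = reset p (\<lambda>x. 1 * x $ p + l1 x) (reset q (\<lambda>x. (1 / c) * x $ q + l2 x) y)"
      have tv: "t = (\<chi> i. if i = p then y $ p - \<tau> else if i = q then \<tau> else y $ i)"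
        using pq c by (auto simp: t_def reset_def l1_def l2_def \<tau>_def vec_eq_iff field_simps)
      have "\<forall>i. 0 \<le> t $ i" using y t by (auto simp: tv M_def)
      moreover have "(\<Sum>i\<in>UNIV. t $ i) = (\<Sum>i\<in>UNIV - {q}. y $ i)"
      proof -
        have "(\<Sum>i\<in>UNIV. t $ i) = t $ q + (t $ p + (\<Sum>i\<in>UNIV - {q} - {p}. t $ i))"
          using pq by (simp add: sum.remove[of UNIV q] sum.remove[of "UNIV - {q}" p])
        also have "(\<Sum>i\<in>UNIV - {q} - {p}. t $ i) = (\<Sum>i\<in>UNIV - {q} - {p}. y $ i)"
          by (intro sum.cong) (auto simp: tv)
        also have "t $ q + (t $ p + (\<Sum>i\<in>UNIV - {q} - {p}. y $ i)) = y $ p + (\<Sum>i\<in>UNIV - {q} - {p}. y $ i)"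
          using pq by (simp add: tv)
        also have "\<dots> = (\<Sum>i\<in>UNIV - {q}. y $ i)" using pq by (simp add: sum.remove[of "UNIV - {q}" p])
        finally show ?thesis .
      qed
      ultimately have "t \<in> ?D" using y by (simp add: std_simplex_vec M_def)
      then show "y \<in> N" by (simp add: N_def N1_def t_def)
    qed
  qed
qed

text \<open>The slices between consecutive partial sums of the linear form cover the region, and their volumes add up
  to the sum of the coefficients, divided by the factorial of the dimension.\<close>

lemma Cayley_volume:
  fixes row :: "nat \<Rightarrow> 'd::finite" and c :: "nat \<Rightarrow> real"
  assumes d: "d \<ge> 2" and row: "bij_betw row {1..d} UNIV" and c: "\<And>k. c k > 0"
  defines "W \<equiv> {y :: real^'d. (\<forall>i. i \<noteq> row d \<longrightarrow> 0 \<le> y $ i) \<and> (\<Sum>i\<in>UNIV - {row d}. y $ i) \<le> 1 \<and>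
     0 \<le> y $ row d \<and> y $ row d \<le> (\<Sum>k=1..<d. c k * y $ row k)}"
  obtains N where "W \<subseteq> N" "N \<in> sets borel" "emeasure lborel N \<le> ennreal ((\<Sum>k=1..<d. c k) / fact CARD('d))"
proof -
  define s where "s = (\<lambda>j y. \<Sum>k=1..<j. c k * y $ row k :: real)"
  have rne: "row j \<noteq> row d" if "1 \<le> j" "j < d" for j
    using inj_on_eq_iff[OF bij_betw_imp_inj_on[OF row], of j d] that by simp
  define M where "M = (\<lambda>j. {y. (\<forall>i. i \<noteq> row d \<longrightarrow> 0 \<le> y $ i) \<and> (\<Sum>i\<in>UNIV - {row d}. y $ i) \<le> 1 \<and>
      s j y \<le> y $ row d \<and> y $ row d \<le> s j y + c j * y $ row j})"
  have "\<exists>N. M j \<subseteq> N \<and> N \<in> sets borel \<and> emeasure lborel N = ennreal (c j / fact CARD('d))"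
    if j: "j \<in> {1..<d}" for j
  proof -
    have sb: "s j \<in> borel_measurable borel" unfolding s_def
      by (intro borel_measurable_continuous_onI continuous_intros)
    have si: "s j (x + axis (row d) t) = s j x" for x t
      unfolding s_def using j rne by (intro sum.cong) (auto simp: axis_def)
    have pq: "row j \<noteq> row d" using rne j by simp
    obtain N where "M j \<subseteq> N" "N \<in> sets borel" "emeasure lborel N = ennreal (c j / fact CARD('d))"
      unfolding M_def by (rule slice_volume[OF pq c sb si])
    then show ?thesis by blast
  qed
  then have "\<forall>j\<in>{1..<d}. \<exists>N. M j \<subseteq> N \<and> N \<in> sets borel \<and> emeasure lborel N = ennreal (c j / fact CARD('d))"
    by blast
  from bchoice[OF this] obtain N where N: "\<And>j. j \<in> {1..<d} \<Longrightarrow> M j \<subseteq> N j"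
    "\<And>j. j \<in> {1..<d} \<Longrightarrow> N j \<in> sets borel"
    "\<And>j. j \<in> {1..<d} \<Longrightarrow> emeasure lborel (N j) = ennreal (c j / fact CARD('d))"
    by blast
  show ?thesis
  proof
    show "(\<Union>j\<in>{1..<d}. N j) \<in> sets borel" using N(2) by auto
    show "W \<subseteq> (\<Union>j\<in>{1..<d}. N j)"
    proof
      fix y assume y: "y \<in> W"
      \<comment> \<open>the slice is found as the first partial sum that reaches the last coordinate\<close>
      define m where "m = (LEAST j. y $ row d \<le> s (Suc j) y)"
      have "y $ row d \<le> s (Suc (d - 1)) y" using y d by (simp add: W_def s_def)
      then have m1: "y $ row d \<le> s (Suc m) y" and md: "m \<le> d - 1"
        unfolding m_def by (auto intro: LeastI Least_le)
      show "y \<in> (\<Union>j\<in>{1..<d}. N j)"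
      proof (cases "m = 0")
        case True
        then have "y $ row d = 0" using m1 y by (simp add: s_def W_def)
        moreover have "0 \<le> c 1 * y $ row 1" using y c[of 1] rne[of 1] d by (simp add: W_def)
        ultimately have "y \<in> N 1" using N(1)[of 1] y d by (auto simp: W_def M_def s_def)
        then show ?thesis using d by auto
      next
        case False
        then have "\<not> y $ row d \<le> s (Suc (m - 1)) y" unfolding m_def by (intro not_less_Least) simp
        then have "s m y \<le> y $ row d" using False by simp
        moreover have "s (Suc m) y = s m y + c m * y $ row m" using False by (simp add: s_def)
        ultimately have "y \<in> M m" using y m1 by (simp add: W_def M_def)
        moreover have "m \<in> {1..<d}" using md d False by auto
        ultimately show ?thesis using N(1)[of m] by blast
      qed
    qed
    have "emeasure lborel (\<Union>j\<in>{1..<d}. N j) \<le> (\<Sum>j\<in>{1..<d}. emeasure lborel (N j))"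
      using N(2) by (intro emeasure_subadditive_finite) auto
    also have "\<dots> = (\<Sum>j\<in>{1..<d}. ennreal (c j / fact CARD('d)))" using N(3) by simp
    also have "\<dots> = ennreal ((\<Sum>k=1..<d. c k) / fact CARD('d))"
      using c by (subst sum_ennreal) (auto simp: sum_divide_distrib less_imp_le)
    finally show "emeasure lborel (\<Union>j\<in>{1..<d}. N j) \<le> ennreal ((\<Sum>k=1..<d. c k) / fact CARD('d))" .
  qed
qed

text \<open>Subtracting from the first coordinate the middle ones turns the Cayley polytope over segments of
  lengths \<open>c k\<close> into the region below a linear form over the standard simplex.\<close>

lemma hull_volume:
  fixes row :: "nat \<Rightarrow> 'd::finite" and V :: "(real^'d) set" and c :: "nat \<Rightarrow> real"
  assumes d: "d \<ge> 2" and row: "bij_betw row {1..d} UNIV" and c: "\<And>k. c k > 0" and V: "finite V"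
    and pts: "\<And>v. v \<in> V \<Longrightarrow> (\<forall>i. i \<noteq> row d \<longrightarrow> 0 \<le> v $ i) \<and> (\<Sum>k=2..<d. v $ row k) \<le> v $ row 1 \<and> v $ row 1 \<le> 1 \<and>
       0 \<le> v $ row d \<and> v $ row d \<le> c 1 * (v $ row 1 - (\<Sum>k=2..<d. v $ row k)) + (\<Sum>k=2..<d. c k * v $ row k)"
  shows "measure lebesgue (convex hull V) \<le> (\<Sum>k=1..<d. c k) / fact CARD('d)"
proof -
  let ?W = "{y :: real^'d. (\<forall>i. i \<noteq> row d \<longrightarrow> 0 \<le> y $ i) \<and> (\<Sum>i\<in>UNIV - {row d}. y $ i) \<le> 1 \<and>
     0 \<le> y $ row d \<and> y $ row d \<le> (\<Sum>k=1..<d. c k * y $ row k)}"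
  obtain N where N: "?W \<subseteq> N" "N \<in> sets borel" "emeasure lborel N \<le> ennreal ((\<Sum>k=1..<d. c k) / fact CARD('d))"
    by (rule Cayley_volume[OF d row c])
  define l where "l = (\<lambda>y::real^'d. - (\<Sum>k=2..<d. y $ row k))"
  define T where "T = reset (row 1) (\<lambda>x. 1 * x $ row 1 + l x)"
  have inj: "inj_on row {1..d}" and surj: "row ` {1..d} = UNIV" using row by (auto simp: bij_betw_def)
  have rne: "row i \<noteq> row j" if "i \<in> {1..d}" "j \<in> {1..d}" "i \<noteq> j" for i j
    using inj_on_eq_iff[OF inj that(1,2)] that(3) by simp
  have lb: "l \<in> borel_measurable borel" unfolding l_def
    by (intro borel_measurable_continuous_onI continuous_intros)
  have "l (x + axis (row 1) t) = l x" for x t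
    unfolding l_def using rne d by (intro arg_cong[where f = uminus] sum.cong) (auto simp: axis_def)
  note e = emeasure_reset[OF _ lb this N(2), of 1, folded T_def]
  have TN: "T -` N \<in> sets borel" using e(2) by simp
  have eT: "emeasure lborel (T -` N) \<le> ennreal ((\<Sum>k=1..<d. c k) / fact CARD('d))" using e(1) N(3) by simp
  have T1: "T y $ row 1 = y $ row 1 - (\<Sum>k=2..<d. y $ row k)" for y by (simp add: T_def reset_def l_def)
  have Ti: "T y $ row k = y $ row k" if "k \<in> {2..d}" for y k
    using rne[of k 1] that d by (simp add: T_def reset_def)
  have lin: "linear T"
    by (rule linearI) (auto simp: T_def reset_def l_def vec_eq_iff sum.distrib sum_distrib_left algebra_simps)
  have convW: "convex ?W"
  proof (rule convexI)
    fix x y :: "real^'d" and u v :: real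
    assume x: "x \<in> ?W" and y: "y \<in> ?W" and uv: "0 \<le> u" "0 \<le> v" "u + v = 1"
    have "(\<Sum>i\<in>UNIV - {row d}. u * x $ i + v * y $ i) \<le> u * 1 + v * 1"
      unfolding sum.distrib sum_distrib_left[symmetric] using x y uv by (intro add_mono mult_left_mono) auto
    moreover have "u * x $ row d + v * y $ row d \<le> u * (\<Sum>k=1..<d. c k * x $ row k) + v * (\<Sum>k=1..<d. c k * y $ row k)"
      using x y uv by (intro add_mono mult_left_mono) auto
    moreover have "u * (\<Sum>k=1..<d. c k * x $ row k) + v * (\<Sum>k=1..<d. c k * y $ row k) = (\<Sum>k=1..<d. c k * (u * x $ row k + v * y $ row k))"
      by (simp add: sum_distrib_left sum.distrib algebra_simps)
    ultimately show "u *\<^sub>R x + v *\<^sub>R y \<in> ?W" using x y uv by (auto simp: add_nonneg_nonneg)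
  qed
  have "convex hull V \<subseteq> T -` ?W"
  proof (rule hull_minimal)
    show "convex (T -` ?W)" by (rule convex_linear_vimage[OF lin convW])
    show "V \<subseteq> T -` ?W"
    proof
      fix v assume v: "v \<in> V"
      note p = pts[OF v]
      have split: "{1..<d} = insert 1 {2..<d}" using d by auto
      have UN: "UNIV - {row d} = row ` {1..<d}"
      proof -
        have "UNIV - {row d} = row ` {1..d} - row ` {d}" using surj by simp
        also have "\<dots> = row ` ({1..d} - {d})" using inj d by (intro inj_on_image_set_diff[symmetric]) auto
        also have "{1..d} - {d} = {1..<d}" by auto
        finally show ?thesis .
      qed
      have injd: "inj_on row {1..<d}" using inj by (rule inj_on_subset) auto
      have "T v $ i \<ge> 0" if "i \<noteq> row d" for i
      proof -
        have "i \<in> row ` {1..<d}" using that UN by blast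
        then obtain k where k: "k \<in> {1..<d}" "i = row k" by auto
        show ?thesis
        proof (cases "k = 1")
          case False
          then show ?thesis using k p Ti[of k v] that by auto
        qed (use k p T1 in auto)
      qed
      moreover have "(\<Sum>i\<in>UNIV - {row d}. T v $ i) = v $ row 1"
      proof -
        have "(\<Sum>i\<in>UNIV - {row d}. T v $ i) = (\<Sum>k\<in>{1..<d}. T v $ row k)"
          unfolding UN using injd by (simp add: sum.reindex)
        also have "\<dots> = T v $ row 1 + (\<Sum>k=2..<d. T v $ row k)" unfolding split by simp
        also have "(\<Sum>k=2..<d. T v $ row k) = (\<Sum>k=2..<d. v $ row k)" by (intro sum.cong) (auto simp: Ti)
        finally show ?thesis using T1[of v] by simp
      qed
      moreover have "(\<Sum>k=1..<d. c k * T v $ row k) = c 1 * (v $ row 1 - (\<Sum>k=2..<d. v $ row k)) + (\<Sum>k=2..<d. c k * v $ row k)"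
      proof -
        have "(\<Sum>k=1..<d. c k * T v $ row k) = c 1 * T v $ row 1 + (\<Sum>k=2..<d. c k * T v $ row k)" unfolding split by simp
        also have "(\<Sum>k=2..<d. c k * T v $ row k) = (\<Sum>k=2..<d. c k * v $ row k)" by (intro sum.cong) (auto simp: Ti)
        finally show ?thesis using T1[of v] by simp
      qed
      moreover have "T v $ row d = v $ row d" using Ti[of d v] d by simp
      ultimately show "v \<in> T -` ?W" using p by simp
    qed
  qed
  also have "\<dots> \<subseteq> T -` N" using N(1) by auto
  finally have sub: "convex hull V \<subseteq> T -` N" .
  have "emeasure lebesgue (convex hull V) \<le> emeasure lebesgue (T -` N)"
    using TN sub by (intro emeasure_mono) auto
  also have "\<dots> = emeasure lborel (T -` N)" using TN by simp
  finally have "emeasure lebesgue (convex hull V) \<le> ennreal ((\<Sum>k=1..<d. c k) / fact CARD('d))" using eT by (rule order_trans)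
  then have "measure lebesgue (convex hull V) \<le> enn2real (ennreal ((\<Sum>k=1..<d. c k) / fact CARD('d)))"
    unfolding measure_def by (intro enn2real_mono) auto
  then show ?thesis using c by (simp add: sum_nonneg less_imp_le)
qed

section \<open>The rank jump\<close>

context quartic_config
begin

lemma weights_partition: "of_nat (wd j) + (\<Sum>k\<in>K. of_nat (wk k j)) = (1 :: 'a::semiring_1)"
proof (cases rule: index_cases[of j])
  case (5 l)
  have "(\<Sum>k\<in>K. of_nat (wk k j)) = (\<Sum>k\<in>K. if k = l then 1 else (0::'a))"
    using 5 by (intro sum.cong) auto
  then show ?thesis using 5 finK by simp
next
  case (6 l)
  have "(\<Sum>k\<in>K. of_nat (wk k j)) = (\<Sum>k\<in>K. if k = l then 1 else (0::'a))"
    using 6 by (intro sum.cong) auto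
  then show ?thesis using 6 finK by simp
qed (auto intro!: sum.neutral)

lemma wd_wp_bound: "wd j = 1 \<and> wp j \<le> 4 \<or> wd j = 0 \<and> wp j \<le> 1"
  by (cases rule: index_cases[of j]) auto

lemma sum_partition:
  fixes g :: "'n \<Rightarrow> 'a::comm_semiring_1"
  shows "(\<Sum>j\<in>UNIV. g j) = (\<Sum>j\<in>UNIV. of_nat (wd j) * g j) + (\<Sum>k\<in>K. \<Sum>j\<in>UNIV. of_nat (wk k j) * g j)"
proof -
  have "(\<Sum>j\<in>UNIV. g j) = (\<Sum>j\<in>UNIV. (of_nat (wd j) + (\<Sum>k\<in>K. of_nat (wk k j))) * g j)"
    by (simp add: weights_partition)
  also have "\<dots> = (\<Sum>j\<in>UNIV. of_nat (wd j) * g j) + (\<Sum>j\<in>UNIV. \<Sum>k\<in>K. of_nat (wk k j) * g j)"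
    by (simp add: distrib_right sum.distrib sum_distrib_right)
  also have "(\<Sum>j\<in>UNIV. \<Sum>k\<in>K. of_nat (wk k j) * g j) = (\<Sum>k\<in>K. \<Sum>j\<in>UNIV. of_nat (wk k j) * g j)"
    by (rule sum.swap)
  finally show ?thesis .
qed

text \<open>The first row of the matrix is the sum of all weights \<open>wd\<close> and \<open>wk k\<close>, so the rows and the weights define the
  same kernel and the same homogeneity conditions.\<close>

lemma hypergeometric_solutions_eq:
  fixes A :: "int^'n^'d" and \<beta> :: "complex^'d" and rt rd :: 'd and rk :: "nat \<Rightarrow> 'd"
  assumes rows: "\<And>i. i = rt \<or> i = rd \<or> (\<exists>k\<in>K. i = rk k)"
    and A1: "\<And>j. A $ rt $ j = 1" and Ad: "\<And>j. A $ rd $ j = int (wp j)" and Ak: "\<And>k j. k \<in> K \<Longrightarrow> A $ rk k $ j = int (wk k j)"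
    and b: "\<beta> $ rt = 1" "\<beta> $ rd = 2" "\<And>k. k \<in> K \<Longrightarrow> \<beta> $ rk k = 0" and U: "open U"
  shows "hypergeometric_solutions A \<beta> U = {f. sol U f \<and> (\<forall>x. x \<notin> U \<longrightarrow> f x = 0)}"
proof -
  have ker: "A *v u = 0 \<longleftrightarrow> (\<forall>w \<in> {wd, wp} \<union> wk ` K. (\<Sum>j\<in>UNIV. int (w j) * u $ j) = 0)" for u
  proof -
    have "A *v u = 0 \<longleftrightarrow> (\<forall>i. (\<Sum>j\<in>UNIV. A $ i $ j * u $ j) = 0)"
      by (simp add: matrix_vector_mult_def vec_eq_iff)
    also have "\<dots> \<longleftrightarrow> (\<Sum>j\<in>UNIV. u $ j) = 0 \<and> (\<Sum>j\<in>UNIV. int (wp j) * u $ j) = 0 \<and> (\<forall>k\<in>K. (\<Sum>j\<in>UNIV. int (wk k j) * u $ j) = 0)"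
    proof
      assume L: "\<forall>i. (\<Sum>j\<in>UNIV. A $ i $ j * u $ j) = 0"
      show "(\<Sum>j\<in>UNIV. u $ j) = 0 \<and> (\<Sum>j\<in>UNIV. int (wp j) * u $ j) = 0 \<and> (\<forall>k\<in>K. (\<Sum>j\<in>UNIV. int (wk k j) * u $ j) = 0)"
      proof (intro conjI ballI)
        fix k assume "k \<in> K"
        then show "(\<Sum>j\<in>UNIV. int (wk k j) * u $ j) = 0" using L[rule_format, of "rk k"] by (simp add: Ak)
      qed (use L[rule_format, of rt] L[rule_format, of rd] in \<open>simp_all add: A1 Ad\<close>)
    next
      assume R: "(\<Sum>j\<in>UNIV. u $ j) = 0 \<and> (\<Sum>j\<in>UNIV. int (wp j) * u $ j) = 0 \<and> (\<forall>k\<in>K. (\<Sum>j\<in>UNIV. int (wk k j) * u $ j) = 0)"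
      show "\<forall>i. (\<Sum>j\<in>UNIV. A $ i $ j * u $ j) = 0"
      proof
        fix i show "(\<Sum>j\<in>UNIV. A $ i $ j * u $ j) = 0" using rows[of i] R by (auto simp: A1 Ad Ak)
      qed
    qed
    also have "\<dots> \<longleftrightarrow> (\<forall>w \<in> {wd, wp} \<union> wk ` K. (\<Sum>j\<in>UNIV. int (w j) * u $ j) = 0)"
      unfolding sum_partition[of "\<lambda>j. u $ j"] by auto
    finally show ?thesis .
  qed
  have hom: "(\<forall>i. \<forall>x\<in>U. (\<Sum>j\<in>UNIV. of_int (A $ i $ j) * x $ j * pd j f x) = \<beta> $ i * f x) \<longleftrightarrow>
     Euler U wd 1 f \<and> Euler U wp 2 f \<and> (\<forall>k\<in>K. Euler U (wk k) 0 f)" for f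
  proof -
    have "(\<forall>i. \<forall>x\<in>U. (\<Sum>j\<in>UNIV. of_int (A $ i $ j) * x $ j * pd j f x) = \<beta> $ i * f x) \<longleftrightarrow>
      (\<forall>x\<in>U. (\<Sum>j\<in>UNIV. x $ j * pd j f x) = f x) \<and> Euler U wp 2 f \<and> (\<forall>k\<in>K. Euler U (wk k) 0 f)" (is "?L \<longleftrightarrow> ?R")
    proof
      assume L: ?L
      show ?R unfolding Euler_def
      proof (intro conjI ballI)
        fix k x assume "k \<in> K" "x \<in> U"
        then show "(\<Sum>j\<in>UNIV. of_nat (wk k j) * x $ j * pd j f x) = 0 * f x"
          using L[rule_format, of x "rk k"] by (simp add: Ak b)
      next
        fix x assume x: "x \<in> U"
        show "(\<Sum>j\<in>UNIV. x $ j * pd j f x) = f x" using L[rule_format, OF x, of rt] by (simp add: A1 b)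
        show "(\<Sum>j\<in>UNIV. of_nat (wp j) * x $ j * pd j f x) = 2 * f x"
          using L[rule_format, OF x, of rd] by (simp add: Ad b)
      qed
    next
      assume R: ?R
      show ?L
      proof (intro allI ballI)
        fix i x assume "x \<in> U"
        then show "(\<Sum>j\<in>UNIV. of_int (A $ i $ j) * x $ j * pd j f x) = \<beta> $ i * f x"
          using rows[of i] R by (auto simp: A1 Ad Ak b Euler_def)
      qed
    qed
    also have "\<dots> \<longleftrightarrow> Euler U wd 1 f \<and> Euler U wp 2 f \<and> (\<forall>k\<in>K. Euler U (wk k) 0 f)"
    proof -
      have "(\<Sum>j\<in>UNIV. x $ j * pd j f x) = (\<Sum>j\<in>UNIV. of_nat (wd j) * x $ j * pd j f x)"
        if "\<forall>k\<in>K. Euler U (wk k) 0 f" "x \<in> U" for x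
        unfolding sum_partition[of "\<lambda>j. x $ j * pd j f x"] using that by (simp add: Euler_def mult.assoc)
      then show ?thesis by (auto simp: Euler_def)
    qed
    finally show ?thesis .
  qed
  show ?thesis
    unfolding hypergeometric_solutions_def hom ker sol_def using toric_iff[OF _ U] by auto
qed

end

theorem theorem3p1:
  fixes d :: nat
    and row :: "nat \<Rightarrow> 'd::finite" and col :: "nat \<Rightarrow> 'n::finite"
    and e :: "nat \<Rightarrow> int^'d"
    and A :: "int^'n^'d" and \<beta> :: "complex^'d"
  assumes "d \<ge> 3"
    and "bij_betw row {1..d} UNIV" and "bij_betw col {1..2 * d} UNIV"
    and "\<And>i. e i = axis (row i) 1"
    and "column (col 1) A = e 1"
    and "column (col 2) A = e 1 + e d"
    and "column (col 3) A = e 1 + 3 *s e d"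
    and "column (col 4) A = e 1 + 4 *s e d"
    and "\<And>k. 3 \<le> k \<Longrightarrow> k \<le> d \<Longrightarrow> column (col (2 * k - 1)) A = e 1 + e (k - 1)"
    and "\<And>k. 3 \<le> k \<Longrightarrow> k \<le> d \<Longrightarrow> column (col (2 * k)) A = e 1 + e (k - 1) + e d"
    and "\<beta> = axis (row 1) 1 + axis (row d) 2"
  shows "real (hypergeometric_rank A \<beta>) - simplicial_volume A \<ge> real d - 1"
proof -
  note d = assms(1) and row = assms(2) and col = assms(3) and e = assms(4)
  define ia where "ia = (\<lambda>k. col (2 * k - 1))"
  define ib where "ib = (\<lambda>k. col (2 * k))"
  let ?K = "{3..d}"
  have cne: "col i = col j \<longleftrightarrow> i = j" if "i \<in> {1..2 * d}" "j \<in> {1..2 * d}" for i j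
    using inj_on_eq_iff[OF bij_betw_imp_inj_on[OF col] that] .
  have rne: "row i = row j \<longleftrightarrow> i = j" if "i \<in> {1..d}" "j \<in> {1..d}" for i j
    using inj_on_eq_iff[OF bij_betw_imp_inj_on[OF row] that] .
  have ia_col: "ia k = col c \<longleftrightarrow> 2 * k - 1 = c" and ib_col: "ib k = col c \<longleftrightarrow> 2 * k = c"
    if "k \<in> ?K" "c \<in> {1..2 * d}" for k c
    unfolding ia_def ib_def by (rule cne; use that in auto)+
  interpret C: quartic_config "col 1" "col 2" "col 3" "col 4" ia ib ?K
  proof
    show "finite ?K" by simp
    show "distinct [col 1, col 2, col 3, col 4]" using d by (simp add: cne)
    show "ia k \<notin> {col 1, col 2, col 3, col 4}" "ib k \<notin> {col 1, col 2, col 3, col 4}" if "k \<in> ?K" for k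
      using that d by (auto simp: ia_col ib_col)
    show "ia k \<noteq> ib l" if "k \<in> ?K" "l \<in> ?K" for k l
    proof -
      have "2 * k - 1 \<noteq> 2 * l" using that by (auto; presburger)
      moreover have "2 * l \<in> {1..2 * d}" using that by auto
      ultimately show ?thesis using ia_col[OF that(1), of "2 * l"] by (simp add: ib_def)
    qed
    show "inj_on ia ?K"
    proof (rule inj_onI)
      fix k l assume kl: "k \<in> ?K" "l \<in> ?K" "ia k = ia l"
      have "2 * l - 1 \<in> {1..2 * d}" using kl by auto
      then have "2 * k - 1 = 2 * l - 1" using ia_col[OF kl(1), of "2 * l - 1"] kl(3) by (simp add: ia_def)
      then show "k = l" using kl by auto
    qed
    show "inj_on ib ?K"
    proof (rule inj_onI)
      fix k l assume kl: "k \<in> ?K" "l \<in> ?K" "ib k = ib l"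
      have "2 * l \<in> {1..2 * d}" using kl by auto
      then show "k = l" using ib_col[OF kl(1), of "2 * l"] kl(3) by (simp add: ib_def)
    qed
    show "UNIV = {col 1, col 2, col 3, col 4} \<union> ia ` ?K \<union> ib ` ?K"
    proof -
      have "col c \<in> {col 1, col 2, col 3, col 4} \<union> ia ` ?K \<union> ib ` ?K" if "c \<in> {1..2 * d}" for c
      proof (cases "c \<le> 4")
        case True
        then have "c = 1 \<or> c = 2 \<or> c = 3 \<or> c = 4" using that by auto
        then show ?thesis by auto
      next
        case False
        show ?thesis
        proof (cases "even c")
          case True
          then obtain k where "c = 2 * k" by blast
          then show ?thesis using False that by (auto simp: ib_def)
        next
          case odd: False
          then obtain k where k: "c = 2 * k + 1" by (auto elim: oddE)
          then have "col c = ia (k + 1)" "k + 1 \<in> ?K" using False that by (auto simp: ia_def)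
          then show ?thesis by blast
        qed
      qed
      moreover have "col ` {1..2 * d} = UNIV" using col by (simp add: bij_betw_def)
      ultimately have "UNIV \<subseteq> {col 1, col 2, col 3, col 4} \<union> ia ` ?K \<union> ib ` ?K"
        by (metis (no_types, lifting) image_subsetI)
      then show ?thesis by (rule equalityI[OF _ subset_UNIV])
    qed
  qed
  have en: "A $ i $ j = column j A $ i" for i j by (simp add: column_def)
  have ax: "e k $ row l = (if k = l then 1 else 0)" if "k \<in> {1..d}" "l \<in> {1..d}" for k l
    using rne[OF that] by (auto simp: e axis_def)
  have ax': "e (k - 1) $ row l = (if k = l + 1 then 1 else 0)" if "k \<in> ?K" "l \<in> {1..d}" for k l
  proof -
    have "k - 1 \<in> {1..d}" "k - 1 = l \<longleftrightarrow> k = l + 1" using that by auto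
    then show ?thesis using ax[of "k - 1" l] that by simp
  qed
  have cols: "column (col 1) A = e 1" "column (col 2) A = e 1 + e d" "column (col 3) A = e 1 + 3 *s e d"
    "column (col 4) A = e 1 + 4 *s e d" "\<And>k. k \<in> ?K \<Longrightarrow> column (ia k) A = e 1 + e (k - 1)"
    "\<And>k. k \<in> ?K \<Longrightarrow> column (ib k) A = e 1 + e (k - 1) + e d"
    using assms(5-10) by (auto simp: ia_def ib_def)
  have one: "1 \<in> {1..d}" "d \<in> {1..d}" using d by auto
  have A1: "A $ row 1 $ j = 1" for j
    unfolding en by (cases rule: C.index_cases[of j]) (use d in \<open>auto simp: cols ax ax' simp del: One_nat_def\<close>)
  have Ad: "A $ row d $ j = int (C.wp j)" for j
    unfolding en by (cases rule: C.index_cases[of j]) (use d in \<open>auto simp: cols ax ax' simp del: One_nat_def\<close>)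
  have Ak: "A $ row (k - 1) $ j = int (C.wk k j)" if k: "k \<in> ?K" for k j
  proof -
    have k1: "k - 1 \<in> {1..d}" "k - 1 \<noteq> 1" "k - 1 \<noteq> d" using k by auto
    have "e 1 $ row (k - 1) = 0" "e d $ row (k - 1) = 0"
      using ax[OF one(1) k1(1)] ax[OF one(2) k1(1)] k1 by auto
    moreover have "e (l - 1) $ row (k - 1) = (if l = k then 1 else 0)" if "l \<in> ?K" for l
      using ax'[OF that k1(1)] k by simp
    ultimately show ?thesis
      unfolding en by (cases rule: C.index_cases[of j]) (use k in \<open>auto simp: cols simp del: One_nat_def\<close>)
  qed
  have rows: "i = row 1 \<or> i = row d \<or> (\<exists>k\<in>?K. i = row (k - 1))" for i
  proof -
    have "i \<in> row ` {1..d}" using row by (simp add: bij_betw_def)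
    then obtain r where r: "r \<in> {1..d}" "i = row r" by blast
    then have "r = 1 \<or> r = d \<or> (r + 1 \<in> ?K \<and> i = row (r + 1 - 1))" by auto
    then show ?thesis using r by blast
  qed
  have rk: "row (k - 1) \<noteq> row 1" "row (k - 1) \<noteq> row d" if "k \<in> ?K" for k
    by (subst rne; use that in auto)+
  have b: "\<beta> $ row 1 = 1" "\<beta> $ row d = 2" "\<And>k. k \<in> ?K \<Longrightarrow> \<beta> $ row (k - 1) = 0"
    using d rne[OF one] rk by (auto simp: assms(11) axis_def)
  have rank: "hypergeometric_rank A \<beta> = 2 * card ?K + 5"
  proof (rule hypergeometric_rank_eqI[OF C.sing_polynomial C.sing_nonzero])
    fix U :: "(complex^'n) set"
    assume U: "open U" "U \<noteq> {}" "simply_connected U" "U \<subseteq> {x. C.sing x \<noteq> 0}"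
    have "hypergeometric_solutions A \<beta> U = {f. C.sol U f \<and> (\<forall>x. x \<notin> U \<longrightarrow> f x = 0)}"
      by (rule C.hypergeometric_solutions_eq[where rt = "row 1" and rd = "row d" and rk = "\<lambda>k. row (k - 1)"])
         (use rows A1 Ad Ak b U in auto)
    then show "has_finite_dim (hypergeometric_solutions A \<beta> U) (2 * card ?K + 5)"
      using C.solution_space_dim[OF U(1,3,2,4)] by simp
  qed
  have card_d: "CARD('d) = d" using bij_betw_same_card[OF row] by simp
  define V where "V = insert 0 (range (\<lambda>j. \<chi> i. real_of_int (A $ i $ j))) "
  \<comment> \<open>the Newton segment of the quartic has length 4, those of the linear polynomials have length 1\<close>
  define c :: "nat \<Rightarrow> real" where "c = (\<lambda>k. if k = 1 then 4 else 1)"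
  have "measure lebesgue (convex hull V) \<le> (\<Sum>k=1..<d. c k) / fact CARD('d)"
  proof (rule hull_volume[OF _ row])
    fix v assume "v \<in> V"
    then consider "v = 0" | j where "v = (\<chi> i. real_of_int (A $ i $ j))" by (auto simp: V_def)
    then show "(\<forall>i. i \<noteq> row d \<longrightarrow> 0 \<le> v $ i) \<and> (\<Sum>k=2..<d. v $ row k) \<le> v $ row 1 \<and> v $ row 1 \<le> 1 \<and>
       0 \<le> v $ row d \<and> v $ row d \<le> c 1 * (v $ row 1 - (\<Sum>k=2..<d. v $ row k)) + (\<Sum>k=2..<d. c k * v $ row k)"
    proof cases
      case (2 j)
      have v: "v $ row 1 = 1" "v $ row d = of_nat (C.wp j)" "\<And>k. k \<in> ?K \<Longrightarrow> v $ row (k - 1) = of_nat (C.wk k j)"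
        using A1 Ad Ak by (simp_all add: 2)
      have pos: "0 \<le> v $ i" for i using rows[of i] v by auto
      have S: "(\<Sum>k=2..<d. v $ row k) = (\<Sum>k\<in>?K. of_nat (C.wk k j))"
        by (rule sum.reindex_bij_witness[of _ "\<lambda>k. k - 1" "\<lambda>k. k + 1"]) (use v(3)[of "k + 1" for k] in auto)
      have S': "(\<Sum>k=2..<d. c k * v $ row k) = (\<Sum>k=2..<d. v $ row k)"
        by (intro sum.cong) (auto simp: c_def)
      have "of_nat (C.wd j) + (\<Sum>k\<in>?K. of_nat (C.wk k j)) = (1::real)" by (rule C.weights_partition)
      moreover have "C.wd j = 1 \<and> C.wp j \<le> 4 \<or> C.wd j = 0 \<and> C.wp j \<le> 1" by (rule C.wd_wp_bound)
      ultimately show ?thesis using pos v S' unfolding S by (elim disjE conjE) (auto simp: c_def)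
    qed (auto simp: c_def)
  qed (use d in \<open>auto simp: c_def V_def\<close>)
  moreover have "(\<Sum>k=1..<d. c k) = real d + 2"
  proof -
    have "{1..<d} = insert 1 {2..<d}" using d by auto
    moreover have "(\<Sum>k=2..<d. c k) = (\<Sum>k=2..<d. 1)" by (intro sum.cong) (auto simp: c_def)
    ultimately show ?thesis using d by (simp add: c_def of_nat_diff)
  qed
  ultimately have "simplicial_volume A \<le> real d + 2"
    unfolding simplicial_volume_def V_def[symmetric] card_d by (simp add: field_simps)
  moreover have "real (hypergeometric_rank A \<beta>) = 2 * real d + 1"
    unfolding rank using d by (simp add: of_nat_diff)
  ultimately show ?thesis by simp
qed

end
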